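(* Let $\alpha\in(0,1)$, and set $s_\alpha=1$ if $\alpha\in[\frac12,1)$ and $s_\alpha=2-2\alpha$ if $\alpha\in(0,\frac12)$. Let $s>s_\alpha$ and $r=(\frac32+\alpha)^-$, i.e. $r=\frac32+\alpha-\epsilon$ with $0<\epsilon\ll1$ (sufficiently small, depending on $\alpha$ and $s$). Let $u\in C([0,T];Z_{s,r})$ be a solution of $$\partial_t u+\partial_x u+D^{\alpha}\partial_t u+\partial_x(u^2)=0,\qquad x\in\mathbb R.$$ Suppose that at two times $0\le t_1<t_2<T$ it holds that $u(t_j)\in Z_{s,\frac32+\alpha}$ for $j=1,2$. Then $$\hat u(0,t_1)=\int_{\mathbb R}u(x,t_1)\,dx=-\frac{1}{t_2-t_1}\int_{t_1}^{t_2}\int_{\mathbb R}(u(x,\tau))^2\,dx\,d\tau .$$ In particular, $\int_{\mathbb R}u(x,t_1)\,dx\ge0$ if and only if $u$ is identically zero on $[t_1,\infty)$.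
   Context: Functions are real-valued. $D^\alpha=(-\partial_x^2)^{\alpha/2}$ is the Fourier multiplier with symbol $|\xi|^\alpha$. $H^s(\mathbb R)$ is the $L^2$-based Sobolev space, and $Z_{s,r}:=H^s(\mathbb R)\cap L^2(|x|^{2r}\,dx)$. $\hat u(\xi,t)$ is the Fourier transform in $x$. Let $A=-\partial_x(1+D^\alpha)^{-1}$ (symbol $-i\xi/(1+|\xi|^\alpha)$) and let $\{e^{tA}\}$ be the unitary group it generates. The equation is equivalent to $\partial_t u-Au-A(u^2)=0$, and a solution on $[0,T]$ with initial condition $\varphi=u(0)$ is understood through $u(t)=e^{tA}\varphi+\int_0^t e^{(t-\tau)A}A(u^2)(\tau)\,d\tau$. Solutions are unique in $C([0,T];H^s)$ and the null solution is global; thus "identically zero on $[t_1,\infty)$" is equivalent to $u\equiv0$ on $[t_1,t_2]$, the solution then being continued by zero for all later times. *)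

theory Defs
  imports "HOL-Analysis.Analysis"
begin

text \<open>Elements of \<open>L\<^sup>2\<close> are represented by Borel functions; all notions below are invariant under
  changes on null sets.\<close>

definition square_integrable :: "(real \<Rightarrow> 'a::real_normed_vector) \<Rightarrow> bool" where
  "square_integrable f \<longleftrightarrow> f \<in> borel_measurable lborel \<and> integrable lborel (\<lambda>x. (norm (f x))\<^sup>2)"

definition L2norm :: "(real \<Rightarrow> 'a::real_normed_vector) \<Rightarrow> real" where
  "L2norm f = sqrt (\<integral>x. (norm (f x))\<^sup>2 \<partial>lborel)"

definition fourier :: "(real \<Rightarrow> real) \<Rightarrow> real \<Rightarrow> complex" where
  "fourier f \<xi> = (\<integral>x. exp (- (\<i> * complex_of_real (x * \<xi>))) * complex_of_real (f x) \<partial>lborel)"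

text \<open>The Fourier--Plancherel transform: the \<open>L\<^sup>2\<close> limit of the transforms of the truncations of \<open>f\<close>
  to \<open>[-R, R]\<close>. By Plancherel's theorem it exists for every square integrable \<open>f\<close>, and it is unique
  up to null sets.\<close>

definition has_fourier_L2 :: "(real \<Rightarrow> real) \<Rightarrow> (real \<Rightarrow> complex) \<Rightarrow> bool" where
  "has_fourier_L2 f g \<longleftrightarrow> square_integrable g \<and>
     ((\<lambda>R. \<integral>\<^sup>+\<xi>. ennreal ((norm (fourier (\<lambda>x. indicator {-R..R} x * f x) \<xi> - g \<xi>))\<^sup>2) \<partial>lborel)
        \<longlongrightarrow> 0) at_top"

definition fourier_L2 :: "(real \<Rightarrow> real) \<Rightarrow> real \<Rightarrow> complex" where
  "fourier_L2 f = (SOME g. has_fourier_L2 f g)"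

text \<open>The Fourier multiplier with symbol \<open>m\<close>. It is meaningful when \<open>m (- \<xi>) = cnj (m \<xi>)\<close>, so that
  real functions are mapped to real functions, and when \<open>m\<close> times the transform of \<open>f\<close> is square
  integrable; the result is then unique up to null sets.\<close>

definition fourier_multiplier :: "(real \<Rightarrow> complex) \<Rightarrow> (real \<Rightarrow> real) \<Rightarrow> real \<Rightarrow> real" where
  "fourier_multiplier m f =
     (SOME g. square_integrable g \<and> (AE \<xi> in lborel. fourier_L2 g \<xi> = m \<xi> * fourier_L2 f \<xi>))"

definition Sobolev :: "real \<Rightarrow> (real \<Rightarrow> real) set" where
  "Sobolev s = {f. square_integrable f \<and>
     square_integrable (\<lambda>\<xi>. complex_of_real ((1 + \<xi>\<^sup>2) powr (s/2)) * fourier_L2 f \<xi>)}"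

definition Sobolev_norm :: "real \<Rightarrow> (real \<Rightarrow> real) \<Rightarrow> real" where
  "Sobolev_norm s f = L2norm (\<lambda>\<xi>. complex_of_real ((1 + \<xi>\<^sup>2) powr (s/2)) * fourier_L2 f \<xi>)"

definition Zspace :: "real \<Rightarrow> real \<Rightarrow> (real \<Rightarrow> real) set" where
  "Zspace s r = {f. f \<in> Sobolev s \<and> square_integrable (\<lambda>x. \<bar>x\<bar> powr r * f x)}"

definition Znorm :: "real \<Rightarrow> real \<Rightarrow> (real \<Rightarrow> real) \<Rightarrow> real" where
  "Znorm s r f = sqrt ((Sobolev_norm s f)\<^sup>2 + (L2norm (\<lambda>x. \<bar>x\<bar> powr r * f x))\<^sup>2)"

definition continuous_into_Z :: "real \<Rightarrow> real \<Rightarrow> real set \<Rightarrow> (real \<Rightarrow> real \<Rightarrow> real) \<Rightarrow> bool" where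
  "continuous_into_Z s r J u \<longleftrightarrow> (\<forall>t\<in>J. u t \<in> Zspace s r) \<and>
     (\<forall>t0\<in>J. ((\<lambda>t. Znorm s r (\<lambda>x. u t x - u t0 x)) \<longlongrightarrow> 0) (at t0 within J))"

text \<open>The \<open>L\<^sup>2\<close>-valued integral of \<open>F\<close> over \<open>S\<close> is \<open>w\<close>. As \<open>L\<^sup>2\<close> is separable, weak measurability
  together with integrability of the norm is Bochner integrability (Pettis), and the Bochner integral
  is determined by its pairings with \<open>L\<^sup>2\<close> functions.\<close>

definition has_L2_integral :: "(real \<Rightarrow> real \<Rightarrow> real) \<Rightarrow> (real \<Rightarrow> real) \<Rightarrow> real set \<Rightarrow> bool" where
  "has_L2_integral F w S \<longleftrightarrow>
     square_integrable w \<and> (\<forall>\<tau>\<in>S. square_integrable (F \<tau>)) \<and>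
     set_integrable lborel S (\<lambda>\<tau>. L2norm (F \<tau>)) \<and>
     (\<forall>g. square_integrable g \<longrightarrow>
        set_integrable lborel S (\<lambda>\<tau>. \<integral>x. F \<tau> x * g x \<partial>lborel) \<and>
        (\<integral>x. w x * g x \<partial>lborel) = (LINT \<tau>:S|lborel. (\<integral>x. F \<tau> x * g x \<partial>lborel)))"

definition symbolA :: "real \<Rightarrow> real \<Rightarrow> complex" where
  "symbolA \<alpha> \<xi> = - (\<i> * complex_of_real \<xi>) / complex_of_real (1 + \<bar>\<xi>\<bar> powr \<alpha>)"

definition opA :: "real \<Rightarrow> (real \<Rightarrow> real) \<Rightarrow> real \<Rightarrow> real" where
  "opA \<alpha> = fourier_multiplier (symbolA \<alpha>)"

definition groupA :: "real \<Rightarrow> real \<Rightarrow> (real \<Rightarrow> real) \<Rightarrow> real \<Rightarrow> real" where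
  "groupA \<alpha> t = fourier_multiplier (\<lambda>\<xi>. exp (complex_of_real t * symbolA \<alpha> \<xi>))"

text \<open>Solutions in \<open>C(J; Z\<^bsub>s,r\<^esub>)\<close> of \<open>u\<^sub>t + u\<^sub>x + D\<^sup>\<alpha> u\<^sub>t + (u\<^sup>2)\<^sub>x = 0\<close>, understood through Duhamel's
  formula. \<open>J\<close> is an interval starting at \<open>0\<close>: \<open>{0..T}\<close>, or \<open>{0..}\<close> for global solutions.\<close>

definition Z_solution ::
    "real \<Rightarrow> real \<Rightarrow> real \<Rightarrow> real set \<Rightarrow> (real \<Rightarrow> real \<Rightarrow> real) \<Rightarrow> bool" where
  "Z_solution \<alpha> s r J u \<longleftrightarrow> continuous_into_Z s r J u \<and>
     (\<forall>t\<in>J. \<exists>w. has_L2_integral (\<lambda>\<tau>. groupA \<alpha> (t - \<tau>) (opA \<alpha> (\<lambda>x. (u \<tau> x)\<^sup>2))) w {0..t} \<and>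
        (AE x in lborel. u t x = groupA \<alpha> t (u 0) x + w x))"

definition s_crit :: "real \<Rightarrow> real" where
  "s_crit \<alpha> = (if \<alpha> \<ge> 1/2 then 1 else 2 - 2 * \<alpha>)"

end

(*
  Write U for the Fourier transform of u in x, N for that of u^2, and m for the symbol of A, so that
  U(t2) = exp((t2-t1) m) U(t1) + m int_{t1}^{t2} exp((t2-tau) m) N(tau) dtau. Since m(xi) = -i xi + i xi |xi|^alpha + ...
  near 0, the difference U(t2) - U(t1) is m(xi) K + O(xi^2) with K = (t2-t1) U(t1)(0) + int_{t1}^{t2} N(tau)(0) dtau.
  The weight |x|^(3/2+alpha) on u(t2) - u(t1) makes the second differences of its transform at 0 of size o(h^(1+alpha)),
  whereas those of m are of exact order h^(1+alpha); hence K = 0, which is the identity.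
  If int u(t1) >= 0, then int int u^2 = 0 and u(t1) = 0; conservation of int (1+|xi|^alpha) |U|^2 keeps u at zero afterwards.
*)

theory Submission
  imports Defs "HOL-Probability.Sinc_Integral" "HOL-Probability.Characteristic_Functions"
begin

section \<open>Square integrable functions\<close>

text \<open>The argument evaluates transforms at the single frequency 0, whereas
  \<open>fourier_L2\<close>, the multipliers and the Duhamel integral are determined only almost
  everywhere. The bridge is continuity: for s > 1 and r \<ge> 1 the functions u(t) and u(t)^2 are
  integrable, so U and N are jointly continuous in time and frequency, and Duhamel's formula, at
  first a statement about L2 pairings, holds at every frequency. Plancherel theory is developed from
  the definitions for this purpose. The second difference uses the nodes 0, h, 2h. The symmetric one
  at -h, 0, h would see nothing, because m is odd. The one-sided one annihilates constants and the
  linear part -i xi of m and keeps i xi |xi|^alpha. A remainder O(xi^2) is negligible against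
  h^(1+alpha) because alpha < 1. The bound 1/2 for epsilon gives r > 1 + alpha, so |x| u^2 is
  integrable and N is Lipschitz in the frequency. The energy identity is derived for each frequency
  separately and integrated afterwards, so no time derivative of a function-valued map is
  needed.\<close>

lemma borel_measurable_square_integrable:
  "square_integrable f \<Longrightarrow> f \<in> borel_measurable borel"
  by (simp add: square_integrable_def)

lemma integrable_square_integrable:
  "square_integrable f \<Longrightarrow> integrable lborel (\<lambda>x. (norm (f x))\<^sup>2)"
  by (simp add: square_integrable_def)

lemma L2norm_nonneg [simp]: "0 \<le> L2norm f"
  by (simp add: L2norm_def)

lemma L2norm_square: "(L2norm f)\<^sup>2 = (\<integral>x. (norm (f x))\<^sup>2 \<partial>lborel)"
  by (simp add: L2norm_def)

lemma nn_integral_square: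
  assumes "square_integrable f"
  shows "(\<integral>\<^sup>+x. ennreal ((norm (f x))\<^sup>2) \<partial>lborel) = ennreal ((L2norm f)\<^sup>2)"
  using nn_integral_eq_integral[OF integrable_square_integrable[OF assms]] by (simp add: L2norm_square)

lemma square_integrable_nn:
  assumes "f \<in> borel_measurable borel" "(\<integral>\<^sup>+x. ennreal ((norm (f x))\<^sup>2) \<partial>lborel) \<le> ennreal C"
  shows "square_integrable f"
  unfolding square_integrable_def
proof
  show "integrable lborel (\<lambda>x. (norm (f x))\<^sup>2)"
    using assms by (intro integrableI_bounded) (auto intro: le_less_trans)
qed (use assms in simp)

lemma L2norm_le_nn:
  assumes "f \<in> borel_measurable borel" "(\<integral>\<^sup>+x. ennreal ((norm (f x))\<^sup>2) \<partial>lborel) \<le> ennreal (C\<^sup>2)" "0 \<le> C"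
  shows "square_integrable f" "L2norm f \<le> C"
proof -
  show *: "square_integrable f" by (rule square_integrable_nn[OF assms(1,2)])
  have "ennreal ((L2norm f)\<^sup>2) \<le> ennreal (C\<^sup>2)" using nn_integral_square[OF *] assms(2) by simp
  then have "(L2norm f)\<^sup>2 \<le> C\<^sup>2" by (simp add: ennreal_le_iff)
  then show "L2norm f \<le> C" using assms(3) by (rule power2_le_imp_le)
qed

lemma square_integrable_dominated:
  assumes "f \<in> borel_measurable borel" "integrable lborel g" "\<And>x. (norm (f x))\<^sup>2 \<le> g x"
  shows "square_integrable f"
  unfolding square_integrable_def
  using assms(1) by (auto intro!: Bochner_Integration.integrable_bound[OF assms(2)] AE_I2 order_trans[OF assms(3)])

lemma square_integrable_le:
  assumes "f \<in> borel_measurable borel" "square_integrable g" "\<And>x. norm (f x) \<le> C * norm (g x)"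
  shows "square_integrable f"
proof (rule square_integrable_dominated[OF assms(1)])
  show "integrable lborel (\<lambda>x. C\<^sup>2 * (norm (g x))\<^sup>2)" using assms(2) by (simp add: square_integrable_def)
  show "(norm (f x))\<^sup>2 \<le> C\<^sup>2 * (norm (g x))\<^sup>2" for x
    using power_mono[OF assms(3)[of x], of 2] by (simp add: power_mult_distrib)
qed

lemma L2norm_mono:
  assumes "f \<in> borel_measurable borel" "square_integrable g" "\<And>x. norm (f x) \<le> norm (g x)"
  shows "L2norm f \<le> L2norm g"
proof -
  have "square_integrable f" using square_integrable_le[of f g 1] assms by simp
  then have "(\<integral>x. (norm (f x))\<^sup>2 \<partial>lborel) \<le> (\<integral>x. (norm (g x))\<^sup>2 \<partial>lborel)"
    using assms by (intro integral_mono) (auto simp: square_integrable_def intro: power_mono)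
  then show ?thesis by (simp add: L2norm_def)
qed

lemma square_integrable_cong_AE:
  assumes "square_integrable f" "AE x in lborel. f x = g x" "g \<in> borel_measurable borel"
  shows "square_integrable g"
proof -
  have [measurable]: "f \<in> borel_measurable borel" "g \<in> borel_measurable borel"
    using assms by (auto simp: square_integrable_def)
  have "integrable lborel (\<lambda>x. (norm (f x))\<^sup>2) = integrable lborel (\<lambda>x. (norm (g x))\<^sup>2)"
    using assms(2) by (intro integrable_cong_AE) auto
  then show ?thesis using assms by (simp add: square_integrable_def)
qed

lemma L2norm_cong_AE:
  assumes "f \<in> borel_measurable borel" "g \<in> borel_measurable borel" "AE x in lborel. f x = g x"
  shows "L2norm f = L2norm g"
proof -
  note [measurable] = assms(1,2)
  have "(\<integral>x. (norm (f x))\<^sup>2 \<partial>lborel) = (\<integral>x. (norm (g x))\<^sup>2 \<partial>lborel)"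
    using assms(3) by (intro integral_cong_AE) auto
  then show ?thesis by (simp add: L2norm_def)
qed

lemma L2norm_cong_norm:
  assumes "\<And>x. norm (f x) = norm (g x)"
  shows "L2norm f = L2norm g"
  by (simp add: L2norm_def assms)

lemma square_integrable_of_real:
  "square_integrable (\<lambda>x. complex_of_real (f x)) \<longleftrightarrow> square_integrable f"
proof -
  have "f \<in> borel_measurable borel" if "(\<lambda>x. complex_of_real (f x)) \<in> borel_measurable borel"
    using measurable_compose[OF that borel_measurable_Re] by simp
  then have "f \<in> borel_measurable borel \<longleftrightarrow> (\<lambda>x. complex_of_real (f x)) \<in> borel_measurable borel"
    using measurable_compose[OF _ borel_measurable_of_real, of f borel] by blast
  then show ?thesis by (simp add: square_integrable_def)
qed

lemma L2norm_of_real: "L2norm (\<lambda>x. complex_of_real (f x)) = L2norm f"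
  by (simp add: L2norm_def)

context
  fixes f g :: "real \<Rightarrow> 'a::{real_normed_field,banach,second_countable_topology}"
  assumes f: "square_integrable f" and g: "square_integrable g"
begin

lemma square_integrable_mult_norm: "integrable lborel (\<lambda>x. norm (f x) * norm (g x))"
proof (rule Bochner_Integration.integrable_bound)
  note [measurable] = f[THEN borel_measurable_square_integrable] g[THEN borel_measurable_square_integrable]
  show "integrable lborel (\<lambda>x. (norm (f x))\<^sup>2 + (norm (g x))\<^sup>2)"
    using f g by (simp add: square_integrable_def)
  show "AE x in lborel. norm (norm (f x) * norm (g x)) \<le> norm ((norm (f x))\<^sup>2 + (norm (g x))\<^sup>2)"
  proof (rule AE_I2)
    fix x show "norm (norm (f x) * norm (g x)) \<le> norm ((norm (f x))\<^sup>2 + (norm (g x))\<^sup>2)"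
      using sum_squares_bound[of "norm (f x)" "norm (g x)"] mult_nonneg_nonneg[OF norm_ge_zero[of "f x"] norm_ge_zero[of "g x"]]
      unfolding real_norm_def abs_mult abs_norm_cancel by (simp add: mult.assoc del: zero_le_mult_iff mult_nonneg_nonneg)
  qed
  show "(\<lambda>x. norm (f x) * norm (g x)) \<in> borel_measurable lborel" by measurable
qed

lemma square_integrable_mult: "integrable lborel (\<lambda>x. f x * g x)"
proof (rule Bochner_Integration.integrable_bound[OF square_integrable_mult_norm])
  note [measurable] = f[THEN borel_measurable_square_integrable] g[THEN borel_measurable_square_integrable]
  show "(\<lambda>x. f x * g x) \<in> borel_measurable lborel" by measurable
qed (simp add: norm_mult)

lemma L2_Cauchy_Schwarz_norm: "(\<integral>x. norm (f x) * norm (g x) \<partial>lborel) \<le> L2norm f * L2norm g"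
proof -
  note [measurable] = f[THEN borel_measurable_square_integrable] g[THEN borel_measurable_square_integrable]
  have "(ennreal (\<integral>x. norm (f x) * norm (g x) \<partial>lborel))\<^sup>2
      = (\<integral>\<^sup>+x. ennreal (norm (f x)) * ennreal (norm (g x)) \<partial>lborel)\<^sup>2"
    by (subst nn_integral_eq_integral[symmetric]) (auto simp: square_integrable_mult_norm ennreal_mult)
  also have "\<dots> \<le> (\<integral>\<^sup>+x. ennreal (norm (f x)) ^ 2 \<partial>lborel) * (\<integral>\<^sup>+x. ennreal (norm (g x)) ^ 2 \<partial>lborel)"
    by (rule Cauchy_Schwarz_nn_integral) auto
  also have "\<dots> = ennreal ((L2norm f * L2norm g)\<^sup>2)"
    using nn_integral_square[OF f] nn_integral_square[OF g]
    by (simp add: ennreal_power ennreal_mult power_mult_distrib)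
  finally have "(\<integral>x. norm (f x) * norm (g x) \<partial>lborel)\<^sup>2 \<le> (L2norm f * L2norm g)\<^sup>2"
    by (subst (asm) ennreal_power) (auto simp: ennreal_le_iff)
  then show ?thesis by (rule power2_le_imp_le) simp
qed

lemma L2_Cauchy_Schwarz: "norm (\<integral>x. f x * g x \<partial>lborel) \<le> L2norm f * L2norm g"
  using integral_norm_bound[of lborel "\<lambda>x. f x * g x"] L2_Cauchy_Schwarz_norm by (simp add: norm_mult)

lemma square_integrable_add: "square_integrable (\<lambda>x. f x + g x)"
proof (rule square_integrable_dominated)
  note [measurable] = f[THEN borel_measurable_square_integrable] g[THEN borel_measurable_square_integrable]
  show "integrable lborel (\<lambda>x. 2 * (norm (f x))\<^sup>2 + 2 * (norm (g x))\<^sup>2)"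
    using f g by (simp add: square_integrable_def)
  fix x
  have "(norm (f x + g x))\<^sup>2 \<le> (norm (f x) + norm (g x))\<^sup>2"
    by (intro power_mono norm_triangle_ineq) auto
  then show "(norm (f x + g x))\<^sup>2 \<le> 2 * (norm (f x))\<^sup>2 + 2 * (norm (g x))\<^sup>2"
    using sum_squares_bound[of "norm (f x)" "norm (g x)"] by (simp add: power2_sum)
qed (intro borel_measurable_add f[THEN borel_measurable_square_integrable] g[THEN borel_measurable_square_integrable])

lemma L2norm_triangle: "L2norm (\<lambda>x. f x + g x) \<le> L2norm f + L2norm g"
proof -
  have int: "integrable lborel (\<lambda>x. (norm (f x))\<^sup>2)" "integrable lborel (\<lambda>x. (norm (g x))\<^sup>2)"
    using f g by (auto simp: square_integrable_def)
  have "(L2norm (\<lambda>x. f x + g x))\<^sup>2 \<le>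
      (\<integral>x. (norm (f x))\<^sup>2 + (norm (g x))\<^sup>2 + 2 * (norm (f x) * norm (g x)) \<partial>lborel)"
    unfolding L2norm_square
  proof (rule integral_mono)
    show "integrable lborel (\<lambda>x. (norm (f x + g x))\<^sup>2)"
      using square_integrable_add by (simp add: square_integrable_def)
    show "integrable lborel (\<lambda>x. (norm (f x))\<^sup>2 + (norm (g x))\<^sup>2 + 2 * (norm (f x) * norm (g x)))"
      using int square_integrable_mult_norm by auto
    fix x
    have "(norm (f x + g x))\<^sup>2 \<le> (norm (f x) + norm (g x))\<^sup>2"
      by (intro power_mono norm_triangle_ineq) auto
    then show "(norm (f x + g x))\<^sup>2 \<le> (norm (f x))\<^sup>2 + (norm (g x))\<^sup>2 + 2 * (norm (f x) * norm (g x))"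
      by (simp add: power2_sum)
  qed
  also have "\<dots> = (L2norm f)\<^sup>2 + (L2norm g)\<^sup>2 + 2 * (\<integral>x. norm (f x) * norm (g x) \<partial>lborel)"
    using int square_integrable_mult_norm by (simp add: L2norm_square)
  also have "\<dots> \<le> (L2norm f + L2norm g)\<^sup>2"
    using L2_Cauchy_Schwarz_norm by (simp add: power2_sum)
  finally show ?thesis by (rule power2_le_imp_le) simp
qed

end

lemma square_integrable_cmult:
  fixes f :: "real \<Rightarrow> 'a::{real_normed_field,banach,second_countable_topology}"
  assumes "square_integrable f" shows "square_integrable (\<lambda>x. c * f x)"
proof (rule square_integrable_le[OF _ assms])
  have [measurable]: "f \<in> borel_measurable borel" by (rule borel_measurable_square_integrable[OF assms])
  show "(\<lambda>x. c * f x) \<in> borel_measurable borel" by measurable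
  show "norm (c * f x) \<le> norm c * norm (f x)" for x by (simp add: norm_mult)
qed

lemma square_integrable_uminus:
  fixes f :: "real \<Rightarrow> 'a::{real_normed_field,banach,second_countable_topology}"
  assumes "square_integrable f" shows "square_integrable (\<lambda>x. - f x)"
  using square_integrable_cmult[OF assms, of "-1"] by simp

lemma L2norm_cmult:
  fixes f :: "real \<Rightarrow> 'a::{real_normed_field,banach,second_countable_topology}"
  shows "L2norm (\<lambda>x. c * f x) = norm c * L2norm f"
  by (simp add: L2norm_def norm_mult power_mult_distrib real_sqrt_mult)

lemma L2norm_uminus [simp]: "L2norm (\<lambda>x. - f x) = L2norm f"
  by (simp add: L2norm_def)

lemma L2norm_minus_commute: "L2norm (\<lambda>x. f x - g x) = L2norm (\<lambda>x. g x - f x)"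
  by (rule L2norm_cong_norm) (rule norm_minus_commute)

lemma square_integrable_diff:
  fixes f g :: "real \<Rightarrow> 'a::{real_normed_field,banach,second_countable_topology}"
  assumes "square_integrable f" "square_integrable g"
  shows "square_integrable (\<lambda>x. f x - g x)"
  using square_integrable_add[OF assms(1) square_integrable_uminus[OF assms(2)]] by simp

lemma L2norm_triangle_diff:
  fixes f g h :: "real \<Rightarrow> 'a::{real_normed_field,banach,second_countable_topology}"
  assumes "square_integrable f" "square_integrable g" "square_integrable h"
  shows "L2norm (\<lambda>x. f x - h x) \<le> L2norm (\<lambda>x. f x - g x) + L2norm (\<lambda>x. g x - h x)"
  using L2norm_triangle[OF square_integrable_diff[OF assms(1,2)] square_integrable_diff[OF assms(2,3)]]
  by simp

lemma L2norm_diff_le: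
  fixes f g :: "real \<Rightarrow> 'a::{real_normed_field,banach,second_countable_topology}"
  assumes "square_integrable f" "square_integrable g"
  shows "\<bar>L2norm f - L2norm g\<bar> \<le> L2norm (\<lambda>x. f x - g x)"
  using L2norm_triangle[OF square_integrable_diff[OF assms] assms(2)]
    L2norm_triangle[OF square_integrable_diff[OF assms(2,1)] assms(1)]
    L2norm_minus_commute[of f g] by simp

lemma square_integrable_zero [simp]: "square_integrable (\<lambda>x. 0)"
  by (simp add: square_integrable_def)

lemma L2norm_zero [simp]: "L2norm (\<lambda>x. 0) = 0"
  by (simp add: L2norm_def)

lemma L2norm_eq_0:
  assumes "square_integrable f" "L2norm f = 0"
  shows "AE x in lborel. f x = 0"
proof -
  have [measurable]: "f \<in> borel_measurable borel" using assms by (simp add: square_integrable_def)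
  have "(\<integral>\<^sup>+x. ennreal ((norm (f x))\<^sup>2) \<partial>lborel) = 0"
    using nn_integral_square[OF assms(1)] assms(2) by simp
  then show ?thesis by (subst (asm) nn_integral_0_iff_AE) auto
qed

lemma square_integrable_bounded_mult:
  fixes f m :: "real \<Rightarrow> 'a::{real_normed_field,banach,second_countable_topology}"
  assumes "square_integrable f" "m \<in> borel_measurable borel" "\<And>x. norm (m x) \<le> C"
  shows "square_integrable (\<lambda>x. m x * f x)"
proof (rule square_integrable_le[OF _ assms(1)])
  have [measurable]: "f \<in> borel_measurable borel" using assms by (simp add: square_integrable_def)
  note [measurable] = assms(2)
  show "(\<lambda>x. m x * f x) \<in> borel_measurable borel" by measurable
  show "norm (m x * f x) \<le> C * norm (f x)" for x
    using assms(3)[of x] by (auto simp: norm_mult intro: mult_right_mono)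
qed

lemma square_integrable_reflect:
  fixes f :: "real \<Rightarrow> 'a::{real_normed_field,banach,second_countable_topology}"
  assumes "square_integrable f" shows "square_integrable (\<lambda>x. f (- x))"
  using lborel_integrable_real_affine[OF integrable_square_integrable[OF assms], of "-1" 0]
    measurable_compose[OF borel_measurable_uminus[OF measurable_ident] borel_measurable_square_integrable[OF assms]]
  by (simp add: square_integrable_def)

lemma L2norm_reflect: "L2norm (\<lambda>x. f (- x)) = L2norm f"
  unfolding L2norm_def
  using lborel_integral_real_affine[of "-1" "\<lambda>x. (norm (f x))\<^sup>2" 0] by simp

lemma AE_lborel_reflect:
  assumes "AE x in lborel. P (x::real)" "Measurable.pred borel P"
  shows "AE x in lborel. P (- x)"
proof -
  have "AE x in distr lborel borel uminus. P x"
    by (subst lborel_distr_uminus) (rule assms(1))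
  then show ?thesis using assms(2) by (subst (asm) AE_distr_iff) auto
qed

section \<open>Limits in L2: weak convergence, Fatou, identification of limits, completeness\<close>

lemma L2_pair_tendsto:
  fixes X :: "'i \<Rightarrow> real \<Rightarrow> 'a::{real_normed_field,banach,second_countable_topology}"
  assumes X: "\<And>n. square_integrable (X n)" and f: "square_integrable f" and g: "square_integrable g"
    and lim: "((\<lambda>n. L2norm (\<lambda>x. X n x - f x)) \<longlongrightarrow> 0) F"
  shows "((\<lambda>n. \<integral>x. X n x * g x \<partial>lborel) \<longlongrightarrow> (\<integral>x. f x * g x \<partial>lborel)) F"
proof -
  have "((\<lambda>n. (\<integral>x. f x * g x \<partial>lborel) - (\<integral>x. X n x * g x \<partial>lborel)) \<longlongrightarrow> 0) F"
  proof (rule Lim_null_comparison)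
    show "\<forall>\<^sub>F n in F. norm ((\<integral>x. f x * g x \<partial>lborel) - (\<integral>x. X n x * g x \<partial>lborel))
        \<le> L2norm (\<lambda>x. X n x - f x) * L2norm g"
    proof (rule always_eventually, rule allI)
      fix n
      have "(\<integral>x. f x * g x \<partial>lborel) - (\<integral>x. X n x * g x \<partial>lborel) = (\<integral>x. (f x - X n x) * g x \<partial>lborel)"
        using square_integrable_mult[OF f g] square_integrable_mult[OF X g]
        by (simp add: left_diff_distrib)
      then show "norm ((\<integral>x. f x * g x \<partial>lborel) - (\<integral>x. X n x * g x \<partial>lborel))
        \<le> L2norm (\<lambda>x. X n x - f x) * L2norm g"
        using L2_Cauchy_Schwarz[OF square_integrable_diff[OF f X[of n]] g] L2norm_minus_commute[of f "X n"]
        by simp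
    qed
    show "((\<lambda>n. L2norm (\<lambda>x. X n x - f x) * L2norm g) \<longlongrightarrow> 0) F"
      using tendsto_mult_left_zero[OF lim] by simp
  qed
  from tendsto_diff[OF tendsto_const[of "\<integral>x. f x * g x \<partial>lborel"] this] show ?thesis by simp
qed

text \<open>Fatou's lemma for the squared norms; that the limit is square integrable is part of the
  conclusion. The threshold \<open>n0\<close> is there because the lemma is applied to tails of
  Cauchy sequences, where the bound holds only eventually.\<close>

lemma L2_Fatou:
  fixes X :: "nat \<Rightarrow> real \<Rightarrow> 'a::{real_normed_field,banach,second_countable_topology}"
  assumes X: "\<And>n. square_integrable (X n)" and g: "g \<in> borel_measurable borel"
    and ae: "AE x in lborel. (\<lambda>n. X n x) \<longlonglongrightarrow> g x"
    and bnd: "\<And>n. n \<ge> n0 \<Longrightarrow> L2norm (X n) \<le> C"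
  shows "square_integrable g" "L2norm g \<le> C"
proof -
  note [measurable] = g
  have [measurable]: "X n \<in> borel_measurable borel" for n using X by (simp add: square_integrable_def)
  have C: "0 \<le> C" using bnd[of n0] L2norm_nonneg[of "X n0"] by linarith
  have "(\<integral>\<^sup>+x. ennreal ((norm (g x))\<^sup>2) \<partial>lborel) = (\<integral>\<^sup>+x. liminf (\<lambda>n. ennreal ((norm (X n x))\<^sup>2)) \<partial>lborel)"
  proof (rule nn_integral_cong_AE, use ae in eventually_elim)
    fix x assume "(\<lambda>n. X n x) \<longlonglongrightarrow> g x"
    then have "(\<lambda>n. ennreal ((norm (X n x))\<^sup>2)) \<longlonglongrightarrow> ennreal ((norm (g x))\<^sup>2)"
      by (intro tendsto_ennrealI tendsto_intros)
    then show "ennreal ((norm (g x))\<^sup>2) = liminf (\<lambda>n. ennreal ((norm (X n x))\<^sup>2))"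
      by (rule lim_imp_Liminf[OF sequentially_bot, symmetric])
  qed
  also have "\<dots> \<le> liminf (\<lambda>n. \<integral>\<^sup>+x. ennreal ((norm (X n x))\<^sup>2) \<partial>lborel)"
    by (rule nn_integral_liminf) auto
  also have "\<dots> \<le> ennreal (C\<^sup>2)"
  proof (rule order_trans[OF Liminf_mono Liminf_const[THEN eq_refl]])
    show "\<forall>\<^sub>F n in sequentially. (\<integral>\<^sup>+x. ennreal ((norm (X n x))\<^sup>2) \<partial>lborel) \<le> ennreal (C\<^sup>2)"
      unfolding eventually_sequentially
      using bnd by (intro exI[of _ n0]) (auto simp: nn_integral_square[OF X] intro!: ennreal_leI power_mono)
  qed simp
  finally show "square_integrable g" "L2norm g \<le> C"
    using L2norm_le_nn[OF g _ C] by auto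
qed

text \<open>No subsequence is extracted: \<open>L2_Fatou\<close> applied to \<open>X n - g\<close>
  bounds the norm of \<open>f - g\<close> by every positive \<open>e\<close>. In this way an L2
  limit such as \<open>cfourier_L2\<close> is computed from a pointwise limit.\<close>

lemma L2_limit_unique_AE:
  fixes X :: "nat \<Rightarrow> real \<Rightarrow> 'a::{real_normed_field,banach,second_countable_topology}"
  assumes X: "\<And>n. square_integrable (X n)" and f: "f \<in> borel_measurable borel" and g: "square_integrable g"
    and ae: "AE x in lborel. (\<lambda>n. X n x) \<longlonglongrightarrow> f x"
    and lim: "(\<lambda>n. L2norm (\<lambda>x. X n x - g x)) \<longlonglongrightarrow> 0"
  shows "AE x in lborel. f x = g x"
proof -
  have [measurable]: "f \<in> borel_measurable borel" "g \<in> borel_measurable borel"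
    using f g by (auto simp: square_integrable_def)
  have *: "square_integrable (\<lambda>x. f x - g x) \<and> L2norm (\<lambda>x. f x - g x) \<le> e" if "e > 0" for e
  proof -
    have "\<forall>\<^sub>F n in sequentially. L2norm (\<lambda>x. X n x - g x) < e"
      using lim that by (rule order_tendstoD)
    then obtain n0 where "\<And>n. n \<ge> n0 \<Longrightarrow> L2norm (\<lambda>x. X n x - g x) \<le> e"
      by (auto simp: eventually_sequentially intro: less_imp_le)
    moreover have "AE x in lborel. (\<lambda>n. X n x - g x) \<longlonglongrightarrow> f x - g x"
      using ae by eventually_elim (intro tendsto_intros)
    ultimately show ?thesis
      using L2_Fatou[of "\<lambda>n x. X n x - g x" "\<lambda>x. f x - g x" n0 e] square_integrable_diff[OF X g] by auto
  qed
  have "L2norm (\<lambda>x. f x - g x) \<le> 0"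
    by (rule field_le_epsilon) (use * in simp)
  then have "L2norm (\<lambda>x. f x - g x) = 0"
    by (simp add: antisym)
  then have "AE x in lborel. f x - g x = 0"
    using L2norm_eq_0 *[of 1] by fastforce
  then show ?thesis by eventually_elim simp
qed

text \<open>Riesz-Fischer for rapidly Cauchy sequences. The squared increments are summed with
  weights 2^n; their integrals are at most 2^n 4^(-n) = 2^(-n), so the weighted series is finite
  almost everywhere. The rate in the conclusion is the geometric tail of the hypothesis.\<close>

lemma L2_complete:
  fixes X :: "nat \<Rightarrow> real \<Rightarrow> 'a::{real_normed_field,banach,second_countable_topology}"
  assumes X: "\<And>n. square_integrable (X n)"
    and fast: "\<And>n. L2norm (\<lambda>x. X (Suc n) x - X n x) \<le> (1/2)^n"
  obtains g where "square_integrable g" "\<And>n. L2norm (\<lambda>x. X n x - g x) \<le> 2 * (1/2)^n"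
proof -
  have [measurable]: "X n \<in> borel_measurable borel" for n using X by (simp add: square_integrable_def)
  have "(\<integral>\<^sup>+x. (\<Sum>n. ennreal (2^n * (norm (X (Suc n) x - X n x))\<^sup>2)) \<partial>lborel)
     = (\<Sum>n. \<integral>\<^sup>+x. ennreal (2^n * (norm (X (Suc n) x - X n x))\<^sup>2) \<partial>lborel)"
    by (rule nn_integral_suminf) measurable
  also have "\<dots> = (\<Sum>n. ennreal (2^n * (L2norm (\<lambda>x. X (Suc n) x - X n x))\<^sup>2))"
    by (simp add: ennreal_mult nn_integral_cmult nn_integral_square[OF square_integrable_diff[OF X X]])
  also have "\<dots> \<le> (\<Sum>n. ennreal ((1/2)^n))"
  proof (intro suminf_le ennreal_leI)
    fix n
    have "(L2norm (\<lambda>x. X (Suc n) x - X n x))\<^sup>2 \<le> ((1/2)^n)\<^sup>2"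
      using fast by (intro power_mono) auto
    then have "2^n * (L2norm (\<lambda>x. X (Suc n) x - X n x))\<^sup>2 \<le> 2^n * ((1/2)^n)\<^sup>2"
      by (intro mult_left_mono) auto
    also have "\<dots> = (1/2::real)^n" by (simp add: power2_eq_square field_simps)
    finally show "2^n * (L2norm (\<lambda>x. X (Suc n) x - X n x))\<^sup>2 \<le> (1/2)^n" .
  qed auto
  also have "\<dots> = ennreal 2"
    using suminf_geometric[of "1/2::real"] by (subst suminf_ennreal2) (auto intro!: summable_geometric)
  finally have "(\<integral>\<^sup>+x. (\<Sum>n. ennreal (2^n * (norm (X (Suc n) x - X n x))\<^sup>2)) \<partial>lborel) \<noteq> \<infinity>"
    using ennreal_less_top[of 2] by (metis infinity_ennreal_def leD)
  then have "AE x in lborel. (\<Sum>n. ennreal (2^n * (norm (X (Suc n) x - X n x))\<^sup>2)) \<noteq> \<infinity>"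
    by (rule nn_integral_PInf_AE[rotated]) measurable
  then have ae: "AE x in lborel. convergent (\<lambda>n. X n x)"
  proof eventually_elim
    case (elim x)
    then have s: "summable (\<lambda>n. 2^n * (norm (X (Suc n) x - X n x))\<^sup>2)"
      by (intro summable_suminf_not_top) auto
    have "summable (\<lambda>n. norm (X (Suc n) x - X n x))"
    proof (rule summable_comparison_test')
      show "summable (\<lambda>n. 2^n * (norm (X (Suc n) x - X n x))\<^sup>2 + (1/2)^n)"
        by (intro summable_add s summable_geometric) auto
      fix n :: nat
      let ?d = "norm (X (Suc n) x - X n x)"
      \<comment> \<open>Completing the square gives 2 d \<le> 2^n d^2 + 2^(-n), which turns
        summability of the weighted squares into absolute summability of the increments.\<close>
      have "0 \<le> (2^n * ?d - 1)\<^sup>2 / 2^n" by simp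
      also have "\<dots> = 2^n * ?d\<^sup>2 - 2 * ?d + (1/2)^n"
        by (simp add: power2_eq_square field_simps)
      finally have "2 * ?d \<le> 2^n * ?d\<^sup>2 + (1/2)^n" by simp
      moreover have "0 \<le> ?d" by simp
      ultimately show "norm ?d \<le> 2^n * ?d\<^sup>2 + (1/2)^n" unfolding real_norm_def by linarith
    qed
    then have "summable (\<lambda>n. X (Suc n) x - X n x)" by (rule summable_norm_cancel)
    then have "convergent (\<lambda>n. \<Sum>k<n. X (Suc k) x - X k x)" by (simp add: summable_iff_convergent)
    then have "convergent (\<lambda>n. X n x - X 0 x)"
      by (subst (asm) sum_lessThan_telescope[of "\<lambda>n. X n x"])
    then show ?case using convergent_add[OF _ convergent_const[of "X 0 x"]] by fastforce
  qed
  define g where "g x = lim (\<lambda>n. X n x)" for x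
  have [measurable]: "g \<in> borel_measurable borel" unfolding g_def by measurable
  have gl: "AE x in lborel. (\<lambda>n. X n x) \<longlonglongrightarrow> g x"
    using ae by eventually_elim (simp add: g_def convergent_LIMSEQ_iff)
  have tel: "L2norm (\<lambda>x. X n x - X m x) \<le> 2 * (1/2)^n" if "n \<le> m" for n m
  proof -
    have "L2norm (\<lambda>x. X n x - X m x) \<le> 2 * (1/2)^n - 2 * (1/2)^m"
      using that
    proof (induction m rule: dec_induct)
      case (step m)
      then show ?case
        using L2norm_triangle_diff[OF X[of n] X[of m] X[of "Suc m"]] fast[of m]
          L2norm_minus_commute[of "X m" "X (Suc m)"] by simp
    qed simp
    moreover have "0 \<le> 2 * (1/2::real)^m" by simp
    ultimately show ?thesis by linarith
  qed
  have *: "square_integrable (\<lambda>x. X n x - g x) \<and> L2norm (\<lambda>x. X n x - g x) \<le> 2 * (1/2)^n" for n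
  proof -
    have "AE x in lborel. (\<lambda>m. X n x - X m x) \<longlonglongrightarrow> X n x - g x"
      using gl by eventually_elim (intro tendsto_intros)
    then show ?thesis
      using L2_Fatou[of "\<lambda>m x. X n x - X m x" "\<lambda>x. X n x - g x" n "2 * (1/2)^n"]
        square_integrable_diff[OF X X] tel by auto
  qed
  show thesis
  proof (rule that)
    show "square_integrable g"
      using square_integrable_diff[OF X[of 0] conjunct1[OF *[of 0]]] by simp
  qed (use * in auto)
qed

section \<open>The Fourier transform of integrable functions\<close>

text \<open>Complex-valued inputs are required because the transform is iterated in the inversion
  formula and applied to modulated functions.\<close>

definition cfourier :: "(real \<Rightarrow> complex) \<Rightarrow> real \<Rightarrow> complex" where
  "cfourier f \<xi> = (\<integral>x. exp (- (\<i> * complex_of_real (x * \<xi>))) * f x \<partial>lborel)"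

text \<open>Normalised to be 1 at the origin rather than to have mass 1: it serves as a cut-off in
  frequency that tends to 1 as c tends to 0, and its transform is then 2 pi times the normal density
  with deviation c.\<close>

definition gauss :: "real \<Rightarrow> real \<Rightarrow> real" where
  "gauss c x = exp (- (c * x)\<^sup>2 / 2)"

lemma fourier_eq_cfourier: "fourier f = cfourier (\<lambda>x. complex_of_real (f x))"
  by (simp add: fourier_def cfourier_def fun_eq_iff)

lemma norm_exp_char [simp]: "norm (exp (- (\<i> * complex_of_real t))) = 1"
  by (simp add: norm_exp_eq_Re)

lemma integrable_exp_mult:
  assumes "integrable lborel f"
  shows "integrable lborel (\<lambda>x. exp (- (\<i> * complex_of_real (x * \<xi>))) * f x)"
proof (rule Bochner_Integration.integrable_bound[OF assms])
  note [measurable] = borel_measurable_integrable[OF assms]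
  show "(\<lambda>x. exp (- (\<i> * complex_of_real (x * \<xi>))) * f x) \<in> borel_measurable lborel" by measurable
qed (auto simp: norm_mult simp del: of_real_mult)

lemma norm_cfourier_le: "norm (cfourier f \<xi>) \<le> (\<integral>x. norm (f x) \<partial>lborel)"
  unfolding cfourier_def
  by (rule order_trans[OF integral_norm_bound]) (simp add: norm_mult del: of_real_mult)

lemma cfourier_diff:
  assumes "integrable lborel f" "integrable lborel g"
  shows "cfourier (\<lambda>x. f x - g x) \<xi> = cfourier f \<xi> - cfourier g \<xi>"
  unfolding cfourier_def using assms[THEN integrable_exp_mult]
  by (simp add: right_diff_distrib del: of_real_mult)

lemma cfourier_cmult: "cfourier (\<lambda>x. c * f x) \<xi> = c * cfourier f \<xi>"
proof -
  have "cfourier (\<lambda>x. c * f x) \<xi> = (\<integral>x. c * (exp (- (\<i> * complex_of_real (x * \<xi>))) * f x) \<partial>lborel)"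
    by (simp add: cfourier_def mult.left_commute)
  then show ?thesis by (simp add: cfourier_def del: of_real_mult)
qed

lemma cfourier_uminus_arg: "cfourier f (- \<xi>) = cfourier (\<lambda>x. f (- x)) \<xi>"
  unfolding cfourier_def
  using lborel_integral_real_affine[of "-1" "\<lambda>x. exp (- (\<i> * complex_of_real (x * - \<xi>))) * f x" 0] by simp

lemma borel_measurable_cnj: "f \<in> borel_measurable M \<Longrightarrow> (\<lambda>x. cnj (f x)) \<in> borel_measurable M"
  by (rule measurable_compose[OF _ borel_measurable_continuous_onI]) (auto intro!: continuous_intros)

lemma cfourier_cnj: "cfourier (\<lambda>x. cnj (f x)) \<xi> = cnj (cfourier f (- \<xi>))"
  unfolding cfourier_def
  by (subst Bochner_Integration.integral_cnj[symmetric])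
     (intro Bochner_Integration.integral_cong, auto simp: exp_cnj)

lemma continuous_cfourier:
  assumes "integrable lborel f"
  shows "continuous_on UNIV (cfourier f)"
proof (clarsimp simp: continuous_on_def)
  fix \<xi>
  note [measurable] = borel_measurable_integrable[OF assms]
  show "cfourier f \<midarrow>\<xi>\<rightarrow> cfourier f \<xi>"
    unfolding tendsto_at_iff_sequentially comp_def cfourier_def
  proof (intro allI impI)
    fix X assume X: "X \<longlonglongrightarrow> \<xi>"
    show "(\<lambda>i. \<integral>x. exp (- (\<i> * complex_of_real (x * X i))) * f x \<partial>lborel)
        \<longlonglongrightarrow> (\<integral>x. exp (- (\<i> * complex_of_real (x * \<xi>))) * f x \<partial>lborel)"
    proof (rule integral_dominated_convergence)
      show "integrable lborel (\<lambda>x. norm (f x))" using assms by simp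
      show "AE x in lborel. (\<lambda>i. exp (- (\<i> * complex_of_real (x * X i))) * f x)
           \<longlonglongrightarrow> exp (- (\<i> * complex_of_real (x * \<xi>))) * f x"
        using X by (intro AE_I2 tendsto_intros)
    qed (auto simp: norm_mult simp del: of_real_mult)
  qed
qed

lemma borel_measurable_cfourier:
  "integrable lborel f \<Longrightarrow> cfourier f \<in> borel_measurable borel"
  by (rule borel_measurable_continuous_onI) (rule continuous_cfourier)

lemma integrable_bounded_mult:
  fixes f m :: "real \<Rightarrow> complex"
  assumes "integrable lborel f" "m \<in> borel_measurable borel" "\<And>x. norm (m x) \<le> C"
  shows "integrable lborel (\<lambda>x. m x * f x)"
proof (rule Bochner_Integration.integrable_bound)
  note [measurable] = borel_measurable_integrable[OF assms(1)] assms(2)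
  show "(\<lambda>x. m x * f x) \<in> borel_measurable lborel" by measurable
  show "integrable lborel (\<lambda>x. C * norm (f x))" using assms(1) by simp
  show "AE x in lborel. norm (m x * f x) \<le> norm (C * norm (f x))"
    unfolding norm_mult real_norm_def
    by (intro AE_I2 order_trans[OF mult_right_mono[OF assms(3) norm_ge_zero]]) (simp add: abs_mult mult_right_mono)
qed

text \<open>Fubini for the kernel exp(-i x \<xi>), which is symmetric in its two variables. The L2
  bound, the inversion formula and Parseval's identity all rest on this formula.\<close>

lemma cfourier_mult_formula:
  assumes a: "integrable lborel a" and b: "integrable lborel b"
  shows "(\<integral>\<xi>. cfourier a \<xi> * b \<xi> \<partial>lborel) = (\<integral>x. a x * cfourier b x \<partial>lborel)"
proof -
  note [measurable] = borel_measurable_integrable[OF a] borel_measurable_integrable[OF b]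
  let ?h = "\<lambda>x \<xi>. exp (- (\<i> * complex_of_real (x * \<xi>))) * a x * b \<xi>"
  have "integrable (lborel \<Otimes>\<^sub>M lborel) (\<lambda>(x, \<xi>). ?h x \<xi>)"
  proof (rule lborel_pair.Fubini_integrable)
    have "integrable lborel (\<lambda>x. norm (a x) * (\<integral>\<xi>. norm (b \<xi>) \<partial>lborel))" using a by simp
    then show "integrable lborel (\<lambda>x. \<integral>y. norm (case (x, y) of (x, \<xi>) \<Rightarrow> ?h x \<xi>) \<partial>lborel)"
      by (simp add: norm_mult del: of_real_mult)
    show "AE x in lborel. integrable lborel (\<lambda>y. case (x, y) of (x, \<xi>) \<Rightarrow> ?h x \<xi>)"
    proof (rule AE_I2)
      fix x
      have "integrable lborel (\<lambda>y. exp (- (\<i> * complex_of_real (x * y))) * a x * b y)"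
        by (rule integrable_bounded_mult[OF b, of _ "norm (a x)"]) (auto simp: norm_mult simp del: of_real_mult)
      then show "integrable lborel (\<lambda>y. case (x, y) of (x, \<xi>) \<Rightarrow> ?h x \<xi>)" by simp
    qed
  qed measurable
  then have "(\<integral>\<xi>. (\<integral>x. ?h x \<xi> \<partial>lborel) \<partial>lborel) = (\<integral>x. (\<integral>\<xi>. ?h x \<xi> \<partial>lborel) \<partial>lborel)"
    by (rule lborel_pair.Fubini_integral)
  moreover have "(\<integral>x. ?h x \<xi> \<partial>lborel) = cfourier a \<xi> * b \<xi>" for \<xi>
    unfolding cfourier_def by (rule integral_mult_left_zero)
  moreover have "(\<integral>\<xi>. ?h x \<xi> \<partial>lborel) = a x * cfourier b x" for x
  proof -
    have "(\<integral>\<xi>. ?h x \<xi> \<partial>lborel) = (\<integral>\<xi>. a x * (exp (- (\<i> * complex_of_real (\<xi> * x))) * b \<xi>) \<partial>lborel)"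
      by (simp add: mult_ac)
    then show ?thesis by (simp add: cfourier_def del: of_real_mult)
  qed
  ultimately show ?thesis by (simp only:)
qed

section \<open>Gaussian cut-offs, their transforms, and the L2 bound for transforms\<close>

lemma gauss_eq_normal_density:
  assumes "c > 0"
  shows "gauss c x = sqrt (2 * pi) / c * normal_density 0 (1 / c) x"
  using assms by (simp add: gauss_def normal_density_def real_sqrt_divide field_simps power_mult_distrib)

lemma integrable_gauss:
  assumes "c > 0" shows "integrable lborel (\<lambda>x. complex_of_real (gauss c x))"
proof -
  have "integrable lborel (normal_density 0 (1 / c))" by (rule integrable_normal_density) (use assms in simp)
  then have "integrable lborel (\<lambda>x. sqrt (2 * pi) / c * normal_density 0 (1 / c) x)"
    by (rule integrable_mult_right)
  then show ?thesis
    using assms by (intro integrable_of_real) (simp only: gauss_eq_normal_density)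
qed

lemma gauss_measurable [measurable]: "gauss c \<in> borel_measurable borel"
  unfolding gauss_def by (intro borel_measurable_continuous_onI continuous_intros) simp

lemma gauss_bounds: "0 \<le> gauss c x" "gauss c x \<le> 1"
  by (auto simp: gauss_def)

lemma gauss_tendsto_1: "(\<lambda>n. gauss (1 / Suc n) x) \<longlonglongrightarrow> 1"
proof -
  have "(\<lambda>n. exp (- (1 / real (Suc n) * x)\<^sup>2 / 2)) \<longlonglongrightarrow> exp (- (0 * x)\<^sup>2 / 2)"
    by (intro tendsto_intros LIMSEQ_Suc[OF lim_1_over_n]) simp
  then show ?thesis by (simp add: gauss_def)
qed

text \<open>Read off from the characteristic function of the standard normal distribution after the
  substitution x = c y.\<close>

lemma cfourier_gauss:
  assumes c: "c > 0"
  shows "cfourier (\<lambda>x. complex_of_real (gauss c x)) z = complex_of_real (2 * pi * normal_density 0 c z)"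
proof -
  define g where "g x = exp (\<i> * complex_of_real (- z / c * x)) * complex_of_real (std_normal_density x)" for x
  have "char std_normal_distribution (- z / c) = (\<integral>x. g x \<partial>lborel)"
    unfolding char_def g_def by (subst integral_density) (auto simp: scaleR_conv_of_real mult.commute)
  also have "\<dots> = c *\<^sub>R (\<integral>x. g (c * x) \<partial>lborel)"
    using lborel_integral_real_affine[of c g 0] c by simp
  also have "(\<integral>x. g (c * x) \<partial>lborel) = (\<integral>x. complex_of_real (1 / sqrt (2 * pi)) *
      (exp (- (\<i> * complex_of_real (x * z))) * complex_of_real (gauss c x)) \<partial>lborel)"
    using c by (intro Bochner_Integration.integral_cong)
      (auto simp: g_def gauss_def std_normal_density_def mult_ac)
  also have "\<dots> = complex_of_real (1 / sqrt (2 * pi)) * cfourier (\<lambda>x. complex_of_real (gauss c x)) z"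
    unfolding cfourier_def by (rule integral_mult_right_zero)
  finally have "complex_of_real (exp (- (- z / c)\<^sup>2 / 2)) =
     complex_of_real (c / sqrt (2 * pi)) * cfourier (\<lambda>x. complex_of_real (gauss c x)) z"
    by (simp add: char_std_normal_distribution scaleR_conv_of_real)
  then have "cfourier (\<lambda>x. complex_of_real (gauss c x)) z
     = complex_of_real (sqrt (2 * pi) / c * exp (- (- z / c)\<^sup>2 / 2))"
    using c by (simp add: field_simps)
  moreover have "sqrt (2 * pi) / c * exp (- (- z / c)\<^sup>2 / 2) = 2 * pi * normal_density 0 c z"
    using c real_sqrt_mult_self[of "2 * pi"]
    by (simp add: normal_density_def real_sqrt_mult power_divide field_simps)
  ultimately show ?thesis by (simp only:)
qed

lemma nn_integral_normal_density_shift: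
  assumes "c > 0"
  shows "(\<integral>\<^sup>+y. ennreal (normal_density 0 c (y - x)) \<partial>lborel) = 1"
proof -
  have "(\<integral>\<^sup>+y. ennreal (normal_density 0 c y) \<partial>lborel) = (\<integral>\<^sup>+y. ennreal (normal_density 0 c (- x + 1 * y)) \<partial>lborel)"
    using nn_integral_real_affine[of "\<lambda>y. ennreal (normal_density 0 c y)" 1 "-x"] by simp
  moreover have "(\<integral>\<^sup>+y. ennreal (normal_density 0 c y) \<partial>lborel) = 1"
    using assms by (subst nn_integral_eq_integral) (auto simp: integral_normal_density)
  ultimately show ?thesis by simp
qed

text \<open>Modulation by x translates the transform by x, so Gaussian regularisation of an inverse
  transform becomes averaging against a normal density centred at x.\<close>

lemma cfourier_modulated_gauss:
  assumes "c > 0"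
  shows "cfourier (\<lambda>\<xi>. exp (\<i> * complex_of_real (x * \<xi>)) * complex_of_real (gauss c \<xi>)) y =
    complex_of_real (2 * pi * normal_density 0 c (y - x))"
proof -
  have "exp (- (\<i> * complex_of_real (\<xi> * y))) * exp (\<i> * complex_of_real (x * \<xi>))
      = exp (- (\<i> * complex_of_real (\<xi> * (y - x))))" for \<xi>
    unfolding exp_add[symmetric] by (rule arg_cong[of _ _ exp]) (simp add: algebra_simps)
  then have "cfourier (\<lambda>\<xi>. exp (\<i> * complex_of_real (x * \<xi>)) * complex_of_real (gauss c \<xi>)) y
      = cfourier (\<lambda>\<xi>. complex_of_real (gauss c \<xi>)) (y - x)"
    unfolding cfourier_def mult.assoc[symmetric] by (simp only:)
  then show ?thesis using cfourier_gauss[OF assms] by simp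
qed

lemma integrable_modulated_gauss:
  assumes "c > 0"
  shows "integrable lborel (\<lambda>\<xi>. exp (\<i> * complex_of_real (x * \<xi>)) * complex_of_real (gauss c \<xi>))"
  by (rule integrable_bounded_mult[OF integrable_gauss[OF assms], of _ 1]) auto

text \<open>With b = cnj(F f) gauss, the left side is the integral of F f times b, which the
  multiplication formula turns into the integral of f times F b. A second application shows that F b
  is the conjugate of f averaged against 2 pi times the normal density. The inequality 2 |f(x)|
  |f(y)| \<le> |f(x)|^2 + |f(y)|^2 and the unit mass of the density then give a bound that does not
  depend on c.\<close>

lemma cfourier_gauss_weighted:
  assumes f: "integrable lborel f" and f2: "square_integrable f" and c: "c > 0"
  shows "(\<integral>\<^sup>+\<xi>. ennreal ((norm (cfourier f \<xi>))\<^sup>2 * gauss c \<xi>) \<partial>lborel) \<le> ennreal (2 * pi * (L2norm f)\<^sup>2)"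
proof -
  note [measurable] = borel_measurable_integrable[OF f] borel_measurable_cfourier[OF f]
  define M where "M = (\<integral>x. norm (f x) \<partial>lborel)"
  have bd: "norm (cfourier f \<xi>) \<le> M" for \<xi> unfolding M_def by (rule norm_cfourier_le)
  let ?\<phi> = "normal_density 0 c"
  define b where "b \<xi> = cnj (cfourier f \<xi>) * complex_of_real (gauss c \<xi>)" for \<xi>
  have b: "integrable lborel b"
    unfolding b_def by (rule integrable_bounded_mult[OF integrable_gauss[OF c], of _ M])
      (auto simp: bd intro!: borel_measurable_cnj)
  have cb: "cfourier b x = cnj (\<integral>y. f y * complex_of_real (2 * pi * ?\<phi> (y - x)) \<partial>lborel)" for x
  proof -
    have "cfourier b x = cnj (\<integral>\<xi>. cfourier f \<xi> * (exp (\<i> * complex_of_real (x * \<xi>)) * complex_of_real (gauss c \<xi>)) \<partial>lborel)"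
      unfolding cfourier_def[of b] b_def
      by (subst Bochner_Integration.integral_cnj[symmetric])
         (intro Bochner_Integration.integral_cong, auto simp: exp_cnj mult_ac)
    then show ?thesis
      by (simp only: cfourier_mult_formula[OF f integrable_modulated_gauss[OF c]] cfourier_modulated_gauss[OF c])
  qed
  have "integrable lborel (\<lambda>\<xi>. cfourier f \<xi> * b \<xi>)"
    by (rule integrable_bounded_mult[OF b _ bd]) measurable
  moreover have eq: "cfourier f \<xi> * b \<xi> = complex_of_real ((norm (cfourier f \<xi>))\<^sup>2 * gauss c \<xi>)" for \<xi>
    unfolding b_def by (simp add: mult.assoc[symmetric] complex_norm_square[symmetric])
  ultimately have int: "integrable lborel (\<lambda>\<xi>. (norm (cfourier f \<xi>))\<^sup>2 * gauss c \<xi>)"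
    using integrable_Re[of lborel "\<lambda>\<xi>. cfourier f \<xi> * b \<xi>"] by simp
  have "(\<integral>\<^sup>+\<xi>. ennreal ((norm (cfourier f \<xi>))\<^sup>2 * gauss c \<xi>) \<partial>lborel)
      = ennreal (\<integral>\<xi>. (norm (cfourier f \<xi>))\<^sup>2 * gauss c \<xi> \<partial>lborel)"
    by (rule nn_integral_eq_integral[OF int]) (auto simp: gauss_bounds)
  also have "\<dots> \<le> ennreal (norm (\<integral>\<xi>. cfourier f \<xi> * b \<xi> \<partial>lborel))"
    unfolding eq integral_complex_of_real norm_of_real by (intro ennreal_leI abs_ge_self)
  also have "(\<integral>\<xi>. cfourier f \<xi> * b \<xi> \<partial>lborel) = (\<integral>x. f x * cfourier b x \<partial>lborel)"
    by (rule cfourier_mult_formula[OF f b])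
  also have "ennreal (norm \<dots>) \<le> (\<integral>\<^sup>+x. ennreal (norm (f x * cfourier b x)) \<partial>lborel)"
  proof (rule integral_norm_bound_ennreal)
    show "integrable lborel (\<lambda>x. f x * cfourier b x)"
      using integrable_bounded_mult[OF f borel_measurable_cfourier[OF b] norm_cfourier_le]
      by (simp add: mult.commute)
  qed
  also have "\<dots> \<le> (\<integral>\<^sup>+x. (\<integral>\<^sup>+y. ennreal (pi * (norm (f x))\<^sup>2 * ?\<phi> (y - x)) + ennreal (pi * (norm (f y))\<^sup>2 * ?\<phi> (y - x)) \<partial>lborel) \<partial>lborel)"
  proof (rule nn_integral_mono)
    fix x
    have "ennreal (norm (f x * cfourier b x)) = ennreal (norm (f x)) * ennreal (norm (\<integral>y. f y * complex_of_real (2 * pi * ?\<phi> (y - x)) \<partial>lborel))"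
      by (simp add: norm_mult cb ennreal_mult del: of_real_mult)
    also have "\<dots> \<le> ennreal (norm (f x)) * (\<integral>\<^sup>+y. ennreal (norm (f y * complex_of_real (2 * pi * ?\<phi> (y - x)))) \<partial>lborel)"
    proof (intro mult_left_mono integral_norm_bound_ennreal)
      have "norm (complex_of_real (2 * pi * ?\<phi> (y - x))) \<le> (\<integral>\<xi>. norm (exp (\<i> * complex_of_real (x * \<xi>)) * complex_of_real (gauss c \<xi>)) \<partial>lborel)" for y
        unfolding cfourier_modulated_gauss[OF c, symmetric] by (rule norm_cfourier_le)
      from integrable_bounded_mult[OF f _ this]
      show "integrable lborel (\<lambda>y. f y * complex_of_real (2 * pi * ?\<phi> (y - x)))"
        by (simp add: mult.commute)
    qed simp
    also have "\<dots> = (\<integral>\<^sup>+y. ennreal (norm (f x)) * ennreal (norm (f y * complex_of_real (2 * pi * ?\<phi> (y - x)))) \<partial>lborel)"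
      by (rule nn_integral_cmult[symmetric]) measurable
    also have "\<dots> \<le> (\<integral>\<^sup>+y. ennreal (pi * (norm (f x))\<^sup>2 * ?\<phi> (y - x)) + ennreal (pi * (norm (f y))\<^sup>2 * ?\<phi> (y - x)) \<partial>lborel)"
    proof (rule nn_integral_mono)
      fix y
      have "norm (f x) * (norm (f y) * (2 * pi * ?\<phi> (y - x))) = (2 * norm (f x) * norm (f y)) * (pi * ?\<phi> (y - x))" by simp
      also have "\<dots> \<le> ((norm (f x))\<^sup>2 + (norm (f y))\<^sup>2) * (pi * ?\<phi> (y - x))"
        by (intro mult_right_mono sum_squares_bound) (auto simp: normal_density_nonneg)
      finally have "norm (f x) * norm (f y * complex_of_real (2 * pi * ?\<phi> (y - x))) \<le> pi * (norm (f x))\<^sup>2 * ?\<phi> (y - x) + pi * (norm (f y))\<^sup>2 * ?\<phi> (y - x)"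
        by (simp add: norm_mult normal_density_nonneg algebra_simps)
      then show "ennreal (norm (f x)) * ennreal (norm (f y * complex_of_real (2 * pi * ?\<phi> (y - x)))) \<le> ennreal (pi * (norm (f x))\<^sup>2 * ?\<phi> (y - x)) + ennreal (pi * (norm (f y))\<^sup>2 * ?\<phi> (y - x))"
        by (simp add: ennreal_mult[symmetric] ennreal_plus[symmetric] normal_density_nonneg ennreal_leI del: ennreal_plus)
    qed
    finally show "ennreal (norm (f x * cfourier b x)) \<le> (\<integral>\<^sup>+y. ennreal (pi * (norm (f x))\<^sup>2 * ?\<phi> (y - x)) + ennreal (pi * (norm (f y))\<^sup>2 * ?\<phi> (y - x)) \<partial>lborel)" .
  qed
  also have "\<dots> = (\<integral>\<^sup>+x. (\<integral>\<^sup>+y. ennreal (pi * (norm (f x))\<^sup>2 * ?\<phi> (y - x)) \<partial>lborel) \<partial>lborel)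
       + (\<integral>\<^sup>+x. (\<integral>\<^sup>+y. ennreal (pi * (norm (f y))\<^sup>2 * ?\<phi> (y - x)) \<partial>lborel) \<partial>lborel)"
    by (subst nn_integral_add[symmetric]) (auto intro!: nn_integral_cong nn_integral_add)
  also have "(\<integral>\<^sup>+x. (\<integral>\<^sup>+y. ennreal (pi * (norm (f y))\<^sup>2 * ?\<phi> (y - x)) \<partial>lborel) \<partial>lborel)
      = (\<integral>\<^sup>+y. (\<integral>\<^sup>+x. ennreal (pi * (norm (f y))\<^sup>2 * ?\<phi> (y - x)) \<partial>lborel) \<partial>lborel)"
    by (rule lborel_pair.Fubini') measurable
  also have "\<dots> = (\<integral>\<^sup>+x. (\<integral>\<^sup>+y. ennreal (pi * (norm (f x))\<^sup>2 * ?\<phi> (y - x)) \<partial>lborel) \<partial>lborel)"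
    by (intro nn_integral_cong) (simp add: normal_density_def power2_commute)
  also have "(\<integral>\<^sup>+x. (\<integral>\<^sup>+y. ennreal (pi * (norm (f x))\<^sup>2 * ?\<phi> (y - x)) \<partial>lborel) \<partial>lborel) = ennreal (pi * (L2norm f)\<^sup>2)"
    by (simp add: ennreal_mult normal_density_nonneg nn_integral_cmult nn_integral_normal_density_shift[OF c] nn_integral_square[OF f2])
  also have "ennreal (pi * (L2norm f)\<^sup>2) + ennreal (pi * (L2norm f)\<^sup>2) = ennreal (2 * pi * (L2norm f)\<^sup>2)"
    by (simp add: ennreal_plus[symmetric] del: ennreal_plus)
  finally show ?thesis .
qed

text \<open>Remove the Gaussian weight by Fatou's lemma as its parameter tends to 0. Only an
  inequality results at this point; equality is obtained later from Parseval's identity.\<close>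

lemma cfourier_L2_bound:
  assumes f: "integrable lborel f" and f2: "square_integrable f"
  shows "square_integrable (cfourier f)" "L2norm (cfourier f) \<le> sqrt (2 * pi) * L2norm f"
proof -
  note [measurable] = borel_measurable_cfourier[OF f]
  have "(\<integral>\<^sup>+\<xi>. ennreal ((norm (cfourier f \<xi>))\<^sup>2) \<partial>lborel)
      = (\<integral>\<^sup>+\<xi>. liminf (\<lambda>n. ennreal ((norm (cfourier f \<xi>))\<^sup>2 * gauss (1 / Suc n) \<xi>)) \<partial>lborel)"
  proof (intro nn_integral_cong lim_imp_Liminf[symmetric] sequentially_bot)
    fix \<xi>
    show "(\<lambda>n. ennreal ((norm (cfourier f \<xi>))\<^sup>2 * gauss (1 / Suc n) \<xi>)) \<longlonglongrightarrow> ennreal ((norm (cfourier f \<xi>))\<^sup>2)"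
      using tendsto_mult[OF tendsto_const gauss_tendsto_1[of \<xi>], of "(norm (cfourier f \<xi>))\<^sup>2"]
      by (intro tendsto_ennrealI) simp
  qed
  also have "\<dots> \<le> liminf (\<lambda>n. \<integral>\<^sup>+\<xi>. ennreal ((norm (cfourier f \<xi>))\<^sup>2 * gauss (1 / Suc n) \<xi>) \<partial>lborel)"
    by (rule nn_integral_liminf) measurable
  also have "\<dots> \<le> ennreal ((sqrt (2 * pi) * L2norm f)\<^sup>2)"
  proof (rule order_trans[OF Liminf_mono Liminf_const[THEN eq_refl]])
    show "\<forall>\<^sub>F n in sequentially. (\<integral>\<^sup>+\<xi>. ennreal ((norm (cfourier f \<xi>))\<^sup>2 * gauss (1 / Suc n) \<xi>) \<partial>lborel)
        \<le> ennreal ((sqrt (2 * pi) * L2norm f)\<^sup>2)"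
      using cfourier_gauss_weighted[OF f f2] by (intro always_eventually) (simp add: power_mult_distrib)
  qed simp
  finally show "square_integrable (cfourier f)" "L2norm (cfourier f) \<le> sqrt (2 * pi) * L2norm f"
    using L2norm_le_nn[of "cfourier f" "sqrt (2 * pi) * L2norm f"] by auto
qed

section \<open>The Fourier--Plancherel transform\<close>

definition truncate :: "real \<Rightarrow> (real \<Rightarrow> complex) \<Rightarrow> real \<Rightarrow> complex" where
  "truncate R f x = complex_of_real (indicator {-R..R} x) * f x"

definition has_cfourier_L2 :: "(real \<Rightarrow> complex) \<Rightarrow> (real \<Rightarrow> complex) \<Rightarrow> bool" where
  "has_cfourier_L2 f g \<longleftrightarrow> square_integrable g \<and>
     ((\<lambda>R. \<integral>\<^sup>+\<xi>. ennreal ((norm (cfourier (truncate R f) \<xi> - g \<xi>))\<^sup>2) \<partial>lborel) \<longlongrightarrow> 0) at_top"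

definition cfourier_L2 :: "(real \<Rightarrow> complex) \<Rightarrow> real \<Rightarrow> complex" where
  "cfourier_L2 f = (SOME g. has_cfourier_L2 f g)"

text \<open>Both \<open>SOME\<close> operators choose from the same predicate, so this is an
  equality of functions and not merely one almost everywhere.\<close>

lemma fourier_L2_eq_cfourier_L2: "fourier_L2 f = cfourier_L2 (\<lambda>x. complex_of_real (f x))"
  by (simp add: fourier_L2_def cfourier_L2_def has_fourier_L2_def has_cfourier_L2_def
      truncate_def[abs_def] fourier_eq_cfourier)

lemma square_integrable_indicator: "square_integrable (\<lambda>x. complex_of_real (indicator {a..b::real} x))"
proof -
  have "integrable lborel (\<lambda>x. indicator {a..b} x :: real)"
    by (intro integrable_real_indicator) (auto simp: emeasure_lborel_Icc_eq)
  then show ?thesis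
    unfolding square_integrable_def by (auto simp: power2_eq_square indicator_inter_arith[symmetric])
qed

context
  fixes f :: "real \<Rightarrow> complex"
  assumes f: "square_integrable f"
begin

lemma square_integrable_truncate: "square_integrable (truncate R f)"
  unfolding truncate_def[abs_def]
  by (rule square_integrable_bounded_mult[OF f, of _ 1]) (auto simp: indicator_def)

lemma integrable_truncate: "integrable lborel (truncate R f)"
  unfolding truncate_def[abs_def] by (rule square_integrable_mult[OF square_integrable_indicator f])

lemma truncate_tendsto: "((\<lambda>R. truncate R f x) \<longlongrightarrow> f x) at_top"
proof (rule tendsto_eventually)
  have "truncate R f x = f x" if "R \<ge> \<bar>x\<bar>" for R
    using that by (auto simp: truncate_def indicator_def)
  then show "\<forall>\<^sub>F R in at_top. truncate R f x = f x"
    unfolding eventually_at_top_linorder by blast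
qed

lemma truncate_L2_tendsto: "((\<lambda>R. L2norm (\<lambda>x. truncate R f x - f x)) \<longlongrightarrow> 0) at_top"
proof -
  have [measurable]: "f \<in> borel_measurable borel" "\<And>R. truncate R f \<in> borel_measurable borel"
    using f square_integrable_truncate by (auto intro: borel_measurable_square_integrable)
  have "((\<lambda>R. \<integral>x. (norm (truncate R f x - f x))\<^sup>2 \<partial>lborel) \<longlongrightarrow> integral\<^sup>L lborel (\<lambda>x::real. 0)) at_top"
  proof (rule integral_dominated_convergence_at_top)
    show "integrable lborel (\<lambda>x. (norm (f x))\<^sup>2)" by (rule integrable_square_integrable[OF f])
    show "\<forall>\<^sub>F R in at_top. AE x in lborel. norm ((norm (truncate R f x - f x))\<^sup>2) \<le> (norm (f x))\<^sup>2"
      by (auto simp: truncate_def indicator_def)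
    show "AE x in lborel. ((\<lambda>R. (norm (truncate R f x - f x))\<^sup>2) \<longlongrightarrow> 0) at_top"
    proof (rule AE_I2)
      fix x
      from tendsto_power[OF tendsto_norm_zero[OF LIM_zero[OF truncate_tendsto[of x]]], of 2]
      show "((\<lambda>R. (norm (truncate R f x - f x))\<^sup>2) \<longlongrightarrow> 0) at_top" by simp
    qed
  qed measurable
  from tendsto_real_sqrt[OF this] show ?thesis by (simp add: L2norm_def)
qed

lemma square_integrable_cfourier_truncate: "square_integrable (cfourier (truncate R f))"
  by (rule cfourier_L2_bound[OF integrable_truncate square_integrable_truncate])

lemma has_cfourier_L2_iff:
  "has_cfourier_L2 f g \<longleftrightarrow> square_integrable g \<and>
     ((\<lambda>R. L2norm (\<lambda>\<xi>. cfourier (truncate R f) \<xi> - g \<xi>)) \<longlongrightarrow> 0) at_top"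
proof -
  have "((\<lambda>R. \<integral>\<^sup>+\<xi>. ennreal ((norm (cfourier (truncate R f) \<xi> - g \<xi>))\<^sup>2) \<partial>lborel) \<longlongrightarrow> 0) at_top
     \<longleftrightarrow> ((\<lambda>R. L2norm (\<lambda>\<xi>. cfourier (truncate R f) \<xi> - g \<xi>)) \<longlongrightarrow> 0) at_top" if g: "square_integrable g"
  proof -
    let ?d = "\<lambda>R. L2norm (\<lambda>\<xi>. cfourier (truncate R f) \<xi> - g \<xi>)"
    have "((\<lambda>R. ennreal ((?d R)\<^sup>2)) \<longlongrightarrow> ennreal 0) at_top \<longleftrightarrow> ((\<lambda>R. (?d R)\<^sup>2) \<longlongrightarrow> 0) at_top"
      by (rule tendsto_ennreal_iff) auto
    also have "\<dots> \<longleftrightarrow> (?d \<longlongrightarrow> 0) at_top"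
    proof
      assume "((\<lambda>R. (?d R)\<^sup>2) \<longlongrightarrow> 0) at_top"
      from tendsto_real_sqrt[OF this] show "(?d \<longlongrightarrow> 0) at_top" by simp
    next
      assume "(?d \<longlongrightarrow> 0) at_top"
      from tendsto_power[OF this, of 2] show "((\<lambda>R. (?d R)\<^sup>2) \<longlongrightarrow> 0) at_top" by simp
    qed
    finally show ?thesis
      using nn_integral_square[OF square_integrable_diff[OF square_integrable_cfourier_truncate g]] by simp
  qed
  then show ?thesis by (auto simp: has_cfourier_L2_def)
qed

lemma cfourier_truncate_diff:
  "L2norm (\<lambda>\<xi>. cfourier (truncate R f) \<xi> - cfourier (truncate S f) \<xi>)
    \<le> sqrt (2 * pi) * (L2norm (\<lambda>x. truncate R f x - f x) + L2norm (\<lambda>x. truncate S f x - f x))"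
proof -
  have "L2norm (\<lambda>\<xi>. cfourier (truncate R f) \<xi> - cfourier (truncate S f) \<xi>)
      = L2norm (cfourier (\<lambda>x. truncate R f x - truncate S f x))"
    by (simp add: cfourier_diff[OF integrable_truncate integrable_truncate] L2norm_def)
  also have "\<dots> \<le> sqrt (2 * pi) * L2norm (\<lambda>x. truncate R f x - truncate S f x)"
    by (intro cfourier_L2_bound Bochner_Integration.integrable_diff integrable_truncate
        square_integrable_diff square_integrable_truncate)
  also have "L2norm (\<lambda>x. truncate R f x - truncate S f x)
      \<le> L2norm (\<lambda>x. truncate R f x - f x) + L2norm (\<lambda>x. truncate S f x - f x)"
    using L2norm_triangle_diff[OF square_integrable_truncate f square_integrable_truncate]
      L2norm_minus_commute[of f] by metis
  finally show ?thesis by simp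
qed

text \<open>By \<open>cfourier_L2_bound\<close> the transforms of the truncations form a Cauchy
  family. Completeness is applied along suitable radii \<open>r n\<close>, and the Cauchy estimate
  then carries the limit over to all real radii.\<close>

lemma has_cfourier_L2_exists: "\<exists>g. has_cfourier_L2 f g"
proof -
  define K where "K = sqrt (2 * pi)"
  have K: "K > 0" by (simp add: K_def)
  let ?e = "\<lambda>R. L2norm (\<lambda>x. truncate R f x - f x)"
  \<comment> \<open>The factor 2 K compensates the transform bound K and the two tails that occur in
    each difference, so that consecutive transforms differ by at most (1/2)^n, as
    \<open>L2_complete\<close> requires.\<close>
  have "\<exists>r. \<forall>R\<ge>r. ?e R < (1/2)^n / (2 * K)" for n :: nat
    using order_tendstoD(2)[OF truncate_L2_tendsto, of "(1/2)^n / (2 * K)"] K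
    by (simp add: eventually_at_top_linorder)
  then obtain r where r: "\<And>n R. R \<ge> r n \<Longrightarrow> ?e R < (1/2)^n / (2 * K)" by metis
  have r': "K * ?e (r n) \<le> (1/2)^n / 2" for n
    using r[of n "r n"] K by (simp add: field_simps)
  have "L2norm (\<lambda>\<xi>. cfourier (truncate (r (Suc n)) f) \<xi> - cfourier (truncate (r n) f) \<xi>) \<le> (1/2)^n" for n
  proof -
    have "(1/2)^Suc n / 2 + (1/2)^n / 2 \<le> (1/2::real)^n" by simp
    then show ?thesis
      using cfourier_truncate_diff[of "r (Suc n)" "r n"] r'[of n] r'[of "Suc n"]
      unfolding K_def[symmetric] distrib_left by linarith
  qed
  then obtain g where g: "square_integrable g"
    "\<And>n. L2norm (\<lambda>\<xi>. cfourier (truncate (r n) f) \<xi> - g \<xi>) \<le> 2 * (1/2)^n"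
    using L2_complete[of "\<lambda>n. cfourier (truncate (r n) f)"] square_integrable_cfourier_truncate by blast
  have "((\<lambda>R. L2norm (\<lambda>\<xi>. cfourier (truncate R f) \<xi> - g \<xi>)) \<longlongrightarrow> 0) at_top"
  proof (rule tendstoI)
    fix e :: real assume e: "e > 0"
    have "(\<lambda>n. (1/2::real)^n) \<longlonglongrightarrow> 0" by (rule LIMSEQ_realpow_zero) auto
    from order_tendstoD(2)[OF this, of "e / 4"] e obtain n where n: "(1/2::real)^n < e / 4"
      by (auto simp: eventually_sequentially)
    have "dist (L2norm (\<lambda>\<xi>. cfourier (truncate R f) \<xi> - g \<xi>)) 0 < e" if R: "R \<ge> r n" for R
    proof -
      have "K * ?e R \<le> (1/2)^n / 2" using r[OF R] K by (simp add: field_simps)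
      moreover have "L2norm (\<lambda>\<xi>. cfourier (truncate R f) \<xi> - g \<xi>) \<le>
          L2norm (\<lambda>\<xi>. cfourier (truncate R f) \<xi> - cfourier (truncate (r n) f) \<xi>) +
          L2norm (\<lambda>\<xi>. cfourier (truncate (r n) f) \<xi> - g \<xi>)"
        by (rule L2norm_triangle_diff[OF square_integrable_cfourier_truncate square_integrable_cfourier_truncate g(1)])
      ultimately have "L2norm (\<lambda>\<xi>. cfourier (truncate R f) \<xi> - g \<xi>) \<le> (1/2)^n / 2 + (1/2)^n / 2 + 2 * (1/2)^n"
        using cfourier_truncate_diff[of R "r n"] r'[of n] g(2)[of n]
        unfolding K_def[symmetric] distrib_left by linarith
      also have "\<dots> < e" using n e by simp
      finally show ?thesis by simp
    qed
    then show "\<forall>\<^sub>F R in at_top. dist (L2norm (\<lambda>\<xi>. cfourier (truncate R f) \<xi> - g \<xi>)) 0 < e"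
      unfolding eventually_at_top_linorder by blast
  qed
  with g(1) show ?thesis using has_cfourier_L2_iff by blast
qed

lemma square_integrable_cfourier_L2: "square_integrable (cfourier_L2 f)"
  and cfourier_L2_tendsto:
    "((\<lambda>R. L2norm (\<lambda>\<xi>. cfourier (truncate R f) \<xi> - cfourier_L2 f \<xi>)) \<longlongrightarrow> 0) at_top"
proof -
  have "has_cfourier_L2 f (cfourier_L2 f)"
    unfolding cfourier_L2_def by (rule someI_ex[OF has_cfourier_L2_exists])
  then show "square_integrable (cfourier_L2 f)"
    "((\<lambda>R. L2norm (\<lambda>\<xi>. cfourier (truncate R f) \<xi> - cfourier_L2 f \<xi>)) \<longlongrightarrow> 0) at_top"
    by (auto simp: has_cfourier_L2_iff)
qed

lemma cfourier_L2_norm_le: "L2norm (cfourier_L2 f) \<le> sqrt (2 * pi) * L2norm f"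
proof (rule tendsto_lowerbound)
  show "((\<lambda>R. sqrt (2 * pi) * L2norm f + L2norm (\<lambda>\<xi>. cfourier (truncate R f) \<xi> - cfourier_L2 f \<xi>))
      \<longlongrightarrow> sqrt (2 * pi) * L2norm f) at_top"
    using tendsto_add[OF tendsto_const cfourier_L2_tendsto] by simp
  show "\<forall>\<^sub>F R in at_top. L2norm (cfourier_L2 f) \<le>
      sqrt (2 * pi) * L2norm f + L2norm (\<lambda>\<xi>. cfourier (truncate R f) \<xi> - cfourier_L2 f \<xi>)"
  proof (intro always_eventually allI)
    fix R
    have "L2norm (cfourier (truncate R f)) \<le> sqrt (2 * pi) * L2norm (truncate R f)"
      by (rule cfourier_L2_bound[OF integrable_truncate square_integrable_truncate])
    also have "L2norm (truncate R f) \<le> L2norm f"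
      by (rule L2norm_mono[OF borel_measurable_square_integrable[OF square_integrable_truncate] f])
         (auto simp: truncate_def indicator_def)
    finally have "L2norm (cfourier (truncate R f)) \<le> sqrt (2 * pi) * L2norm f" by simp
    then show "L2norm (cfourier_L2 f) \<le>
      sqrt (2 * pi) * L2norm f + L2norm (\<lambda>\<xi>. cfourier (truncate R f) \<xi> - cfourier_L2 f \<xi>)"
      using L2norm_diff_le[OF square_integrable_cfourier_truncate[of R] square_integrable_cfourier_L2] by linarith
  qed
qed simp

text \<open>The rule behind the scaling, difference, reflection and conjugation laws below: a
  candidate transform has only to be the L2 limit of the truncated transforms.\<close>

lemma cfourier_L2_unique:
  assumes g: "square_integrable g"
    and lim: "((\<lambda>R. L2norm (\<lambda>\<xi>. cfourier (truncate R f) \<xi> - g \<xi>)) \<longlongrightarrow> 0) at_top"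
  shows "AE \<xi> in lborel. cfourier_L2 f \<xi> = g \<xi>"
proof -
  let ?d = "L2norm (\<lambda>\<xi>. cfourier_L2 f \<xi> - g \<xi>)"
  have "?d \<le> 0"
  proof (rule tendsto_lowerbound)
    show "((\<lambda>R. L2norm (\<lambda>\<xi>. cfourier (truncate R f) \<xi> - cfourier_L2 f \<xi>) +
        L2norm (\<lambda>\<xi>. cfourier (truncate R f) \<xi> - g \<xi>)) \<longlongrightarrow> 0) at_top"
      using tendsto_add[OF cfourier_L2_tendsto lim] by simp
    show "\<forall>\<^sub>F R in at_top. ?d \<le> L2norm (\<lambda>\<xi>. cfourier (truncate R f) \<xi> - cfourier_L2 f \<xi>) +
        L2norm (\<lambda>\<xi>. cfourier (truncate R f) \<xi> - g \<xi>)"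
      using L2norm_triangle_diff[OF square_integrable_cfourier_L2 square_integrable_cfourier_truncate g]
        L2norm_minus_commute[of "cfourier_L2 f"]
      by (intro always_eventually allI) metis
  qed simp
  then have "?d = 0" by (simp add: antisym)
  from L2norm_eq_0[OF square_integrable_diff[OF square_integrable_cfourier_L2 g] this]
  show ?thesis by eventually_elim simp
qed

text \<open>Along integer radii the truncated transforms converge at every \<xi> by dominated
  convergence and in L2 by definition; the two limits agree almost everywhere.\<close>

lemma cfourier_L2_eq_cfourier:
  assumes int: "integrable lborel f"
  shows "AE \<xi> in lborel. cfourier_L2 f \<xi> = cfourier f \<xi>"
proof -
  note [measurable] = borel_measurable_integrable[OF int]
  have seq: "filterlim (\<lambda>n. real n) at_top sequentially" by (rule filterlim_real_sequentially)
  have "(\<lambda>n. cfourier (truncate (real n) f) \<xi>) \<longlonglongrightarrow> cfourier f \<xi>" for \<xi>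
    unfolding cfourier_def
  proof (rule integral_dominated_convergence)
    show "integrable lborel (\<lambda>x. norm (f x))" using int by simp
    show "AE x in lborel. (\<lambda>n. exp (- (\<i> * complex_of_real (x * \<xi>))) * truncate (real n) f x)
         \<longlonglongrightarrow> exp (- (\<i> * complex_of_real (x * \<xi>))) * f x"
      by (intro AE_I2 tendsto_intros filterlim_compose[OF truncate_tendsto seq])
    show "(\<lambda>x. exp (- (\<i> * complex_of_real (x * \<xi>))) * truncate (real n) f x) \<in> borel_measurable lborel" for n
      unfolding truncate_def by measurable
  qed (auto simp: norm_mult truncate_def indicator_def simp del: of_real_mult)
  then have "AE \<xi> in lborel. cfourier f \<xi> = cfourier_L2 f \<xi>"
    using filterlim_compose[OF cfourier_L2_tendsto seq]
    by (intro L2_limit_unique_AE[of "\<lambda>n. cfourier (truncate (real n) f)"] AE_I2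
        square_integrable_cfourier_truncate square_integrable_cfourier_L2 borel_measurable_cfourier[OF int])
  then show ?thesis by eventually_elim simp
qed

end

lemma cfourier_L2_cmult:
  assumes f: "square_integrable f"
  shows "AE \<xi> in lborel. cfourier_L2 (\<lambda>x. c * f x) \<xi> = c * cfourier_L2 f \<xi>"
proof (rule cfourier_L2_unique)
  show "square_integrable (\<lambda>x. c * f x)" by (rule square_integrable_cmult[OF f])
  show "square_integrable (\<lambda>\<xi>. c * cfourier_L2 f \<xi>)"
    by (rule square_integrable_cmult[OF square_integrable_cfourier_L2[OF f]])
  have "truncate R (\<lambda>x. c * f x) = (\<lambda>x. c * truncate R f x)" for R
    by (simp add: truncate_def fun_eq_iff mult.left_commute)
  then have "L2norm (\<lambda>\<xi>. cfourier (truncate R (\<lambda>x. c * f x)) \<xi> - c * cfourier_L2 f \<xi>)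
      = norm c * L2norm (\<lambda>\<xi>. cfourier (truncate R f) \<xi> - cfourier_L2 f \<xi>)" for R
    by (simp add: cfourier_cmult right_diff_distrib[symmetric] L2norm_cmult)
  then show "((\<lambda>R. L2norm (\<lambda>\<xi>. cfourier (truncate R (\<lambda>x. c * f x)) \<xi> - c * cfourier_L2 f \<xi>)) \<longlongrightarrow> 0) at_top"
    using tendsto_mult_right_zero[OF cfourier_L2_tendsto[OF f], of "norm c"] by simp
qed

lemma cfourier_L2_diff:
  assumes f: "square_integrable f" and g: "square_integrable g"
  shows "AE \<xi> in lborel. cfourier_L2 (\<lambda>x. f x - g x) \<xi> = cfourier_L2 f \<xi> - cfourier_L2 g \<xi>"
proof (rule cfourier_L2_unique)
  show "square_integrable (\<lambda>x. f x - g x)" by (rule square_integrable_diff[OF f g])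
  note sq = square_integrable_cfourier_L2[OF f] square_integrable_cfourier_L2[OF g]
  note sqt = square_integrable_cfourier_truncate[OF f] square_integrable_cfourier_truncate[OF g]
  show "square_integrable (\<lambda>\<xi>. cfourier_L2 f \<xi> - cfourier_L2 g \<xi>)"
    by (rule square_integrable_diff[OF sq])
  have t: "truncate R (\<lambda>x. f x - g x) = (\<lambda>x. truncate R f x - truncate R g x)" for R
    by (simp add: truncate_def fun_eq_iff right_diff_distrib)
  let ?D = "\<lambda>h R. L2norm (\<lambda>\<xi>. cfourier (truncate R h) \<xi> - cfourier_L2 h \<xi>)"
  show "((\<lambda>R. L2norm (\<lambda>\<xi>. cfourier (truncate R (\<lambda>x. f x - g x)) \<xi> - (cfourier_L2 f \<xi> - cfourier_L2 g \<xi>))) \<longlongrightarrow> 0) at_top"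
  proof (rule tendsto_sandwich[OF _ _ tendsto_const])
    show "((\<lambda>R. ?D f R + ?D g R) \<longlongrightarrow> 0) at_top"
      using tendsto_add[OF cfourier_L2_tendsto[OF f] cfourier_L2_tendsto[OF g]] by simp
    have "L2norm (\<lambda>\<xi>. cfourier (truncate R (\<lambda>x. f x - g x)) \<xi> - (cfourier_L2 f \<xi> - cfourier_L2 g \<xi>)) \<le> ?D f R + ?D g R" for R
    proof -
      have "(\<lambda>\<xi>. cfourier (truncate R (\<lambda>x. f x - g x)) \<xi> - (cfourier_L2 f \<xi> - cfourier_L2 g \<xi>))
        = (\<lambda>\<xi>. (cfourier (truncate R f) \<xi> - cfourier_L2 f \<xi>) + - (cfourier (truncate R g) \<xi> - cfourier_L2 g \<xi>))"
        by (simp add: t cfourier_diff integrable_truncate f g fun_eq_iff)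
      then show ?thesis
        using L2norm_triangle[OF square_integrable_diff[OF sqt(1) sq(1)]
            square_integrable_uminus[OF square_integrable_diff[OF sqt(2) sq(2)]], of R R]
        by (simp only: L2norm_uminus)
    qed
    then show "\<forall>\<^sub>F R in at_top. L2norm (\<lambda>\<xi>. cfourier (truncate R (\<lambda>x. f x - g x)) \<xi> - (cfourier_L2 f \<xi> - cfourier_L2 g \<xi>)) \<le> ?D f R + ?D g R"
      by (intro always_eventually allI)
  qed (simp add: always_eventually)
qed

lemma cfourier_cong_AE:
  assumes "f \<in> borel_measurable borel" "g \<in> borel_measurable borel" "AE x in lborel. f x = g x"
  shows "cfourier f = cfourier g"
proof
  note [measurable] = assms(1,2)
  show "cfourier f \<xi> = cfourier g \<xi>" for \<xi>
    unfolding cfourier_def using assms(3) by (intro integral_cong_AE) auto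
qed

text \<open>The predicate under \<open>SOME\<close> sees its argument only through integrals. Inputs
  that agree almost everywhere therefore receive the same representative, which permits rewriting
  with a genuine equation.\<close>

lemma cfourier_L2_cong_AE:
  assumes "f \<in> borel_measurable borel" "g \<in> borel_measurable borel" "AE x in lborel. f x = g x"
  shows "cfourier_L2 f = cfourier_L2 g"
proof -
  note [measurable] = assms(1,2)
  have "cfourier (truncate R f) = cfourier (truncate R g)" for R
    unfolding truncate_def[abs_def] using assms(3) by (intro cfourier_cong_AE) auto
  then show ?thesis by (simp add: cfourier_L2_def has_cfourier_L2_def)
qed

lemma cfourier_L2_tendsto_L2:
  assumes X: "\<And>n. square_integrable (X n)" and f: "square_integrable f"
    and lim: "((\<lambda>n. L2norm (\<lambda>x. X n x - f x)) \<longlongrightarrow> 0) F"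
  shows "((\<lambda>n. L2norm (\<lambda>x. cfourier_L2 (X n) x - cfourier_L2 f x)) \<longlongrightarrow> 0) F"
proof (rule tendsto_sandwich[OF _ _ tendsto_const])
  show "((\<lambda>n. sqrt (2 * pi) * L2norm (\<lambda>x. X n x - f x)) \<longlongrightarrow> 0) F"
    using tendsto_mult_right_zero[OF lim] .
  have "L2norm (\<lambda>x. cfourier_L2 (X n) x - cfourier_L2 f x) \<le> sqrt (2 * pi) * L2norm (\<lambda>x. X n x - f x)" for n
  proof -
    note sq = square_integrable_diff[OF X[of n] f]
    have "L2norm (\<lambda>x. cfourier_L2 (X n) x - cfourier_L2 f x) = L2norm (cfourier_L2 (\<lambda>x. X n x - f x))"
      using cfourier_L2_diff[OF X[of n] f]
      by (intro L2norm_cong_AE borel_measurable_square_integrable square_integrable_diff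
          square_integrable_cfourier_L2 X f) auto
    then show ?thesis using cfourier_L2_norm_le[OF sq] by simp
  qed
  then show "\<forall>\<^sub>F n in F. L2norm (\<lambda>x. cfourier_L2 (X n) x - cfourier_L2 f x) \<le> sqrt (2 * pi) * L2norm (\<lambda>x. X n x - f x)"
    by (intro always_eventually allI)
qed (simp add: always_eventually)

text \<open>Both factors are truncated, where the integrable version applies, and the truncations
  are released one after the other: first that of \<open>f\<close>, then that of
  \<open>g\<close>.\<close>

lemma cfourier_L2_mult_formula:
  assumes f: "square_integrable f" and g: "square_integrable g"
  shows "(\<integral>\<xi>. cfourier_L2 f \<xi> * g \<xi> \<partial>lborel) = (\<integral>x. f x * cfourier_L2 g x \<partial>lborel)"
proof -
  have 1: "(\<integral>\<xi>. cfourier_L2 f \<xi> * truncate S g \<xi> \<partial>lborel) = (\<integral>x. f x * cfourier (truncate S g) x \<partial>lborel)" for S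
  proof (rule tendsto_unique[OF trivial_limit_at_top_linorder])
    show "((\<lambda>R. \<integral>\<xi>. cfourier (truncate R f) \<xi> * truncate S g \<xi> \<partial>lborel) \<longlongrightarrow>
        (\<integral>\<xi>. cfourier_L2 f \<xi> * truncate S g \<xi> \<partial>lborel)) at_top"
      by (rule L2_pair_tendsto[OF square_integrable_cfourier_truncate[OF f] square_integrable_cfourier_L2[OF f]
            square_integrable_truncate[OF g] cfourier_L2_tendsto[OF f]])
    have "((\<lambda>R. \<integral>x. truncate R f x * cfourier (truncate S g) x \<partial>lborel) \<longlongrightarrow>
        (\<integral>x. f x * cfourier (truncate S g) x \<partial>lborel)) at_top"
      by (rule L2_pair_tendsto[OF square_integrable_truncate[OF f] f
            square_integrable_cfourier_truncate[OF g] truncate_L2_tendsto[OF f]])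
    then show "((\<lambda>R. \<integral>\<xi>. cfourier (truncate R f) \<xi> * truncate S g \<xi> \<partial>lborel) \<longlongrightarrow>
        (\<integral>x. f x * cfourier (truncate S g) x \<partial>lborel)) at_top"
      by (simp only: cfourier_mult_formula[OF integrable_truncate[OF f] integrable_truncate[OF g]])
  qed
  show ?thesis
  proof (rule tendsto_unique[OF trivial_limit_at_top_linorder])
    show "((\<lambda>S. \<integral>\<xi>. cfourier_L2 f \<xi> * truncate S g \<xi> \<partial>lborel) \<longlongrightarrow> (\<integral>\<xi>. cfourier_L2 f \<xi> * g \<xi> \<partial>lborel)) at_top"
      using L2_pair_tendsto[OF square_integrable_truncate[OF g] g square_integrable_cfourier_L2[OF f] truncate_L2_tendsto[OF g]]
      by (simp only: mult.commute)
    have "((\<lambda>S. \<integral>x. f x * cfourier (truncate S g) x \<partial>lborel) \<longlongrightarrow> (\<integral>x. f x * cfourier_L2 g x \<partial>lborel)) at_top"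
      using L2_pair_tendsto[OF square_integrable_cfourier_truncate[OF g] square_integrable_cfourier_L2[OF g] f cfourier_L2_tendsto[OF g]]
      by (simp only: mult.commute)
    then show "((\<lambda>S. \<integral>\<xi>. cfourier_L2 f \<xi> * truncate S g \<xi> \<partial>lborel) \<longlongrightarrow> (\<integral>x. f x * cfourier_L2 g x \<partial>lborel)) at_top"
      by (simp only: 1)
  qed
qed

section \<open>Inversion and Parseval's identity\<close>

abbreviation cindicator :: "real \<Rightarrow> real \<Rightarrow> real \<Rightarrow> complex" where
  "cindicator a b \<equiv> \<lambda>x. complex_of_real (indicator {a..b} x)"

text \<open>Test with the set where F is positive. The one-sided conclusion suffices because it is
  applied to a function and to its negative.\<close>

lemma AE_eq_0_of_integrals_real:
  fixes F :: "real \<Rightarrow> real"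
  assumes F: "integrable lborel F"
    and zero: "\<And>A. A \<in> sets borel \<Longrightarrow> (\<integral>x. indicator A x * F x \<partial>lborel) = 0"
  shows "AE x in lborel. F x \<le> 0"
proof -
  note [measurable] = borel_measurable_integrable[OF F]
  let ?A = "{x. F x > 0}"
  have A[measurable]: "?A \<in> sets borel" by measurable
  have "integrable lborel (\<lambda>x. indicator ?A x * F x)"
    using integrable_mult_indicator[of ?A lborel F] F A by simp
  moreover have "AE x in lborel. 0 \<le> indicator ?A x * F x" by (auto simp: indicator_def)
  ultimately have "AE x in lborel. indicator ?A x * F x = 0"
    using zero[OF A] integral_nonneg_eq_0_iff_AE by blast
  then show ?thesis by eventually_elim (auto simp: indicator_def split: if_splits)
qed

text \<open>Dynkin's argument: half-lines are stable under intersection and generate the Borel sets.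
  The hypothesis \<open>total\<close> provides the complement step.\<close>

lemma integrals_eq_0_of_halflines:
  fixes F :: "real \<Rightarrow> real"
  assumes F: "integrable lborel F" and total: "(\<integral>x. F x \<partial>lborel) = 0"
    and half: "\<And>a. (\<integral>x. indicator {..a} x * F x \<partial>lborel) = 0"
    and A: "A \<in> sets borel"
  shows "(\<integral>x. indicator A x * F x \<partial>lborel) = 0"
proof -
  have ind: "integrable lborel (\<lambda>x. indicator B x * F x)" if "B \<in> sets borel" for B
    using integrable_mult_indicator[of B lborel F] F that by simp
  have sets: "sets borel = sigma_sets UNIV (range (\<lambda>a::real. {..a}))"
    by (subst borel_eq_atMost) (simp add: sets_measure_of)
  have "Int_stable (range (\<lambda>a::real. {..a}))" by (auto simp: Int_stable_def)
  moreover have "range (\<lambda>a::real. {..a}) \<subseteq> Pow UNIV" by simp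
  moreover have "A \<in> sigma_sets UNIV (range (\<lambda>a::real. {..a}))" using A sets by simp
  ultimately show ?thesis
  proof (induction rule: sigma_sets_induct_disjoint)
    case (basic B) then show ?case using half by auto
  next
    case empty show ?case by simp
  next
    case (compl B)
    then have B: "B \<in> sets borel" using sets by simp
    have "(\<integral>x. indicator (UNIV - B) x * F x \<partial>lborel) = (\<integral>x. F x - indicator B x * F x \<partial>lborel)"
      by (intro Bochner_Integration.integral_cong) (auto simp: indicator_def)
    also have "\<dots> = 0" using F ind[OF B] total compl by simp
    finally show ?case .
  next
    case (union B)
    then have B: "B i \<in> sets borel" for i using sets by auto
    have "set_lebesgue_integral lborel (\<Union>i. B i) F = (\<Sum>i. set_lebesgue_integral lborel (B i) F)"
    proof (rule lebesgue_integral_countable_add)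
      show "set_integrable lborel (\<Union>i. B i) F"
        unfolding set_integrable_def using ind[of "\<Union>i. B i"] B by auto
      show "B i \<inter> B j = {}" if "i \<noteq> j" for i j
        using union(1) that by (auto simp: disjoint_family_on_def)
    qed (use B in simp)
    then show ?case using union(3) by (simp add: set_lebesgue_integral_def)
  qed
qed

text \<open>Local integrability is enough, since the argument runs on each [-n, n] separately; this
  matters for the Duhamel integral, which is only known to be continuous. Real part, imaginary part
  and their negatives give four one-sided bounds.\<close>

lemma AE_eq_0_of_interval_integrals:
  fixes f :: "real \<Rightarrow> complex"
  assumes f: "\<And>a b. integrable lborel (\<lambda>x. cindicator a b x * f x)"
    and zero: "\<And>a b. (\<integral>x. cindicator a b x * f x \<partial>lborel) = 0"
  shows "AE x in lborel. f x = 0"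
proof -
  have *: "AE x in lborel. g (truncate (real n) f x) \<le> 0"
    if g: "bounded_linear g" for n and g :: "complex \<Rightarrow> real"
  proof -
    interpret bounded_linear g by fact
    let ?F = "\<lambda>x. g (truncate (real n) f x)"
    have F: "integrable lborel ?F"
      unfolding truncate_def by (rule integrable_bounded_linear[OF g f])
    have half: "(\<integral>x. indicator {..a} x * ?F x \<partial>lborel) = 0" for a
    proof -
      have "(\<integral>x. indicator {..a} x * ?F x \<partial>lborel) = (\<integral>x. g (complex_of_real (indicator {- real n..min a (real n)} x) * f x) \<partial>lborel)"
        by (intro Bochner_Integration.integral_cong) (auto simp: truncate_def indicator_def zero)
      also have "\<dots> = g (\<integral>x. complex_of_real (indicator {- real n..min a (real n)} x) * f x \<partial>lborel)"
        by (rule integral_bounded_linear[OF g f])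
      finally show ?thesis using assms(2) by (simp add: local.zero)
    qed
    have "(\<integral>x. ?F x \<partial>lborel) = (\<integral>x. indicator {..real n} x * ?F x \<partial>lborel)"
      by (intro Bochner_Integration.integral_cong) (auto simp: truncate_def indicator_def local.zero)
    then have total: "(\<integral>x. ?F x \<partial>lborel) = 0" using half by simp
    show ?thesis
      using AE_eq_0_of_integrals_real[OF F integrals_eq_0_of_halflines[OF F total half]] .
  qed
  have "AE x in lborel. \<forall>n. Re (truncate (real n) f x) \<le> 0 \<and> - Re (truncate (real n) f x) \<le> 0 \<and>
      Im (truncate (real n) f x) \<le> 0 \<and> - Im (truncate (real n) f x) \<le> 0"
    unfolding AE_all_countable
    using *[OF bounded_linear_Re] *[OF bounded_linear_minus[OF bounded_linear_Re]]
      *[OF bounded_linear_Im] *[OF bounded_linear_minus[OF bounded_linear_Im]] by auto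
  then show ?thesis
  proof eventually_elim
    case (elim x)
    obtain n :: nat where "\<bar>x\<bar> \<le> real n" using real_arch_simple by blast
    then have "truncate (real n) f x = f x" by (auto simp: truncate_def indicator_def)
    with elim[rule_format, of n] show ?case by (auto simp: complex_eq_iff)
  qed
qed

lemma integrable_cindicator: "integrable lborel (cindicator a b)"
  by (intro integrable_of_real integrable_real_indicator) (auto simp: emeasure_lborel_Icc_eq)

lemma normal_density_scale:
  assumes "c > 0" shows "c * normal_density 0 c (c * z) = std_normal_density z"
  using assms by (simp add: normal_density_def real_sqrt_mult power_mult_distrib)

lemma normal_density_indicator_tendsto:
  assumes "y \<noteq> a" "y \<noteq> b"
  shows "(\<lambda>n. \<integral>x. cindicator a b x * complex_of_real (normal_density 0 (1 / Suc n) (x - y)) \<partial>lborel)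
     \<longlonglongrightarrow> cindicator a b y"
proof -
  let ?\<phi> = std_normal_density
  have eq: "(\<integral>x. cindicator a b x * complex_of_real (normal_density 0 (1 / Suc n) (x - y)) \<partial>lborel)
     = (\<integral>z. cindicator a b (y + 1 / Suc n * z) * complex_of_real (?\<phi> z) \<partial>lborel)" for n
  proof -
    let ?c = "1 / real (Suc n)"
    have d: "?c * normal_density 0 ?c (?c * z) = ?\<phi> z" for z
      by (rule normal_density_scale) simp
    have "(\<integral>x. cindicator a b x * complex_of_real (normal_density 0 ?c (x - y)) \<partial>lborel)
       = ?c *\<^sub>R (\<integral>z. cindicator a b (y + ?c * z) * complex_of_real (normal_density 0 ?c (?c * z)) \<partial>lborel)"
      using lborel_integral_real_affine[of ?c "\<lambda>x. cindicator a b x * complex_of_real (normal_density 0 ?c (x - y))" y]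
      by (simp add: add.commute)
    also have "\<dots> = (\<integral>z. cindicator a b (y + ?c * z) * complex_of_real (?c * normal_density 0 ?c (?c * z)) \<partial>lborel)"
      by (subst integral_scaleR_right[symmetric])
         (simp only: scaleR_conv_of_real of_real_mult mult_ac)
    finally show ?thesis by (simp only: d)
  qed
  have "(\<lambda>n. \<integral>z. cindicator a b (y + 1 / Suc n * z) * complex_of_real (?\<phi> z) \<partial>lborel)
    \<longlonglongrightarrow> (\<integral>z. cindicator a b y * complex_of_real (?\<phi> z) \<partial>lborel)"
  proof (rule integral_dominated_convergence)
    show "integrable lborel (\<lambda>z. ?\<phi> z)" by (rule integrable_normal_density) simp
    show "AE z in lborel. (\<lambda>n. cindicator a b (y + 1 / Suc n * z) * complex_of_real (?\<phi> z))
        \<longlonglongrightarrow> cindicator a b y * complex_of_real (?\<phi> z)"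
    proof (intro AE_I2 tendsto_mult_right)
      fix z
      have l: "(\<lambda>n. y + 1 / Suc n * z) \<longlonglongrightarrow> y + 0 * z"
        by (intro tendsto_intros LIMSEQ_Suc[OF lim_1_over_n])
      have "\<forall>\<^sub>F n in sequentially. indicator {a..b} (y + 1 / Suc n * z) = (indicator {a..b} y :: real)"
      proof -
        consider "y < a" | "b < y" | "a < y" "y < b" using assms by linarith
        then show ?thesis
        proof cases
          case 1 with order_tendstoD(2)[OF l, of a] show ?thesis by (auto elim!: eventually_mono)
        next
          case 2 with order_tendstoD(1)[OF l, of b] show ?thesis by (auto elim!: eventually_mono)
        next
          case 3
          with order_tendstoD(1)[OF l, of a] order_tendstoD(2)[OF l, of b]
          have "\<forall>\<^sub>F n in sequentially. a < y + 1 / Suc n * z \<and> y + 1 / Suc n * z < b"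
            by (auto intro: eventually_conj)
          then show ?thesis by (rule eventually_mono) (use 3 in auto)
        qed
      qed
      then show "(\<lambda>n. cindicator a b (y + 1 / Suc n * z)) \<longlonglongrightarrow> cindicator a b y"
        by (intro tendsto_of_real tendsto_eventually)
    qed
    show "AE z in lborel. norm (cindicator a b (y + 1 / Suc n * z) * complex_of_real (?\<phi> z)) \<le> ?\<phi> z" for n
      by (auto simp: norm_mult indicator_def normal_density_nonneg)
  qed measurable
  moreover have "(\<integral>z. cindicator a b y * complex_of_real (?\<phi> z) \<partial>lborel) = cindicator a b y"
    by simp
  ultimately show ?thesis by (simp only: eq)
qed

text \<open>The transform of an indicator decays too slowly to be integrable in general, so it is
  regularised to \<open>k n\<close> by a Gaussian factor. The transform of \<open>k n\<close> is an
  average of the indicator over a shrinking Gaussian, which converges except at two points. Since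
  \<open>k n\<close> also converges in L2, the two limits can be identified.\<close>

lemma cfourier_L2_cfourier_L2_indicator:
  "AE x in lborel. cfourier_L2 (cfourier (cindicator a b)) x = 2 * pi * cindicator a b (- x)"
proof -
  let ?F = "cfourier (cindicator a b)"
  let ?g = "\<lambda>n. gauss (1 / Suc n)"
  have [measurable]: "?F \<in> borel_measurable borel"
    by (rule borel_measurable_cfourier[OF integrable_cindicator])
  define M where "M = (\<integral>x. norm (cindicator a b x) \<partial>lborel)"
  have bd: "norm (?F \<xi>) \<le> M" for \<xi> unfolding M_def by (rule norm_cfourier_le)
  define k where "k n \<xi> = complex_of_real (?g n \<xi>) * ?F \<xi>" for n \<xi>
  have F2: "square_integrable ?F"
    by (rule cfourier_L2_bound[OF integrable_cindicator square_integrable_indicator])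
  have k1: "integrable lborel (k n)" for n
    unfolding k_def[abs_def] mult.commute[of _ "?F _"]
    by (rule integrable_bounded_mult[OF integrable_gauss _ bd]) auto
  have k2: "square_integrable (k n)" for n
    unfolding k_def[abs_def] by (rule square_integrable_bounded_mult[OF F2, of _ 1]) (auto simp: gauss_bounds)
  have ck: "cfourier (k n) x = 2 * pi * (\<integral>y. cindicator a b y * complex_of_real (normal_density 0 (1 / Suc n) (y - (- x))) \<partial>lborel)" for n x
  proof -
    have "cfourier (k n) x = (\<integral>\<xi>. ?F \<xi> * (exp (\<i> * complex_of_real (- x * \<xi>)) * complex_of_real (?g n \<xi>)) \<partial>lborel)"
      unfolding cfourier_def[of "k n"] k_def by (intro Bochner_Integration.integral_cong) (auto simp: mult_ac)
    also have "\<dots> = (\<integral>y. cindicator a b y * complex_of_real (2 * pi * normal_density 0 (1 / Suc n) (y - (- x))) \<partial>lborel)"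
      by (subst cfourier_mult_formula[OF integrable_cindicator integrable_modulated_gauss])
         (simp_all only: cfourier_modulated_gauss[of "1 / Suc n"] of_nat_0_less_iff zero_less_divide_1_iff zero_less_Suc)
    also have "\<dots> = (\<integral>y. complex_of_real (2 * pi) * (cindicator a b y * complex_of_real (normal_density 0 (1 / Suc n) (y - (- x)))) \<partial>lborel)"
      by (simp add: mult_ac)
    finally show ?thesis by (simp only: integral_mult_right_zero)
  qed
  have "(\<lambda>n. \<integral>x. (norm (k n x - ?F x))\<^sup>2 \<partial>lborel) \<longlonglongrightarrow> integral\<^sup>L lborel (\<lambda>x::real. 0)"
  proof (rule integral_dominated_convergence)
    show "integrable lborel (\<lambda>x. (norm (?F x))\<^sup>2)" by (rule integrable_square_integrable[OF F2])
    show "AE x in lborel. (\<lambda>n. (norm (k n x - ?F x))\<^sup>2) \<longlonglongrightarrow> 0"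
    proof (rule AE_I2)
      fix x
      have "(\<lambda>n. (norm (complex_of_real (?g n x) * ?F x - ?F x))\<^sup>2) \<longlonglongrightarrow> (norm (complex_of_real 1 * ?F x - ?F x))\<^sup>2"
        by (intro tendsto_intros gauss_tendsto_1)
      then show "(\<lambda>n. (norm (k n x - ?F x))\<^sup>2) \<longlonglongrightarrow> 0" by (simp add: k_def)
    qed
    show "AE x in lborel. norm ((norm (k n x - ?F x))\<^sup>2) \<le> (norm (?F x))\<^sup>2" for n
    proof (rule AE_I2)
      fix x
      have "k n x - ?F x = complex_of_real (?g n x - 1) * ?F x" by (simp add: k_def left_diff_distrib)
      then have "norm (k n x - ?F x) = \<bar>?g n x - 1\<bar> * norm (?F x)" by (simp only: norm_mult norm_of_real)
      also have "\<dots> \<le> 1 * norm (?F x)"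
        using gauss_bounds[of "1 / Suc n" x] by (intro mult_right_mono) auto
      finally show "norm ((norm (k n x - ?F x))\<^sup>2) \<le> (norm (?F x))\<^sup>2" by (simp add: power_mono)
    qed
  qed (auto simp: k_def[abs_def])
  from tendsto_real_sqrt[OF this] have "(\<lambda>n. L2norm (\<lambda>x. k n x - ?F x)) \<longlonglongrightarrow> 0" by (simp add: L2norm_def)
  then have l2: "(\<lambda>n. L2norm (\<lambda>x. cfourier_L2 (k n) x - cfourier_L2 ?F x)) \<longlonglongrightarrow> 0"
    by (rule cfourier_L2_tendsto_L2[OF k2 F2])
  have "AE x in lborel. \<forall>n. cfourier_L2 (k n) x = cfourier (k n) x"
    unfolding AE_all_countable using cfourier_L2_eq_cfourier[OF k2 k1] by blast
  moreover have ne: "AE x in lborel. - x \<noteq> c" for c :: real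
    using AE_lborel_singleton[of "-c"] by eventually_elim auto
  note ne[of a] ne[of b]
  ultimately have "AE x in lborel. (\<lambda>n. cfourier_L2 (k n) x) \<longlonglongrightarrow> 2 * pi * cindicator a b (- x)"
  proof eventually_elim
    case (elim x)
    show ?case
      unfolding elim(1)[rule_format] ck
      by (intro tendsto_mult_left normal_density_indicator_tendsto elim)
  qed
  then have "AE x in lborel. 2 * pi * cindicator a b (- x) = cfourier_L2 ?F x"
    by (rule L2_limit_unique_AE[OF square_integrable_cfourier_L2[OF k2] _ square_integrable_cfourier_L2[OF F2] _ l2, rotated])
       measurable
  then show ?thesis by eventually_elim simp
qed

text \<open>Duality: paired with an indicator, both transforms are moved onto the indicator by the
  multiplication formula, and there the inversion formula is already known. Indicators of intervals
  separate functions.\<close>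

lemma cfourier_L2_inversion:
  fixes f :: "real \<Rightarrow> complex"
  assumes f: "square_integrable f"
  shows "AE x in lborel. cfourier_L2 (cfourier_L2 f) x = 2 * pi * f (- x)"
proof -
  note Ff = square_integrable_cfourier_L2[OF f]
  note FFf = square_integrable_cfourier_L2[OF Ff]
  have Rf: "square_integrable (\<lambda>x. 2 * pi * f (- x))"
    by (rule square_integrable_cmult[OF square_integrable_reflect[OF f]])
  have "AE x in lborel. cfourier_L2 (cfourier_L2 f) x - 2 * pi * f (- x) = 0"
  proof (rule AE_eq_0_of_interval_integrals[OF square_integrable_mult[OF square_integrable_indicator square_integrable_diff[OF FFf Rf]]])
    fix a b
    let ?\<chi> = "cindicator a b"
    note \<chi> = square_integrable_indicator[of a b]
    have [measurable]: "f \<in> borel_measurable borel" by (rule borel_measurable_square_integrable[OF f])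
    have F\<chi>: "square_integrable (cfourier ?\<chi>)"
      by (rule cfourier_L2_bound[OF integrable_cindicator \<chi>])
    have "(\<integral>x. cfourier_L2 (cfourier_L2 f) x * ?\<chi> x \<partial>lborel) = (\<integral>x. cfourier_L2 f x * cfourier_L2 ?\<chi> x \<partial>lborel)"
      by (rule cfourier_L2_mult_formula[OF Ff \<chi>])
    also have "\<dots> = (\<integral>x. f x * cfourier_L2 (cfourier_L2 ?\<chi>) x \<partial>lborel)"
      by (rule cfourier_L2_mult_formula[OF f square_integrable_cfourier_L2[OF \<chi>]])
    also have "cfourier_L2 (cfourier_L2 ?\<chi>) = cfourier_L2 (cfourier ?\<chi>)"
      by (intro cfourier_L2_cong_AE cfourier_L2_eq_cfourier[OF \<chi> integrable_cindicator]
          borel_measurable_square_integrable square_integrable_cfourier_L2 \<chi> F\<chi>)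
    also have "(\<integral>x. f x * cfourier_L2 (cfourier ?\<chi>) x \<partial>lborel) = (\<integral>x. f x * (2 * pi * ?\<chi> (- x)) \<partial>lborel)"
      using cfourier_L2_cfourier_L2_indicator[of a b] borel_measurable_square_integrable[OF square_integrable_cfourier_L2[OF F\<chi>]]
      by (intro integral_cong_AE) auto
    also have "\<dots> = (\<integral>x. f (- x) * (2 * pi * ?\<chi> x) \<partial>lborel)"
      using lborel_integral_real_affine[of "-1" "\<lambda>x. f x * (2 * pi * ?\<chi> (- x))" 0] by simp
    finally have "(\<integral>x. cfourier_L2 (cfourier_L2 f) x * ?\<chi> x \<partial>lborel) = (\<integral>x. 2 * pi * f (- x) * ?\<chi> x \<partial>lborel)"
      by (simp add: mult_ac)
    then show "(\<integral>x. ?\<chi> x * (cfourier_L2 (cfourier_L2 f) x - 2 * pi * f (- x)) \<partial>lborel) = 0"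
      using square_integrable_mult[OF \<chi> FFf] square_integrable_mult[OF \<chi> Rf]
      by (simp add: right_diff_distrib mult.commute)
  qed
  then show ?thesis by eventually_elim simp
qed

lemma cfourier_L2_reflect:
  assumes f: "square_integrable f"
  shows "AE \<xi> in lborel. cfourier_L2 (\<lambda>x. f (- x)) \<xi> = cfourier_L2 f (- \<xi>)"
proof (rule cfourier_L2_unique[OF square_integrable_reflect[OF f]
      square_integrable_reflect[OF square_integrable_cfourier_L2[OF f]]])
  have "truncate R (\<lambda>x. f (- x)) = (\<lambda>x. truncate R f (- x))" for R
    by (auto simp: truncate_def fun_eq_iff indicator_def)
  then have "L2norm (\<lambda>\<xi>. cfourier (truncate R (\<lambda>x. f (- x))) \<xi> - cfourier_L2 f (- \<xi>)) =
      L2norm (\<lambda>\<xi>. cfourier (truncate R f) \<xi> - cfourier_L2 f \<xi>)" for R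
    using L2norm_reflect[of "\<lambda>\<xi>. cfourier (truncate R f) \<xi> - cfourier_L2 f \<xi>"]
    by (simp add: cfourier_uminus_arg)
  then show "((\<lambda>R. L2norm (\<lambda>\<xi>. cfourier (truncate R (\<lambda>x. f (- x))) \<xi> - cfourier_L2 f (- \<xi>))) \<longlongrightarrow> 0) at_top"
    using cfourier_L2_tendsto[OF f] by simp
qed

lemma square_integrable_cnj:
  assumes "square_integrable f" shows "square_integrable (\<lambda>x. cnj (f x))"
  using assms by (auto simp: square_integrable_def intro: borel_measurable_cnj)

lemma cfourier_L2_cnj:
  assumes f: "square_integrable f"
  shows "AE \<xi> in lborel. cfourier_L2 (\<lambda>x. cnj (f x)) \<xi> = cnj (cfourier_L2 f (- \<xi>))"
proof (rule cfourier_L2_unique[OF square_integrable_cnj[OF f]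
      square_integrable_cnj[OF square_integrable_reflect[OF square_integrable_cfourier_L2[OF f]]]])
  have t: "truncate R (\<lambda>x. cnj (f x)) = (\<lambda>x. cnj (truncate R f x))" for R
    by (auto simp: truncate_def fun_eq_iff)
  have "L2norm (\<lambda>\<xi>. cfourier (truncate R (\<lambda>x. cnj (f x))) \<xi> - cnj (cfourier_L2 f (- \<xi>))) =
      L2norm (\<lambda>\<xi>. cfourier (truncate R f) (- \<xi>) - cfourier_L2 f (- \<xi>))" for R
    by (rule L2norm_cong_norm)
       (simp only: t cfourier_cnj complex_cnj_diff[symmetric] complex_mod_cnj)
  then show "((\<lambda>R. L2norm (\<lambda>\<xi>. cfourier (truncate R (\<lambda>x. cnj (f x))) \<xi> - cnj (cfourier_L2 f (- \<xi>)))) \<longlongrightarrow> 0) at_top"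
    using cfourier_L2_tendsto[OF f] L2norm_reflect[of "\<lambda>\<xi>. cfourier (truncate _ f) \<xi> - cfourier_L2 f \<xi>"]
    by simp
qed

text \<open>The preimage is the one that the inversion formula dictates. Its explicit form is
  exported because reality of the preimage has to be checked later for Hermitian
  \<open>g\<close>.\<close>

lemma cfourier_L2_surj:
  fixes g :: "real \<Rightarrow> complex"
  assumes g: "square_integrable g"
  obtains f where "square_integrable f" "AE \<xi> in lborel. cfourier_L2 f \<xi> = g \<xi>"
    "f = (\<lambda>x. 1 / (2 * pi) * cfourier_L2 g (- x))"
proof
  define f where "f = (\<lambda>x. complex_of_real (1 / (2 * pi)) * cfourier_L2 g (- x))"
  note Fg = square_integrable_cfourier_L2[OF g]
  note RFg = square_integrable_reflect[OF Fg]
  show "f = (\<lambda>x. 1 / (2 * pi) * cfourier_L2 g (- x))" by (simp add: f_def)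
  show "square_integrable f" unfolding f_def by (rule square_integrable_cmult[OF RFg])
  have m: "cfourier_L2 (cfourier_L2 g) \<in> borel_measurable borel"
    by (rule borel_measurable_square_integrable[OF square_integrable_cfourier_L2[OF Fg]])
  note [measurable] = m borel_measurable_square_integrable[OF g]
  have "AE \<xi> in lborel. cfourier_L2 (cfourier_L2 g) (- \<xi>) = 2 * pi * g (- (- \<xi>))"
    by (rule AE_lborel_reflect[OF cfourier_L2_inversion[OF g]]) measurable
  with cfourier_L2_reflect[OF Fg] cfourier_L2_cmult[OF RFg, of "complex_of_real (1 / (2 * pi))"]
  show "AE \<xi> in lborel. cfourier_L2 f \<xi> = g \<xi>"
    unfolding f_def[symmetric] by eventually_elim simp
qed

text \<open>The multiplication formula with the reflected transform of \<open>g\<close> in the place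
  of \<open>g\<close>, followed by inversion. The bilinear form, with a reflection instead of a
  conjugate, is also what yields the convolution formula for u^2.\<close>

lemma cfourier_L2_Parseval:
  fixes f g :: "real \<Rightarrow> complex"
  assumes f: "square_integrable f" and g: "square_integrable g"
  shows "(\<integral>\<xi>. cfourier_L2 f \<xi> * cfourier_L2 g (- \<xi>) \<partial>lborel) = 2 * pi * (\<integral>x. f x * g x \<partial>lborel)"
proof -
  note Fg = square_integrable_cfourier_L2[OF g]
  have m: "cfourier_L2 (cfourier_L2 g) \<in> borel_measurable borel"
    by (rule borel_measurable_square_integrable[OF square_integrable_cfourier_L2[OF Fg]])
  note [measurable] = m borel_measurable_square_integrable[OF g] borel_measurable_square_integrable[OF f]
    borel_measurable_square_integrable[OF square_integrable_cfourier_L2[OF square_integrable_reflect[OF Fg]]]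
  have ae: "AE \<xi> in lborel. cfourier_L2 (cfourier_L2 g) (- \<xi>) = 2 * pi * g (- (- \<xi>))"
    by (rule AE_lborel_reflect[OF cfourier_L2_inversion[OF g]]) measurable
  have "(\<integral>\<xi>. cfourier_L2 f \<xi> * cfourier_L2 g (- \<xi>) \<partial>lborel) = (\<integral>x. f x * cfourier_L2 (\<lambda>\<xi>. cfourier_L2 g (- \<xi>)) x \<partial>lborel)"
    by (rule cfourier_L2_mult_formula[OF f square_integrable_reflect[OF Fg]])
  also have "\<dots> = (\<integral>x. 2 * pi * (f x * g x) \<partial>lborel)"
    using ae cfourier_L2_reflect[OF Fg] by (intro integral_cong_AE) auto
  finally show ?thesis by simp
qed

text \<open>Parseval's identity for \<open>f\<close> and its conjugate; reflecting the transform of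
  the conjugate gives the conjugate of the transform.\<close>

lemma cfourier_L2_isometry:
  assumes f: "square_integrable f"
  shows "L2norm (cfourier_L2 f) = sqrt (2 * pi) * L2norm f"
proof -
  note Ff = square_integrable_cfourier_L2[OF f]
  note cf = square_integrable_cnj[OF f]
  note [measurable] = borel_measurable_square_integrable[OF Ff]
    borel_measurable_cnj[OF borel_measurable_square_integrable[OF Ff]]
    borel_measurable_square_integrable[OF square_integrable_cfourier_L2[OF cf]]
  have ae: "AE \<xi> in lborel. cfourier_L2 (\<lambda>x. cnj (f x)) (- \<xi>) = cnj (cfourier_L2 f (- (- \<xi>)))"
    by (rule AE_lborel_reflect[OF cfourier_L2_cnj[OF f]]) measurable
  have "complex_of_real ((L2norm (cfourier_L2 f))\<^sup>2) = (\<integral>\<xi>. cfourier_L2 f \<xi> * cnj (cfourier_L2 f \<xi>) \<partial>lborel)"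
    unfolding L2norm_square complex_norm_square[symmetric] integral_complex_of_real ..
  also have "\<dots> = (\<integral>\<xi>. cfourier_L2 f \<xi> * cfourier_L2 (\<lambda>x. cnj (f x)) (- \<xi>) \<partial>lborel)"
    using ae by (intro integral_cong_AE) auto
  also have "\<dots> = 2 * pi * (\<integral>x. f x * cnj (f x) \<partial>lborel)" by (rule cfourier_L2_Parseval[OF f cf])
  also have "(\<integral>x. f x * cnj (f x) \<partial>lborel) = complex_of_real ((L2norm f)\<^sup>2)"
    unfolding L2norm_square complex_norm_square[symmetric] integral_complex_of_real ..
  finally have "complex_of_real ((L2norm (cfourier_L2 f))\<^sup>2) = complex_of_real (2 * pi * (L2norm f)\<^sup>2)" by simp
  then have "(L2norm (cfourier_L2 f))\<^sup>2 = (sqrt (2 * pi) * L2norm f)\<^sup>2"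
    unfolding of_real_eq_iff by (simp add: power_mult_distrib)
  then show ?thesis by (rule power2_eq_imp_eq) auto
qed

section \<open>Real functions and Fourier multipliers\<close>

lemma square_integrable_fourier_L2: "square_integrable f \<Longrightarrow> square_integrable (fourier_L2 f)"
  by (simp add: fourier_L2_eq_cfourier_L2 square_integrable_cfourier_L2 square_integrable_of_real)

lemma fourier_L2_measurable: "square_integrable f \<Longrightarrow> fourier_L2 f \<in> borel_measurable borel"
  by (intro borel_measurable_square_integrable square_integrable_fourier_L2)

lemma L2norm_fourier_L2: "square_integrable f \<Longrightarrow> L2norm (fourier_L2 f) = sqrt (2 * pi) * L2norm f"
  by (simp add: fourier_L2_eq_cfourier_L2 cfourier_L2_isometry square_integrable_of_real L2norm_of_real)

lemma fourier_L2_cong_AE: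
  assumes "f \<in> borel_measurable borel" "g \<in> borel_measurable borel" "AE x in lborel. f x = g x"
  shows "fourier_L2 f = fourier_L2 g"
  unfolding fourier_L2_eq_cfourier_L2 using assms(1,2)
  by (intro cfourier_L2_cong_AE borel_measurable_of_real[THEN measurable_compose[rotated]])
     (use assms(3) in \<open>auto elim!: eventually_mono\<close>)

lemma fourier_L2_diff:
  assumes "square_integrable f" "square_integrable g"
  shows "AE \<xi> in lborel. fourier_L2 (\<lambda>x. f x - g x) \<xi> = fourier_L2 f \<xi> - fourier_L2 g \<xi>"
  using cfourier_L2_diff[of "\<lambda>x. complex_of_real (f x)" "\<lambda>x. complex_of_real (g x)"] assms
  by (simp add: fourier_L2_eq_cfourier_L2 square_integrable_of_real)

lemma fourier_L2_eq_fourier: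
  assumes "square_integrable f" "integrable lborel f"
  shows "AE \<xi> in lborel. fourier_L2 f \<xi> = fourier f \<xi>"
  using cfourier_L2_eq_cfourier[of "\<lambda>x. complex_of_real (f x)"] assms
  by (simp add: fourier_L2_eq_cfourier_L2 fourier_eq_cfourier square_integrable_of_real)

lemma fourier_L2_hermitian:
  assumes f: "square_integrable f"
  shows "AE \<xi> in lborel. fourier_L2 f (- \<xi>) = cnj (fourier_L2 f \<xi>)"
proof -
  have "AE \<xi> in lborel. fourier_L2 f \<xi> = cnj (fourier_L2 f (- \<xi>))"
    using cfourier_L2_cnj[of "\<lambda>x. complex_of_real (f x)"] f
    by (simp add: fourier_L2_eq_cfourier_L2 square_integrable_of_real)
  then show ?thesis by eventually_elim (metis complex_cnj_cnj)
qed

lemma fourier_L2_Parseval: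
  assumes f: "square_integrable f" and g: "square_integrable g"
  shows "(\<integral>\<xi>. fourier_L2 f \<xi> * cnj (fourier_L2 g \<xi>) \<partial>lborel) = complex_of_real (2 * pi * (\<integral>x. f x * g x \<partial>lborel))"
proof -
  have c: "square_integrable (\<lambda>x. complex_of_real (f x))" "square_integrable (\<lambda>x. complex_of_real (g x))"
    using f g by (auto simp: square_integrable_of_real)
  note [measurable] = fourier_L2_measurable[OF f] fourier_L2_measurable[OF g]
    borel_measurable_cnj[OF fourier_L2_measurable[OF g]]
  have "(\<integral>\<xi>. fourier_L2 f \<xi> * cnj (fourier_L2 g \<xi>) \<partial>lborel) = (\<integral>\<xi>. fourier_L2 f \<xi> * fourier_L2 g (- \<xi>) \<partial>lborel)"
    using fourier_L2_hermitian[OF g] by (intro integral_cong_AE) auto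
  also have "\<dots> = 2 * pi * (\<integral>x. complex_of_real (f x) * complex_of_real (g x) \<partial>lborel)"
    unfolding fourier_L2_eq_cfourier_L2 by (rule cfourier_L2_Parseval[OF c])
  finally show ?thesis by (simp flip: of_real_mult)
qed

text \<open>For Hermitian \<open>g\<close> the preimage supplied by inversion equals its own
  conjugate almost everywhere, so its real part has the same transform.\<close>

lemma fourier_L2_surj:
  assumes g: "square_integrable g" and herm: "AE \<xi> in lborel. g (- \<xi>) = cnj (g \<xi>)"
  shows "\<exists>f. square_integrable f \<and> (AE \<xi> in lborel. fourier_L2 f \<xi> = g \<xi>)"
proof -
  obtain h where h: "square_integrable h" "AE \<xi> in lborel. cfourier_L2 h \<xi> = g \<xi>"
    and h_def: "h = (\<lambda>x. 1 / (2 * pi) * cfourier_L2 g (- x))"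
    by (rule cfourier_L2_surj[OF g])
  note cg = square_integrable_cnj[OF g] and Rg = square_integrable_reflect[OF g]
  note [measurable] = borel_measurable_square_integrable[OF g] borel_measurable_square_integrable[OF Rg]
    borel_measurable_square_integrable[OF cg] borel_measurable_square_integrable[OF h(1)]
    borel_measurable_square_integrable[OF square_integrable_cfourier_L2[OF g]]
    borel_measurable_cnj[OF borel_measurable_square_integrable[OF square_integrable_cfourier_L2[OF g]]]
  have "cfourier_L2 (\<lambda>x. g (- x)) = cfourier_L2 (\<lambda>x. cnj (g x))"
    by (intro cfourier_L2_cong_AE herm) measurable
  with cfourier_L2_reflect[OF g] cfourier_L2_cnj[OF g]
  have "AE x in lborel. cfourier_L2 g (- x) = cnj (cfourier_L2 g (- x))"
    by (auto elim: eventually_elim2)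
  then have real: "AE x in lborel. complex_of_real (Re (h x)) = h x"
    unfolding h_def by eventually_elim (simp add: complex_eq_iff)
  have sq: "square_integrable (\<lambda>x. Re (h x))"
    by (rule square_integrable_dominated[OF _ integrable_square_integrable[OF h(1)]])
       (auto intro!: power2_le_iff_abs_le[THEN iffD2] abs_Re_le_cmod)
  have "fourier_L2 (\<lambda>x. Re (h x)) = cfourier_L2 h"
    unfolding fourier_L2_eq_cfourier_L2 by (intro cfourier_L2_cong_AE real) measurable
  with sq h(2) show ?thesis by auto
qed

text \<open>A Hermitian symbol keeps the product Hermitian, so a real preimage exists and the choice
  in \<open>fourier_multiplier\<close> is made from a nonempty set.\<close>

lemma fourier_multiplier_spec:
  assumes f: "square_integrable f" and m: "\<And>\<xi>. m (- \<xi>) = cnj (m \<xi>)"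
    and mf: "square_integrable (\<lambda>\<xi>. m \<xi> * fourier_L2 f \<xi>)"
  shows "square_integrable (fourier_multiplier m f)"
    and "AE \<xi> in lborel. fourier_L2 (fourier_multiplier m f) \<xi> = m \<xi> * fourier_L2 f \<xi>"
proof -
  have "AE \<xi> in lborel. m (- \<xi>) * fourier_L2 f (- \<xi>) = cnj (m \<xi> * fourier_L2 f \<xi>)"
    using fourier_L2_hermitian[OF f] by eventually_elim (simp add: m)
  from someI_ex[OF fourier_L2_surj[OF mf this]]
  show "square_integrable (fourier_multiplier m f)"
    "AE \<xi> in lborel. fourier_L2 (fourier_multiplier m f) \<xi> = m \<xi> * fourier_L2 f \<xi>"
    unfolding fourier_multiplier_def by auto
qed

section \<open>The symbol of A, its unitary group, and A itself\<close>

lemma one_plus_powr_pos: "0 < 1 + \<bar>\<xi>::real\<bar> powr \<alpha>"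
  by (smt (verit) powr_ge_zero)

lemma symbolA_eq: "symbolA \<alpha> \<xi> = - (\<i> * complex_of_real (\<xi> / (1 + \<bar>\<xi>\<bar> powr \<alpha>)))"
  by (simp add: symbolA_def)

lemma Re_symbolA [simp]: "Re (symbolA \<alpha> \<xi>) = 0"
  by (simp add: symbolA_eq del: of_real_divide)

lemma cnj_symbolA: "cnj (symbolA \<alpha> \<xi>) = - symbolA \<alpha> \<xi>"
  by (simp add: complex_eq_iff)

lemma symbolA_uminus: "symbolA \<alpha> (- \<xi>) = cnj (symbolA \<alpha> \<xi>)"
  by (simp add: symbolA_eq)

lemma continuous_symbolA: "\<alpha> > 0 \<Longrightarrow> continuous_on UNIV (symbolA \<alpha>)"
  unfolding symbolA_def using one_plus_powr_pos[of _ \<alpha>]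
  by (intro continuous_intros continuous_on_powr') (auto simp: of_real_eq_0_iff less_le simp del: of_real_add)

lemma symbolA_measurable: "\<alpha> > 0 \<Longrightarrow> symbolA \<alpha> \<in> borel_measurable borel"
  by (intro borel_measurable_continuous_onI continuous_symbolA)

lemma norm_symbolA_le: "norm (symbolA \<alpha> \<xi>) \<le> \<bar>\<xi>\<bar>"
proof -
  have "\<bar>\<xi>\<bar> / (1 + \<bar>\<xi>\<bar> powr \<alpha>) \<le> \<bar>\<xi>\<bar> / 1"
    using one_plus_powr_pos[of \<xi> \<alpha>] by (intro divide_left_mono) auto
  then show ?thesis
    using one_plus_powr_pos[of \<xi> \<alpha>] by (simp add: symbolA_eq norm_mult norm_divide del: of_real_add)
qed

lemma norm_exp_symbolA [simp]: "norm (exp (complex_of_real t * symbolA \<alpha> \<xi>)) = 1"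
  by (simp add: symbolA_eq norm_exp_eq_Re)

context
  fixes \<alpha> :: real
  assumes \<alpha>: "\<alpha> > 0"
begin

lemma groupA_symbol_measurable: "(\<lambda>\<xi>. exp (complex_of_real t * symbolA \<alpha> \<xi>)) \<in> borel_measurable borel"
  by (intro borel_measurable_continuous_onI continuous_intros continuous_on_subset[OF continuous_symbolA[OF \<alpha>]]) auto

lemma groupA_spec:
  assumes f: "square_integrable f"
  shows "square_integrable (groupA \<alpha> t f)"
    and "AE \<xi> in lborel. fourier_L2 (groupA \<alpha> t f) \<xi> = exp (complex_of_real t * symbolA \<alpha> \<xi>) * fourier_L2 f \<xi>"
proof -
  have "square_integrable (\<lambda>\<xi>. exp (complex_of_real t * symbolA \<alpha> \<xi>) * fourier_L2 f \<xi>)"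
    by (rule square_integrable_bounded_mult[OF square_integrable_fourier_L2[OF f] groupA_symbol_measurable, of _ 1]) simp
  from fourier_multiplier_spec[OF f _ this]
  show "square_integrable (groupA \<alpha> t f)"
    "AE \<xi> in lborel. fourier_L2 (groupA \<alpha> t f) \<xi> = exp (complex_of_real t * symbolA \<alpha> \<xi>) * fourier_L2 f \<xi>"
    by (auto simp: groupA_def symbolA_uminus exp_cnj)
qed

lemma L2norm_groupA:
  assumes f: "square_integrable f"
  shows "L2norm (groupA \<alpha> t f) = L2norm f"
proof -
  note g = groupA_spec[OF f, of t]
  note [measurable] = groupA_symbol_measurable fourier_L2_measurable[OF f]
  have "L2norm (fourier_L2 (groupA \<alpha> t f)) = L2norm (\<lambda>\<xi>. exp (complex_of_real t * symbolA \<alpha> \<xi>) * fourier_L2 f \<xi>)"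
    by (rule L2norm_cong_AE[OF fourier_L2_measurable[OF g(1)] _ g(2)]) measurable
  also have "\<dots> = L2norm (fourier_L2 f)" by (rule L2norm_cong_norm) (simp add: norm_mult)
  finally show ?thesis by (simp add: L2norm_fourier_L2 f g(1))
qed

text \<open>The symbol is purely imaginary, so the adjoint of exp(\<sigma> A) is exp(-\<sigma> A).
  This moves additional time onto the test function, which is how Duhamel's formula is continued
  past the final time.\<close>

lemma groupA_adjoint:
  assumes f: "square_integrable f" and g: "square_integrable g"
  shows "(\<integral>x. groupA \<alpha> (t + \<sigma>) f x * g x \<partial>lborel) = (\<integral>x. groupA \<alpha> t f x * groupA \<alpha> (- \<sigma>) g x \<partial>lborel)"
proof -
  note f1 = groupA_spec[OF f, of "t + \<sigma>"] and f2 = groupA_spec[OF f, of t] and g1 = groupA_spec[OF g, of "- \<sigma>"]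
  note [measurable] = fourier_L2_measurable[OF f1(1)] fourier_L2_measurable[OF f2(1)] fourier_L2_measurable[OF g]
    fourier_L2_measurable[OF g1(1)] fourier_L2_measurable[OF f]
  have "(\<integral>\<xi>. fourier_L2 (groupA \<alpha> (t + \<sigma>) f) \<xi> * cnj (fourier_L2 g \<xi>) \<partial>lborel)
      = (\<integral>\<xi>. fourier_L2 (groupA \<alpha> t f) \<xi> * cnj (fourier_L2 (groupA \<alpha> (- \<sigma>) g) \<xi>) \<partial>lborel)"
  proof (rule integral_cong_AE)
    show "AE \<xi> in lborel. fourier_L2 (groupA \<alpha> (t + \<sigma>) f) \<xi> * cnj (fourier_L2 g \<xi>)
      = fourier_L2 (groupA \<alpha> t f) \<xi> * cnj (fourier_L2 (groupA \<alpha> (- \<sigma>) g) \<xi>)"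
      using f1(2) f2(2) g1(2)
    proof eventually_elim
      case (elim \<xi>)
      have "cnj (exp (complex_of_real (- \<sigma>) * symbolA \<alpha> \<xi>)) = exp (complex_of_real \<sigma> * symbolA \<alpha> \<xi>)"
        by (simp add: cnj_symbolA exp_cnj)
      moreover have "exp (complex_of_real (t + \<sigma>) * symbolA \<alpha> \<xi>)
          = exp (complex_of_real t * symbolA \<alpha> \<xi>) * exp (complex_of_real \<sigma> * symbolA \<alpha> \<xi>)"
        by (simp add: exp_add[symmetric] distrib_right)
      ultimately show ?case by (simp only: elim complex_cnj_mult) (simp only: mult_ac)
    qed
  qed (auto intro!: borel_measurable_times borel_measurable_cnj)
  then show ?thesis
    unfolding fourier_L2_Parseval[OF f1(1) g] fourier_L2_Parseval[OF f2(1) g1(1)] of_real_eq_iff by simp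
qed

lemma opA_spec:
  assumes f: "square_integrable f" and \<xi>f: "square_integrable (\<lambda>\<xi>. complex_of_real \<xi> * fourier_L2 f \<xi>)"
  shows "square_integrable (opA \<alpha> f)"
    and "AE \<xi> in lborel. fourier_L2 (opA \<alpha> f) \<xi> = symbolA \<alpha> \<xi> * fourier_L2 f \<xi>"
proof -
  note [measurable] = fourier_L2_measurable[OF f] symbolA_measurable[OF \<alpha>]
  have "square_integrable (\<lambda>\<xi>. symbolA \<alpha> \<xi> * fourier_L2 f \<xi>)"
  proof (rule square_integrable_le[OF _ \<xi>f, of _ 1])
    show "norm (symbolA \<alpha> \<xi> * fourier_L2 f \<xi>) \<le> 1 * norm (complex_of_real \<xi> * fourier_L2 f \<xi>)" for \<xi>
      using mult_right_mono[OF norm_symbolA_le norm_ge_zero, of \<alpha> \<xi> "fourier_L2 f \<xi>"] by (simp add: norm_mult)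
  qed measurable
  from fourier_multiplier_spec[OF f _ this]
  show "square_integrable (opA \<alpha> f)"
    "AE \<xi> in lborel. fourier_L2 (opA \<alpha> f) \<xi> = symbolA \<alpha> \<xi> * fourier_L2 f \<xi>"
    by (auto simp: opA_def symbolA_uminus)
qed

end

section \<open>Weighted integrability and Young's inequality\<close>

lemma
  shows integrable_inverse_one_plus_square: "integrable lborel (\<lambda>x::real. inverse (1 + x\<^sup>2))"
    and integral_inverse_one_plus_square: "integral\<^sup>L lborel (\<lambda>x::real. inverse (1 + x\<^sup>2)) = pi"
  using integrable_inverse_1_plus_square LBINT_inverse_1_plus_square
  by (auto simp: set_integrable_def interval_lebesgue_integral_def set_lebesgue_integral_def einterval_def)

text \<open>Cauchy-Schwarz against (1 + x^2)^(-1/2), whose squared L2 norm is pi. The lemma is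
  applied both in x, using decay, and in \<xi>, using Sobolev regularity.\<close>

lemma square_integrable_weight:
  fixes f :: "real \<Rightarrow> 'a::{real_normed_field,banach,second_countable_topology}"
  assumes f: "f \<in> borel_measurable borel" and w: "integrable lborel (\<lambda>x. (1 + x\<^sup>2) * (norm (f x))\<^sup>2)"
  shows "integrable lborel f" and "(\<integral>x. norm (f x) \<partial>lborel) \<le> sqrt pi * sqrt (\<integral>x. (1 + x\<^sup>2) * (norm (f x))\<^sup>2 \<partial>lborel)"
proof -
  let ?a = "\<lambda>x::real. sqrt (inverse (1 + x\<^sup>2))"
  let ?b = "\<lambda>x::real. sqrt (1 + x\<^sup>2) * norm (f x)"
  note [measurable] = f
  have a: "square_integrable ?a" and b: "square_integrable ?b"
    using integrable_inverse_one_plus_square w by (auto simp: square_integrable_def power_mult_distrib)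
  have ab: "norm (?a x) * norm (?b x) = norm (f x)" for x
  proof -
    have "1 + x\<^sup>2 \<noteq> 0" using zero_le_power2[of x] by linarith
    then have "?a x * ?b x = norm (f x)"
      by (simp add: real_sqrt_mult[symmetric] mult.assoc[symmetric])
    then show ?thesis by simp
  qed
  show i: "integrable lborel f"
    using square_integrable_mult_norm[OF a b] unfolding ab by (rule integrable_norm_cancel) measurable
  have "(\<integral>x. norm (f x) \<partial>lborel) \<le> L2norm ?a * L2norm ?b"
    using L2_Cauchy_Schwarz_norm[OF a b] unfolding ab .
  also have "\<dots> = sqrt pi * sqrt (\<integral>x. (1 + x\<^sup>2) * (norm (f x))\<^sup>2 \<partial>lborel)"
    by (simp add: L2norm_def power_mult_distrib integral_inverse_one_plus_square)
  finally show "(\<integral>x. norm (f x) \<partial>lborel) \<le> sqrt pi * sqrt (\<integral>x. (1 + x\<^sup>2) * (norm (f x))\<^sup>2 \<partial>lborel)" .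
qed

text \<open>Young's inequality for L2 and L1, by Cauchy-Schwarz with |b| split into two square
  roots. It is stated for anything dominated by the convolution, because the derivative of u^2 is
  only estimated by one.\<close>

lemma square_integrable_convolution:
  fixes a b :: "real \<Rightarrow> complex" and g :: "real \<Rightarrow> complex"
  assumes a: "square_integrable a" and b: "integrable lborel b" and g: "g \<in> borel_measurable borel"
    and le: "\<And>x. ennreal (norm (g x)) \<le> (\<integral>\<^sup>+y. ennreal (norm (a y) * norm (b (x - y))) \<partial>lborel)"
  shows "square_integrable g"
proof -
  note [measurable] = g borel_measurable_square_integrable[OF a] borel_measurable_integrable[OF b]
  define B where "B = (\<integral>x. norm (b x) \<partial>lborel)"
  have B: "(\<integral>\<^sup>+y. ennreal (norm (b (x - y))) \<partial>lborel) = ennreal B" for x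
  proof -
    have "(\<integral>\<^sup>+y. ennreal (norm (b y)) \<partial>lborel) = (\<integral>\<^sup>+y. ennreal (norm (b (x - y))) \<partial>lborel)"
      using nn_integral_real_affine[of "\<lambda>y. ennreal (norm (b y))" "-1" x] by simp
    moreover have "(\<integral>\<^sup>+y. ennreal (norm (b y)) \<partial>lborel) = ennreal B"
      unfolding B_def by (rule nn_integral_eq_integral) (use b in auto)
    ultimately show ?thesis by simp
  qed
  have B': "(\<integral>\<^sup>+x. ennreal (norm (b (x - y))) \<partial>lborel) = ennreal B" for y
  proof -
    have "(\<integral>\<^sup>+x. ennreal (norm (b x)) \<partial>lborel) = (\<integral>\<^sup>+x. ennreal (norm (b (x - y))) \<partial>lborel)"
      using nn_integral_real_affine[of "\<lambda>y. ennreal (norm (b y))" 1 "-y"] by (simp add: add.commute)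
    then show ?thesis using B[of 0] nn_integral_real_affine[of "\<lambda>y. ennreal (norm (b y))" "-1" 0] by simp
  qed
  have sq: "ennreal ((norm (g x))\<^sup>2) \<le> (\<integral>\<^sup>+y. ennreal ((norm (a y))\<^sup>2) * ennreal (norm (b (x - y))) \<partial>lborel) * ennreal B" for x
  proof -
    let ?s = "\<lambda>y. ennreal (sqrt (norm (b (x - y))))"
    have s: "?s y * ?s y = ennreal (norm (b (x - y)))" for y by (simp add: ennreal_mult[symmetric])
    have "ennreal ((norm (g x))\<^sup>2) = (ennreal (norm (g x)))\<^sup>2" by (simp add: ennreal_power)
    also have "\<dots> \<le> (\<integral>\<^sup>+y. ennreal (norm (a y) * norm (b (x - y))) \<partial>lborel)\<^sup>2"
      by (rule power_mono[OF le]) simp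
    also have "\<dots> = (\<integral>\<^sup>+y. (ennreal (norm (a y)) * ?s y) * ?s y \<partial>lborel)\<^sup>2"
      by (simp add: mult.assoc s ennreal_mult)
    also have "\<dots> \<le> (\<integral>\<^sup>+y. (ennreal (norm (a y)) * ?s y)\<^sup>2 \<partial>lborel) * (\<integral>\<^sup>+y. (?s y)\<^sup>2 \<partial>lborel)"
      by (rule Cauchy_Schwarz_nn_integral) measurable
    also have "(\<integral>\<^sup>+y. (?s y)\<^sup>2 \<partial>lborel) = ennreal B" by (simp only: power2_eq_square s B)
    also have "(\<lambda>y. (ennreal (norm (a y)) * ?s y)\<^sup>2) = (\<lambda>y. ennreal ((norm (a y))\<^sup>2) * ennreal (norm (b (x - y))))"
      by (simp only: power_mult_distrib ennreal_power norm_ge_zero) (simp only: power2_eq_square s)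
    finally show ?thesis .
  qed
  have "(\<integral>\<^sup>+x. ennreal ((norm (g x))\<^sup>2) \<partial>lborel) \<le>
      (\<integral>\<^sup>+x. (\<integral>\<^sup>+y. ennreal ((norm (a y))\<^sup>2) * ennreal (norm (b (x - y))) \<partial>lborel) * ennreal B \<partial>lborel)"
    by (rule nn_integral_mono) (rule sq)
  also have "\<dots> = (\<integral>\<^sup>+x. (\<integral>\<^sup>+y. ennreal ((norm (a y))\<^sup>2) * ennreal (norm (b (x - y))) \<partial>lborel) \<partial>lborel) * ennreal B"
    by (rule nn_integral_multc) measurable
  also have "(\<integral>\<^sup>+x. (\<integral>\<^sup>+y. ennreal ((norm (a y))\<^sup>2) * ennreal (norm (b (x - y))) \<partial>lborel) \<partial>lborel)
     = (\<integral>\<^sup>+y. (\<integral>\<^sup>+x. ennreal ((norm (a y))\<^sup>2) * ennreal (norm (b (x - y))) \<partial>lborel) \<partial>lborel)"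
    by (rule lborel_pair.Fubini'[symmetric]) measurable
  also have "\<dots> = ennreal ((L2norm a)\<^sup>2) * ennreal B"
    by (simp add: nn_integral_cmult B' nn_integral_multc nn_integral_square[OF a])
  also have "\<dots> * ennreal B = ennreal ((L2norm a)\<^sup>2 * B * B)"
    by (simp add: ennreal_mult B_def)
  finally show ?thesis by (rule square_integrable_nn[OF g])
qed

section \<open>The spaces \<open>Z\<^bsub>s,r\<^esub>\<close>\<close>

lemma Sobolev_norm_le_Znorm: "Sobolev_norm s f \<le> Znorm s r f"
  unfolding Znorm_def by (rule real_le_rsqrt) simp

lemma Znorm_nonneg [simp]: "0 \<le> Znorm s r f"
  by (simp add: Znorm_def)

lemma Znorm_square: "(Znorm s r f)\<^sup>2 = (Sobolev_norm s f)\<^sup>2 + (L2norm (\<lambda>x. \<bar>x\<bar> powr r * f x))\<^sup>2"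
  by (simp add: Znorm_def)

lemma norm_sobolev_weight:
  "norm (complex_of_real ((1 + \<xi>\<^sup>2) powr (s/2)) * z) = (1 + \<xi>\<^sup>2) powr (s/2) * norm z"
  by (simp add: norm_mult)

lemma sqrt_le_sobolev_weight:
  assumes "s \<ge> 1" shows "sqrt (1 + \<xi>\<^sup>2) \<le> (1 + \<xi>\<^sup>2) powr (s/2)"
proof -
  have "(1 + \<xi>\<^sup>2) powr (1/2) \<le> (1 + \<xi>\<^sup>2) powr (s/2)" using assms by (intro powr_mono) auto
  then show ?thesis by (simp add: powr_half_sqrt)
qed

lemma fourier_L2_diff_sobolev:
  assumes "square_integrable f" "square_integrable g"
  shows "AE \<xi> in lborel. complex_of_real ((1 + \<xi>\<^sup>2) powr (s/2)) * fourier_L2 (\<lambda>x. f x - g x) \<xi> =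
    complex_of_real ((1 + \<xi>\<^sup>2) powr (s/2)) * fourier_L2 f \<xi> - complex_of_real ((1 + \<xi>\<^sup>2) powr (s/2)) * fourier_L2 g \<xi>"
  using fourier_L2_diff[OF assms] by eventually_elim (simp add: right_diff_distrib)

lemma ZspaceD:
  assumes "u \<in> Zspace s r"
  shows "square_integrable u" "u \<in> borel_measurable borel"
    "square_integrable (\<lambda>\<xi>. complex_of_real ((1 + \<xi>\<^sup>2) powr (s/2)) * fourier_L2 u \<xi>)"
    "square_integrable (\<lambda>x. \<bar>x\<bar> powr r * u x)"
  using assms by (auto simp: Zspace_def Sobolev_def square_integrable_def)

lemma Zspace_diff:
  assumes f: "f \<in> Zspace s r" and g: "g \<in> Zspace s r"
  shows "(\<lambda>x. f x - g x) \<in> Zspace s r" "Znorm s r f \<le> Znorm s r (\<lambda>x. f x - g x) + Znorm s r g"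
proof -
  note F = ZspaceD[OF f] and G = ZspaceD[OF g]
  let ?w = "\<lambda>h \<xi>. complex_of_real ((1 + \<xi>\<^sup>2) powr (s/2)) * fourier_L2 h \<xi>"
  note d = square_integrable_diff[OF F(1) G(1)]
  have [measurable]: "?w (\<lambda>x. f x - g x) \<in> borel_measurable borel"
    using fourier_L2_measurable[OF d] by measurable
  note ae = fourier_L2_diff_sobolev[OF F(1) G(1), of s]
  note wd = square_integrable_diff[OF F(3) G(3)]
  have w: "square_integrable (?w (\<lambda>x. f x - g x))"
    by (rule square_integrable_cong_AE[OF wd]) (use ae in \<open>auto elim!: eventually_mono\<close>)
  have r: "square_integrable (\<lambda>x. \<bar>x\<bar> powr r * (f x - g x))"
    using square_integrable_diff[OF F(4) G(4)] by (simp add: right_diff_distrib)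
  show "(\<lambda>x. f x - g x) \<in> Zspace s r"
    using d w r by (auto simp: Zspace_def Sobolev_def)
  have S: "Sobolev_norm s f \<le> Sobolev_norm s (\<lambda>x. f x - g x) + Sobolev_norm s g"
  proof -
    have "L2norm (\<lambda>\<xi>. ?w f \<xi> - ?w g \<xi>) = Sobolev_norm s (\<lambda>x. f x - g x)"
      unfolding Sobolev_norm_def
      by (intro L2norm_cong_AE borel_measurable_square_integrable[OF wd] borel_measurable_square_integrable[OF w])
         (use ae in \<open>auto elim!: eventually_mono\<close>)
    then show ?thesis
      using L2norm_triangle[OF wd G(3)] by (simp add: Sobolev_norm_def)
  qed
  have W: "L2norm (\<lambda>x. \<bar>x\<bar> powr r * f x) \<le> L2norm (\<lambda>x. \<bar>x\<bar> powr r * (f x - g x)) + L2norm (\<lambda>x. \<bar>x\<bar> powr r * g x)"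
    using L2norm_triangle[OF r G(4)] by (simp add: right_diff_distrib)
  have "Znorm s r f \<le> sqrt ((Sobolev_norm s (\<lambda>x. f x - g x) + Sobolev_norm s g)\<^sup>2 +
      (L2norm (\<lambda>x. \<bar>x\<bar> powr r * (f x - g x)) + L2norm (\<lambda>x. \<bar>x\<bar> powr r * g x))\<^sup>2)"
    unfolding Znorm_def
    by (intro real_sqrt_le_mono add_mono power_mono S W) (auto simp: Sobolev_norm_def)
  also have "\<dots> \<le> Znorm s r (\<lambda>x. f x - g x) + Znorm s r g"
    unfolding Znorm_def by (rule real_sqrt_sum_squares_triangle_ineq)
  finally show "Znorm s r f \<le> Znorm s r (\<lambda>x. f x - g x) + Znorm s r g" .
qed

text \<open>Not purely algebraic: the representatives of the transforms of f - g and g - f are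
  chosen independently and are negatives of each other only almost everywhere.\<close>

lemma Znorm_minus_commute: "f \<in> Zspace s r \<Longrightarrow> g \<in> Zspace s r \<Longrightarrow>
  Znorm s r (\<lambda>x. f x - g x) = Znorm s r (\<lambda>x. g x - f x)"
proof -
  assume f: "f \<in> Zspace s r" and g: "g \<in> Zspace s r"
  note d = Zspace_diff(1)[OF f g] Zspace_diff(1)[OF g f]
  have "Sobolev_norm s (\<lambda>x. f x - g x) = Sobolev_norm s (\<lambda>x. g x - f x)"
  proof -
    let ?w = "\<lambda>h \<xi>. complex_of_real ((1 + \<xi>\<^sup>2) powr (s/2)) * fourier_L2 h \<xi>"
    have "AE \<xi> in lborel. ?w (\<lambda>x. f x - g x) \<xi> = - ?w (\<lambda>x. g x - f x) \<xi>"
      using fourier_L2_diff[OF ZspaceD(1)[OF f] ZspaceD(1)[OF g]] fourier_L2_diff[OF ZspaceD(1)[OF g] ZspaceD(1)[OF f]]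
      by eventually_elim (simp add: right_diff_distrib)
    then have "L2norm (?w (\<lambda>x. f x - g x)) = L2norm (\<lambda>\<xi>. - ?w (\<lambda>x. g x - f x) \<xi>)"
      by (intro L2norm_cong_AE borel_measurable_square_integrable square_integrable_uminus ZspaceD(3)[OF d(1)] ZspaceD(3)[OF d(2)])
    then show ?thesis by (simp add: Sobolev_norm_def)
  qed
  moreover have "L2norm (\<lambda>x. \<bar>x\<bar> powr r * (f x - g x)) = L2norm (\<lambda>x. \<bar>x\<bar> powr r * (g x - f x))"
    by (rule L2norm_cong_norm) (simp add: abs_mult abs_minus_commute)
  ultimately show ?thesis by (simp add: Znorm_def)
qed

lemma square_le_one_plus_powr:
  assumes "r \<ge> 1" shows "x\<^sup>2 \<le> 1 + (\<bar>x::real\<bar> powr r)\<^sup>2"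
proof (cases "\<bar>x\<bar> \<le> 1")
  case True
  then have "x\<^sup>2 \<le> 1" using power_mono[of "\<bar>x\<bar>" 1 2] by simp
  then show ?thesis using zero_le_power2[of "\<bar>x\<bar> powr r"] by linarith
next
  case False
  then have "\<bar>x\<bar> powr 1 \<le> \<bar>x\<bar> powr r" using assms by (intro powr_mono) auto
  then have "\<bar>x\<bar>\<^sup>2 \<le> (\<bar>x\<bar> powr r)\<^sup>2" using False by (intro power_mono) auto
  then show ?thesis by simp
qed

section \<open>Lipschitz and sup bounds for transforms of integrable functions\<close>

lemma norm_iexp_diff_le: "norm (exp (\<i> * complex_of_real a) - exp (\<i> * complex_of_real b)) \<le> \<bar>a - b\<bar>"
proof -
  have "exp (\<i> * complex_of_real a) - exp (\<i> * complex_of_real b) =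
      exp (\<i> * complex_of_real b) * (exp (\<i> * complex_of_real (a - b)) - 1)"
    by (simp add: right_diff_distrib exp_diff)
  then have "norm (exp (\<i> * complex_of_real a) - exp (\<i> * complex_of_real b)) = 2 * \<bar>sin ((a - b) / 2)\<bar>"
    by (simp only: norm_mult norm_exp_i_times dist_exp_i_1)
  also have "\<dots> \<le> 2 * \<bar>(a - b) / 2\<bar>" by (intro mult_left_mono abs_sin_x_le_abs_x) simp
  finally show ?thesis by simp
qed

lemma cfourier_lipschitz:
  assumes f: "integrable lborel f" and xf: "integrable lborel (\<lambda>x. \<bar>x\<bar> * norm (f x))"
  shows "norm (cfourier f \<xi> - cfourier f \<eta>) \<le> \<bar>\<xi> - \<eta>\<bar> * (\<integral>x. \<bar>x\<bar> * norm (f x) \<partial>lborel)"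
proof -
  note i = integrable_exp_mult[OF f]
  have "norm (cfourier f \<xi> - cfourier f \<eta>)
     = norm (\<integral>x. exp (- (\<i> * complex_of_real (x * \<xi>))) * f x - exp (- (\<i> * complex_of_real (x * \<eta>))) * f x \<partial>lborel)"
    unfolding cfourier_def using i[of \<xi>] i[of \<eta>] by (simp del: of_real_mult)
  also have "\<dots> \<le> (\<integral>x. norm (exp (- (\<i> * complex_of_real (x * \<xi>))) * f x - exp (- (\<i> * complex_of_real (x * \<eta>))) * f x) \<partial>lborel)"
    by (rule integral_norm_bound)
  also have "\<dots> \<le> (\<integral>x. \<bar>\<xi> - \<eta>\<bar> * (\<bar>x\<bar> * norm (f x)) \<partial>lborel)"
  proof (rule integral_mono)
    show "integrable lborel (\<lambda>x. norm (exp (- (\<i> * complex_of_real (x * \<xi>))) * f x - exp (- (\<i> * complex_of_real (x * \<eta>))) * f x))"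
      using i[of \<xi>] i[of \<eta>] by (intro integrable_norm Bochner_Integration.integrable_diff)
    show "integrable lborel (\<lambda>x. \<bar>\<xi> - \<eta>\<bar> * (\<bar>x\<bar> * norm (f x)))" using xf by simp
    fix x
    have "norm (exp (\<i> * complex_of_real (- (x * \<xi>))) - exp (\<i> * complex_of_real (- (x * \<eta>)))) \<le> \<bar>- (x * \<xi>) - - (x * \<eta>)\<bar>"
      by (rule norm_iexp_diff_le)
    also have "\<dots> = \<bar>\<xi> - \<eta>\<bar> * \<bar>x\<bar>" by (simp add: abs_mult[symmetric] algebra_simps abs_minus_commute)
    finally show "norm (exp (- (\<i> * complex_of_real (x * \<xi>))) * f x - exp (- (\<i> * complex_of_real (x * \<eta>))) * f x) \<le> \<bar>\<xi> - \<eta>\<bar> * (\<bar>x\<bar> * norm (f x))"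
      by (simp add: left_diff_distrib[symmetric] norm_mult mult_right_mono mult.assoc[symmetric])
  qed
  finally show ?thesis by simp
qed

lemma fourier_lipschitz:
  assumes f: "integrable lborel f" and xf: "integrable lborel (\<lambda>x. \<bar>x\<bar> * \<bar>f x\<bar>)"
  shows "norm (fourier f \<xi> - fourier f \<eta>) \<le> \<bar>\<xi> - \<eta>\<bar> * (\<integral>x. \<bar>x\<bar> * \<bar>f x\<bar> \<partial>lborel)"
  using cfourier_lipschitz[of "\<lambda>x. complex_of_real (f x)" \<xi> \<eta>] f xf by (simp add: fourier_eq_cfourier)

lemma norm_fourier_le: "norm (fourier f \<xi>) \<le> (\<integral>x. \<bar>f x\<bar> \<partial>lborel)"
  using norm_cfourier_le[of "\<lambda>x. complex_of_real (f x)" \<xi>] by (simp add: fourier_eq_cfourier)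

lemma fourier_diff:
  "integrable lborel f \<Longrightarrow> integrable lborel g \<Longrightarrow> fourier (\<lambda>x. f x - g x) \<xi> = fourier f \<xi> - fourier g \<xi>"
  by (simp add: fourier_eq_cfourier cfourier_diff[symmetric])

lemma continuous_fourier: "integrable lborel f \<Longrightarrow> continuous_on UNIV (fourier f)"
  by (simp add: fourier_eq_cfourier continuous_cfourier)

lemma fourier_measurable: "integrable lborel f \<Longrightarrow> fourier f \<in> borel_measurable borel"
  by (intro borel_measurable_continuous_onI continuous_fourier)

lemma fourier_uminus: "fourier f (- \<xi>) = cnj (fourier f \<xi>)"
  using cfourier_cnj[of "\<lambda>x. complex_of_real (f x)" \<xi>] by (simp add: fourier_eq_cfourier)

section \<open>Bounds for a single element of the solution space, its transform and its
  square\<close>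

context
  fixes s r :: real and u :: "real \<Rightarrow> real"
  assumes s: "s > 1" and r: "r \<ge> 1" and u: "u \<in> Zspace s r"
begin

lemma L2norm_le_Sobolev_norm: "sqrt (2 * pi) * L2norm u \<le> Sobolev_norm s u"
proof -
  have "sqrt (2 * pi) * L2norm u = L2norm (fourier_L2 u)"
    by (simp add: L2norm_fourier_L2[OF ZspaceD(1)[OF u]])
  also have "\<dots> \<le> Sobolev_norm s u"
    unfolding Sobolev_norm_def
  proof (rule L2norm_mono[OF fourier_L2_measurable[OF ZspaceD(1)[OF u]] ZspaceD(3)[OF u]])
    fix \<xi> :: real
    have "1 \<le> sqrt (1 + \<xi>\<^sup>2)" by simp
    then have "1 \<le> (1 + \<xi>\<^sup>2) powr (s/2)" using sqrt_le_sobolev_weight[of s \<xi>] s by linarith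
    from mult_right_mono[OF this norm_ge_zero]
    show "norm (fourier_L2 u \<xi>) \<le> norm (complex_of_real ((1 + \<xi>\<^sup>2) powr (s/2)) * fourier_L2 u \<xi>)"
      unfolding norm_sobolev_weight by simp
  qed
  finally show ?thesis .
qed

lemma L2norm_le_Znorm: "L2norm u \<le> Znorm s r u"
proof -
  have "1 \<le> sqrt (2 * pi)" using pi_gt3 by simp
  from mult_right_mono[OF this L2norm_nonneg[of u]] show ?thesis
    using L2norm_le_Sobolev_norm Sobolev_norm_le_Znorm[of s u r] by simp
qed

lemma
  shows integrable_Zspace_weight: "integrable lborel (\<lambda>x. (1 + x\<^sup>2) * (norm (u x))\<^sup>2)"
    and Zspace_weight_le: "(\<integral>x. (1 + x\<^sup>2) * (norm (u x))\<^sup>2 \<partial>lborel) \<le> (Znorm s r u)\<^sup>2"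
proof -
  note Z = ZspaceD[OF u]
  note [measurable] = Z(2)
  let ?b = "\<lambda>x. 2 * (norm (u x))\<^sup>2 + (norm (\<bar>x\<bar> powr r * u x))\<^sup>2"
  have b: "integrable lborel ?b"
    using integrable_square_integrable[OF Z(1)] integrable_square_integrable[OF Z(4)] by simp
  have le: "(1 + x\<^sup>2) * (norm (u x))\<^sup>2 \<le> ?b x" for x
  proof -
    have "(1 + x\<^sup>2) * (norm (u x))\<^sup>2 \<le> (2 + (\<bar>x\<bar> powr r)\<^sup>2) * (norm (u x))\<^sup>2"
      using square_le_one_plus_powr[OF r, of x] by (intro mult_right_mono) auto
    then show ?thesis by (simp add: norm_mult power_mult_distrib distrib_right)
  qed
  show i: "integrable lborel (\<lambda>x. (1 + x\<^sup>2) * (norm (u x))\<^sup>2)"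
  proof (rule Bochner_Integration.integrable_bound[OF b])
    show "AE x in lborel. norm ((1 + x\<^sup>2) * (norm (u x))\<^sup>2) \<le> norm (?b x)"
      using le by (intro AE_I2) (simp add: order_trans[OF _ abs_ge_self])
  qed measurable
  have "(\<integral>x. (1 + x\<^sup>2) * (norm (u x))\<^sup>2 \<partial>lborel) \<le> (\<integral>x. ?b x \<partial>lborel)"
    by (rule integral_mono[OF i b le])
  also have "\<dots> = 2 * (L2norm u)\<^sup>2 + (L2norm (\<lambda>x. \<bar>x\<bar> powr r * u x))\<^sup>2"
    using integrable_square_integrable[OF Z(1)] integrable_square_integrable[OF Z(4)]
    unfolding L2norm_square by simp
  \<comment> \<open>The transform is unnormalised, so Plancherel contributes a factor 2 pi > 2. It
    absorbs the two copies of the L2 norm and leaves the final bound free of a constant.\<close>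
  also have "2 * (L2norm u)\<^sup>2 \<le> (Sobolev_norm s u)\<^sup>2"
  proof -
    have "(sqrt (2 * pi) * L2norm u)\<^sup>2 \<le> (Sobolev_norm s u)\<^sup>2"
      by (intro power_mono L2norm_le_Sobolev_norm) simp
    then have "2 * pi * (L2norm u)\<^sup>2 \<le> (Sobolev_norm s u)\<^sup>2" by (simp add: power_mult_distrib)
    moreover have "2 * 1 * (L2norm u)\<^sup>2 \<le> 2 * pi * (L2norm u)\<^sup>2"
      using pi_gt3 by (intro mult_right_mono mult_left_mono) auto
    ultimately show ?thesis by simp
  qed
  finally show "(\<integral>x. (1 + x\<^sup>2) * (norm (u x))\<^sup>2 \<partial>lborel) \<le> (Znorm s r u)\<^sup>2"
    by (simp add: Znorm_square)
qed

lemma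
  shows integrable_Zspace: "integrable lborel u"
    and L1norm_le_Znorm: "(\<integral>x. \<bar>u x\<bar> \<partial>lborel) \<le> sqrt pi * Znorm s r u"
proof -
  note W = square_integrable_weight[OF ZspaceD(2)[OF u] integrable_Zspace_weight]
  show "integrable lborel u" by (rule W(1))
  have "(\<integral>x. \<bar>u x\<bar> \<partial>lborel) \<le> sqrt pi * sqrt (\<integral>x. (1 + x\<^sup>2) * (norm (u x))\<^sup>2 \<partial>lborel)"
    using W(2) by simp
  also have "\<dots> \<le> sqrt pi * sqrt ((Znorm s r u)\<^sup>2)"
    by (intro mult_left_mono real_sqrt_le_mono Zspace_weight_le) simp
  finally show "(\<integral>x. \<bar>u x\<bar> \<partial>lborel) \<le> sqrt pi * Znorm s r u" by simp
qed

lemma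
  shows integrable_abs_square: "integrable lborel (\<lambda>x. \<bar>x\<bar> * \<bar>(u x)\<^sup>2\<bar>)"
    and integral_abs_square_le: "(\<integral>x. \<bar>x\<bar> * \<bar>(u x)\<^sup>2\<bar> \<partial>lborel) \<le> (Znorm s r u)\<^sup>2"
proof -
  note [measurable] = ZspaceD(2)[OF u]
  have le: "\<bar>x\<bar> * \<bar>(u x)\<^sup>2\<bar> \<le> (1 + x\<^sup>2) * (norm (u x))\<^sup>2" for x
  proof -
    have "0 \<le> (1 - \<bar>x\<bar>)\<^sup>2" by simp
    then have "2 * \<bar>x\<bar> \<le> 1 + x\<^sup>2" by (simp add: power2_diff)
    then have "\<bar>x\<bar> \<le> 1 + x\<^sup>2" by linarith
    from mult_right_mono[OF this zero_le_power2[of "u x"]] show ?thesis by simp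
  qed
  show i: "integrable lborel (\<lambda>x. \<bar>x\<bar> * \<bar>(u x)\<^sup>2\<bar>)"
  proof (rule Bochner_Integration.integrable_bound[OF integrable_Zspace_weight])
    show "AE x in lborel. norm (\<bar>x\<bar> * \<bar>(u x)\<^sup>2\<bar>) \<le> norm ((1 + x\<^sup>2) * (norm (u x))\<^sup>2)"
      using le by (intro AE_I2) (simp add: abs_mult)
  qed measurable
  show "(\<integral>x. \<bar>x\<bar> * \<bar>(u x)\<^sup>2\<bar> \<partial>lborel) \<le> (Znorm s r u)\<^sup>2"
    using integral_mono[OF i integrable_Zspace_weight le] Zspace_weight_le by linarith
qed

lemma integrable_square: "integrable lborel (\<lambda>x. (u x)\<^sup>2)"
  using integrable_square_integrable[OF ZspaceD(1)[OF u]] by simp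

lemma fourier_L2_Zspace: "AE \<xi> in lborel. fourier_L2 u \<xi> = fourier u \<xi>"
  by (rule fourier_L2_eq_fourier[OF ZspaceD(1)[OF u] integrable_Zspace])

lemma
  shows integrable_fourier_weight: "integrable lborel (\<lambda>\<xi>. (1 + \<xi>\<^sup>2) * (norm (fourier u \<xi>))\<^sup>2)"
    and fourier_weight_le: "(\<integral>\<xi>. (1 + \<xi>\<^sup>2) * (norm (fourier u \<xi>))\<^sup>2 \<partial>lborel) \<le> (Znorm s r u)\<^sup>2"
proof -
  note [measurable] = fourier_measurable[OF integrable_Zspace]
  let ?b = "\<lambda>\<xi>. (norm (complex_of_real ((1 + \<xi>\<^sup>2) powr (s/2)) * fourier_L2 u \<xi>))\<^sup>2"
  have b: "integrable lborel ?b" by (rule integrable_square_integrable[OF ZspaceD(3)[OF u]])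
  have le: "AE \<xi> in lborel. (1 + \<xi>\<^sup>2) * (norm (fourier u \<xi>))\<^sup>2 \<le> ?b \<xi>"
    using fourier_L2_Zspace
  proof eventually_elim
    case (elim \<xi>)
    have "(sqrt (1 + \<xi>\<^sup>2))\<^sup>2 \<le> ((1 + \<xi>\<^sup>2) powr (s/2))\<^sup>2"
      using sqrt_le_sobolev_weight[of s \<xi>] s by (intro power_mono) auto
    from mult_right_mono[OF this zero_le_power2[of "norm (fourier u \<xi>)"]]
    show ?case by (simp add: norm_sobolev_weight elim power_mult_distrib del: norm_mult)
  qed
  show i: "integrable lborel (\<lambda>\<xi>. (1 + \<xi>\<^sup>2) * (norm (fourier u \<xi>))\<^sup>2)"
    by (rule Bochner_Integration.integrable_bound[OF b]) (use le in \<open>auto elim!: eventually_mono\<close>)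
  have "(\<integral>\<xi>. (1 + \<xi>\<^sup>2) * (norm (fourier u \<xi>))\<^sup>2 \<partial>lborel) \<le> (Sobolev_norm s u)\<^sup>2"
    unfolding Sobolev_norm_def L2norm_square by (rule integral_mono_AE[OF i b le])
  also have "\<dots> \<le> (Znorm s r u)\<^sup>2" by (simp add: Znorm_square)
  finally show "(\<integral>\<xi>. (1 + \<xi>\<^sup>2) * (norm (fourier u \<xi>))\<^sup>2 \<partial>lborel) \<le> (Znorm s r u)\<^sup>2" .
qed

lemma
  shows integrable_fourier: "integrable lborel (fourier u)"
    and L1norm_fourier_le: "(\<integral>\<xi>. norm (fourier u \<xi>) \<partial>lborel) \<le> sqrt pi * Znorm s r u"
proof -
  note W = square_integrable_weight[OF fourier_measurable[OF integrable_Zspace] integrable_fourier_weight]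
  show "integrable lborel (fourier u)" by (rule W(1))
  have "(\<integral>\<xi>. norm (fourier u \<xi>) \<partial>lborel) \<le> sqrt pi * sqrt ((Znorm s r u)\<^sup>2)"
    by (rule order_trans[OF W(2)], intro mult_left_mono real_sqrt_le_mono fourier_weight_le) simp
  then show "(\<integral>\<xi>. norm (fourier u \<xi>) \<partial>lborel) \<le> sqrt pi * Znorm s r u" by simp
qed

lemma square_integrable_fourier: "square_integrable (fourier u)"
proof (rule square_integrable_dominated[OF fourier_measurable[OF integrable_Zspace] integrable_fourier_weight])
  show "(norm (fourier u \<xi>))\<^sup>2 \<le> (1 + \<xi>\<^sup>2) * (norm (fourier u \<xi>))\<^sup>2" for \<xi>
    using mult_right_mono[of 1 "1 + \<xi>\<^sup>2" "(norm (fourier u \<xi>))\<^sup>2"] by simp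
qed

lemma
  shows square_integrable_xi_fourier: "square_integrable (\<lambda>\<xi>. complex_of_real \<xi> * fourier u \<xi>)"
    and L2norm_xi_fourier_le: "L2norm (\<lambda>\<xi>. complex_of_real \<xi> * fourier u \<xi>) \<le> Znorm s r u"
proof -
  note [measurable] = fourier_measurable[OF integrable_Zspace]
  have le: "(norm (complex_of_real \<xi> * fourier u \<xi>))\<^sup>2 \<le> (1 + \<xi>\<^sup>2) * (norm (fourier u \<xi>))\<^sup>2" for \<xi>
    by (simp add: norm_mult power_mult_distrib mult_right_mono)
  show sq: "square_integrable (\<lambda>\<xi>. complex_of_real \<xi> * fourier u \<xi>)"
    by (rule square_integrable_dominated[OF _ integrable_fourier_weight le]) measurable
  have "(L2norm (\<lambda>\<xi>. complex_of_real \<xi> * fourier u \<xi>))\<^sup>2 \<le> (Znorm s r u)\<^sup>2"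
    unfolding L2norm_square
    using integral_mono[OF integrable_square_integrable[OF sq] integrable_fourier_weight le] fourier_weight_le by linarith
  then show "L2norm (\<lambda>\<xi>. complex_of_real \<xi> * fourier u \<xi>) \<le> Znorm s r u"
    by (rule power2_le_imp_le) simp
qed

text \<open>Sobolev embedding through inversion: u coincides almost everywhere with the transform of
  an integrable function, up to a reflection and the factor 2 pi.\<close>

lemma bounded_Zspace: "AE x in lborel. \<bar>u x\<bar> \<le> Znorm s r u"
proof -
  note sq = ZspaceD(1)[OF u] and [measurable] = ZspaceD(2)[OF u]
  have "cfourier_L2 (fourier_L2 u) = cfourier_L2 (fourier u)"
    by (intro cfourier_L2_cong_AE fourier_L2_Zspace fourier_L2_measurable[OF sq] fourier_measurable integrable_Zspace)
  moreover have "AE x in lborel. cfourier_L2 (fourier_L2 u) x = complex_of_real (2 * pi) * complex_of_real (u (- x))"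
    using cfourier_L2_inversion[of "\<lambda>x. complex_of_real (u x)"] sq
    by (simp add: fourier_L2_eq_cfourier_L2 square_integrable_of_real)
  ultimately have "AE x in lborel. cfourier_L2 (fourier u) x = complex_of_real (2 * pi) * complex_of_real (u (- x))"
    by simp
  with cfourier_L2_eq_cfourier[OF square_integrable_fourier integrable_fourier]
  have "AE x in lborel. \<bar>u (- x)\<bar> \<le> Znorm s r u"
  proof eventually_elim
    case (elim x)
    then have "cfourier (fourier u) x = complex_of_real (2 * pi * u (- x))" by simp
    then have "2 * pi * \<bar>u (- x)\<bar> = norm (cfourier (fourier u) x)"
      by (simp only: norm_of_real) (simp add: abs_mult)
    also have "\<dots> \<le> sqrt pi * Znorm s r u"
      using norm_cfourier_le L1norm_fourier_le by (rule order_trans)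
    also have "\<dots> \<le> 2 * pi * Znorm s r u"
    proof (rule mult_right_mono)
      have "sqrt pi \<le> sqrt (pi * pi)" using pi_gt3 by (intro real_sqrt_le_mono) simp
      then have "sqrt pi \<le> pi" by simp
      then show "sqrt pi \<le> 2 * pi" using pi_gt3 by linarith
    qed simp
    finally show ?case by simp
  qed
  from AE_lborel_reflect[OF this] show ?thesis by simp
qed

lemma
  shows square_integrable_square: "square_integrable (\<lambda>x. (u x)\<^sup>2)"
    and L2norm_square_le: "L2norm (\<lambda>x. (u x)\<^sup>2) \<le> (Znorm s r u)\<^sup>2"
proof -
  note [measurable] = ZspaceD(2)[OF u]
  let ?b = "\<lambda>x. (Znorm s r u)\<^sup>2 * (norm (u x))\<^sup>2"
  have b: "integrable lborel ?b"
    using integrable_square_integrable[OF ZspaceD(1)[OF u]] by simp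
  have le: "AE x in lborel. (norm ((u x)\<^sup>2))\<^sup>2 \<le> ?b x"
    using bounded_Zspace
  proof eventually_elim
    case (elim x)
    then have "\<bar>u x\<bar>\<^sup>2 \<le> (Znorm s r u)\<^sup>2" by (intro power_mono) auto
    from mult_right_mono[OF this zero_le_power2[of "u x"]] show ?case by (simp add: power2_eq_square)
  qed
  have i: "integrable lborel (\<lambda>x. (norm ((u x)\<^sup>2))\<^sup>2)"
    by (rule Bochner_Integration.integrable_bound[OF b]) (use le in \<open>auto elim!: eventually_mono\<close>)
  then show "square_integrable (\<lambda>x. (u x)\<^sup>2)" by (simp add: square_integrable_def)
  have "(L2norm (\<lambda>x. (u x)\<^sup>2))\<^sup>2 \<le> (\<integral>x. ?b x \<partial>lborel)"
    unfolding L2norm_square by (rule integral_mono_AE[OF i b le])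
  also have "\<dots> = (Znorm s r u)\<^sup>2 * (L2norm u)\<^sup>2" unfolding L2norm_square by simp
  also have "\<dots> \<le> (Znorm s r u)\<^sup>2 * (Znorm s r u)\<^sup>2"
    by (intro mult_left_mono power_mono L2norm_le_Znorm) auto
  also have "\<dots> = ((Znorm s r u)\<^sup>2)\<^sup>2" by (simp add: power2_eq_square)
  finally show "L2norm (\<lambda>x. (u x)\<^sup>2) \<le> (Znorm s r u)\<^sup>2" by (rule power2_le_imp_le) simp
qed

text \<open>Parseval for u and the modulated function exp(-i x \<xi>) u, whose transform at -\<eta>
  is that of u at \<xi> - \<eta>. As \<xi> is fixed throughout, the formula holds at every
  frequency.\<close>

lemma fourier_square_convolution:
  "fourier (\<lambda>x. (u x)\<^sup>2) \<xi> = 1 / (2 * pi) * (\<integral>\<eta>. fourier u \<eta> * fourier u (\<xi> - \<eta>) \<partial>lborel)"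
proof -
  note sq = ZspaceD(1)[OF u] and [measurable] = ZspaceD(2)[OF u]
  let ?e = "\<lambda>x. exp (- (\<i> * complex_of_real (x * \<xi>)))"
  let ?u = "\<lambda>x. complex_of_real (u x)"
  define g where "g x = ?e x * ?u x" for x
  have cu: "square_integrable ?u" "integrable lborel ?u"
    using sq integrable_Zspace by (auto simp: square_integrable_of_real)
  have g: "square_integrable g" "integrable lborel g"
  proof -
    show "square_integrable g"
      unfolding g_def[abs_def]
      by (rule square_integrable_bounded_mult[OF cu(1), of _ 1]) (simp_all del: of_real_mult)
    show "integrable lborel g"
      unfolding g_def[abs_def] by (rule integrable_exp_mult[OF cu(2)])
  qed
  have cg: "cfourier g (- \<eta>) = fourier u (\<xi> - \<eta>)" for \<eta>
  proof -
    have "exp (- (\<i> * complex_of_real (x * - \<eta>))) * ?e x = exp (- (\<i> * complex_of_real (x * (\<xi> - \<eta>))))" for x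
      unfolding exp_add[symmetric] by (rule arg_cong[of _ _ exp]) (simp add: algebra_simps)
    then show ?thesis
      unfolding cfourier_def fourier_def g_def by (simp only: mult.assoc[symmetric])
  qed
  note m = fourier_measurable[OF integrable_Zspace] fourier_L2_measurable[OF sq]
    borel_measurable_square_integrable[OF square_integrable_reflect[OF square_integrable_cfourier_L2[OF g(1)]]]
    borel_measurable_square_integrable[OF square_integrable_cfourier_L2[OF g(1)]]
  note [measurable] = m borel_measurable_cfourier[OF g(2)]
  have ae: "AE \<eta> in lborel. cfourier_L2 g (- \<eta>) = cfourier g (- \<eta>)"
    by (rule AE_lborel_reflect[OF cfourier_L2_eq_cfourier[OF g]]) measurable
  have "2 * pi * fourier (\<lambda>x. (u x)\<^sup>2) \<xi> = 2 * pi * (\<integral>x. ?u x * g x \<partial>lborel)"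
    by (simp add: fourier_def g_def power2_eq_square mult_ac)
  also have "\<dots> = (\<integral>\<eta>. cfourier_L2 ?u \<eta> * cfourier_L2 g (- \<eta>) \<partial>lborel)"
    by (rule cfourier_L2_Parseval[OF cu(1) g(1), symmetric])
  also have "\<dots> = (\<integral>\<eta>. fourier u \<eta> * fourier u (\<xi> - \<eta>) \<partial>lborel)"
    unfolding fourier_L2_eq_cfourier_L2[symmetric]
    using fourier_L2_Zspace ae by (intro integral_cong_AE) (auto simp: cg)
  finally show ?thesis by (simp add: field_simps)
qed

lemma fourier_L2_square: "AE \<xi> in lborel. fourier_L2 (\<lambda>x. (u x)\<^sup>2) \<xi> = fourier (\<lambda>x. (u x)\<^sup>2) \<xi>"
  by (rule fourier_L2_eq_fourier[OF square_integrable_square integrable_square])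

text \<open>Splitting |\<xi>| \<le> |\<eta>| + |\<xi> - \<eta>| puts the derivative on one factor:
  \<xi> U lies in L2, U in L1, and Young's inequality applies. Estimating 1/(2 pi) by 1/2 makes the
  two equal halves add up to exactly one convolution. The lemma puts u^2 into the domain on which
  \<open>opA\<close> is meaningful.\<close>

lemma square_integrable_xi_fourier_square:
  "square_integrable (\<lambda>\<xi>. complex_of_real \<xi> * fourier (\<lambda>x. (u x)\<^sup>2) \<xi>)"
proof (rule square_integrable_convolution[OF square_integrable_xi_fourier integrable_fourier])
  note [measurable] = fourier_measurable[OF integrable_square] fourier_measurable[OF integrable_Zspace]
  show "(\<lambda>\<xi>. complex_of_real \<xi> * fourier (\<lambda>x. (u x)\<^sup>2) \<xi>) \<in> borel_measurable borel" by measurable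
  let ?U = "\<lambda>\<eta>. norm (fourier u \<eta>)"
  fix \<xi>
  have a: "square_integrable (\<lambda>\<eta>. fourier u (\<xi> - \<eta>))"
    using lborel_integrable_real_affine[OF integrable_square_integrable[OF square_integrable_fourier], of "-1" \<xi>]
    by (simp add: square_integrable_def)
  have "ennreal (norm (complex_of_real \<xi> * fourier (\<lambda>x. (u x)\<^sup>2) \<xi>)) =
     ennreal (\<bar>\<xi>\<bar> / (2 * pi)) * ennreal (norm (\<integral>\<eta>. fourier u \<eta> * fourier u (\<xi> - \<eta>) \<partial>lborel))"
    by (simp add: fourier_square_convolution norm_mult norm_divide ennreal_mult[symmetric])
  also have "\<dots> \<le> ennreal (\<bar>\<xi>\<bar> / (2 * pi)) * (\<integral>\<^sup>+\<eta>. ennreal (norm (fourier u \<eta> * fourier u (\<xi> - \<eta>))) \<partial>lborel)"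
    by (intro mult_left_mono integral_norm_bound_ennreal square_integrable_mult[OF square_integrable_fourier a]) simp
  also have "\<dots> = (\<integral>\<^sup>+\<eta>. ennreal (1 / (2 * pi)) * ennreal (\<bar>\<xi>\<bar> * (?U \<eta> * ?U (\<xi> - \<eta>))) \<partial>lborel)"
    by (subst nn_integral_cmult[symmetric]) (auto simp: norm_mult ennreal_mult[symmetric] mult_ac)
  also have "\<dots> \<le> (\<integral>\<^sup>+\<eta>. ennreal (1 / 2) * (ennreal (\<bar>\<eta>\<bar> * ?U \<eta> * ?U (\<xi> - \<eta>)) + ennreal (\<bar>\<xi> - \<eta>\<bar> * ?U (\<xi> - \<eta>) * ?U \<eta>)) \<partial>lborel)"
  proof (intro nn_integral_mono mult_mono ennreal_leI)
    fix \<eta>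
    show "1 / (2 * pi) \<le> 1 / 2" using pi_gt3 by (simp add: field_simps)
    have "\<bar>\<xi>\<bar> * (?U \<eta> * ?U (\<xi> - \<eta>)) \<le> (\<bar>\<eta>\<bar> + \<bar>\<xi> - \<eta>\<bar>) * (?U \<eta> * ?U (\<xi> - \<eta>))"
      by (intro mult_right_mono) auto
    then show "ennreal (\<bar>\<xi>\<bar> * (?U \<eta> * ?U (\<xi> - \<eta>))) \<le> ennreal (\<bar>\<eta>\<bar> * ?U \<eta> * ?U (\<xi> - \<eta>)) + ennreal (\<bar>\<xi> - \<eta>\<bar> * ?U (\<xi> - \<eta>) * ?U \<eta>)"
      by (subst ennreal_plus[symmetric]) (auto simp: distrib_left mult_ac simp del: ennreal_plus intro!: ennreal_leI)
  qed auto
  also have "\<dots> = ennreal (1 / 2) * ((\<integral>\<^sup>+\<eta>. ennreal (\<bar>\<eta>\<bar> * ?U \<eta> * ?U (\<xi> - \<eta>)) \<partial>lborel) +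
      (\<integral>\<^sup>+\<eta>. ennreal (\<bar>\<xi> - \<eta>\<bar> * ?U (\<xi> - \<eta>) * ?U \<eta>) \<partial>lborel))"
    by (subst nn_integral_cmult, measurable, subst nn_integral_add) auto
  also have "(\<integral>\<^sup>+\<eta>. ennreal (\<bar>\<xi> - \<eta>\<bar> * ?U (\<xi> - \<eta>) * ?U \<eta>) \<partial>lborel) = (\<integral>\<^sup>+\<eta>. ennreal (\<bar>\<eta>\<bar> * ?U \<eta> * ?U (\<xi> - \<eta>)) \<partial>lborel)"
    using nn_integral_real_affine[of "\<lambda>\<eta>. ennreal (\<bar>\<eta>\<bar> * ?U \<eta> * ?U (\<xi> - \<eta>))" "-1" \<xi>] by simp
  also have "ennreal (1 / 2) * (A + A) = A" for A :: ennreal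
  proof -
    have "ennreal (1 / 2) * (A + A) = (ennreal (1 / 2) + ennreal (1 / 2)) * A" by (simp only: distrib_left distrib_right)
    also have "ennreal (1 / 2) + ennreal (1 / 2) = 1" by (subst ennreal_plus[symmetric]) auto
    finally show ?thesis by simp
  qed
  finally show "ennreal (norm (complex_of_real \<xi> * fourier (\<lambda>x. (u x)\<^sup>2) \<xi>)) \<le>
      (\<integral>\<^sup>+\<eta>. ennreal (norm (complex_of_real \<eta> * fourier u \<eta>) * norm (fourier u (\<xi> - \<eta>))) \<partial>lborel)"
    by (simp add: norm_mult)
qed

end

section \<open>Duhamel's formula on the Fourier side\<close>

text \<open>A nonempty open set is not negligible. This is the passage from almost every frequency
  to every frequency, the origin included.\<close>

lemma continuous_AE_eq:
  fixes f g :: "real \<Rightarrow> 'a::t2_space"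
  assumes f: "continuous_on UNIV f" and g: "continuous_on UNIV g" and ae: "AE x in lborel. f x = g x"
  shows "f x = g x"
proof -
  have op: "open {x. f x \<noteq> g x}"
    using open_Collect_neq[OF f g] .
  from ae obtain K where K: "K \<in> null_sets lborel" "{x. f x \<noteq> g x} \<subseteq> K"
    by (auto simp: eventually_ae_filter)
  have "negligible {x. f x \<noteq> g x}"
    using K null_sets_completionI[OF K(1)] by (meson negligible_iff_null_sets negligible_subset)
  then have "{x. f x \<noteq> g x} = {}" using open_not_negligible[OF op] by blast
  then show ?thesis by blast
qed

text \<open>A modulus of continuity in time that is uniform in \<xi>, together with continuity in
  \<xi> at each fixed time, gives joint continuity.\<close>

lemma continuous_on_strip:
  fixes f :: "real \<Rightarrow> real \<Rightarrow> complex"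
  assumes c: "\<And>t. t \<in> J \<Longrightarrow> continuous_on UNIV (f t)"
    and le: "\<And>t0 t \<xi>. t \<in> J \<Longrightarrow> t0 \<in> J \<Longrightarrow> norm (f t \<xi> - f t0 \<xi>) \<le> d t0 t"
    and lim: "\<And>t0. t0 \<in> J \<Longrightarrow> (d t0 \<longlongrightarrow> 0) (at t0 within J)"
  shows "continuous_on (J \<times> UNIV) (\<lambda>p. f (fst p) (snd p))"
  unfolding continuous_on_iff
proof (intro ballI allI impI)
  fix p :: "real \<times> real" and e :: real
  assume "p \<in> J \<times> UNIV" and e: "e > 0"
  then obtain t0 \<xi>0 where p: "p = (t0, \<xi>0)" and t0: "t0 \<in> J" by auto
  have "\<forall>\<^sub>F t in at t0 within J. d t0 t < e / 2"
    using order_tendstoD(2)[OF lim[OF t0], of "e / 2"] e by simp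
  then obtain d1 where d1: "d1 > 0" "\<And>t. t \<in> J \<Longrightarrow> t \<noteq> t0 \<Longrightarrow> dist t t0 < d1 \<Longrightarrow> d t0 t < e / 2"
    unfolding eventually_at by auto
  obtain d2 where d2: "d2 > 0" "\<And>\<xi>. dist \<xi> \<xi>0 < d2 \<Longrightarrow> dist (f t0 \<xi>) (f t0 \<xi>0) < e / 2"
    using c[OF t0] e unfolding continuous_on_iff by (meson UNIV_I half_gt_zero)
  show "\<exists>\<delta>>0. \<forall>q\<in>J \<times> UNIV. dist q p < \<delta> \<longrightarrow> dist (f (fst q) (snd q)) (f (fst p) (snd p)) < e"
  proof (intro exI[of _ "min d1 d2"] conjI ballI impI)
    fix q :: "real \<times> real" assume q: "q \<in> J \<times> UNIV" and dq: "dist q p < min d1 d2"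
    have t: "fst q \<in> J" using q by auto
    have dt: "dist (fst q) t0 < d1" and dx: "dist (snd q) \<xi>0 < d2"
      using dist_fst_le[of q p] dist_snd_le[of q p] dq by (auto simp: p)
    have "norm (f (fst q) (snd q) - f t0 (snd q)) < e / 2"
    proof (cases "fst q = t0")
      case False
      then show ?thesis using d1(2)[OF t False dt] le[OF t t0, of "snd q"] by linarith
    qed (use e in simp)
    then show "dist (f (fst q) (snd q)) (f (fst p) (snd p)) < e"
      using d2(2)[OF dx] dist_triangle[of "f (fst q) (snd q)" "f t0 \<xi>0" "f t0 (snd q)"]
      by (simp add: p dist_norm)
  qed (use d1 d2 in auto)
qed

lemma strip_Fubini:
  fixes E :: "real \<Rightarrow> real \<Rightarrow> complex"
  assumes M: "(\<lambda>p. indicator {a..b} (fst p) *\<^sub>R E (fst p) (snd p)) \<in> borel_measurable (lborel \<Otimes>\<^sub>M lborel)"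
    and int: "\<And>\<tau>. \<tau> \<in> {a..b} \<Longrightarrow> integrable lborel (E \<tau>)"
    and bound: "\<And>\<tau>. \<tau> \<in> {a..b} \<Longrightarrow> (\<integral>\<xi>. norm (E \<tau> \<xi>) \<partial>lborel) \<le> C"
  shows "(LINT \<tau>:{a..b}|lborel. (\<integral>\<xi>. E \<tau> \<xi> \<partial>lborel)) = (\<integral>\<xi>. (LINT \<tau>:{a..b}|lborel. E \<tau> \<xi>) \<partial>lborel)"
    and "integrable lborel (\<lambda>\<xi>. LINT \<tau>:{a..b}|lborel. E \<tau> \<xi>)"
proof -
  let ?E = "\<lambda>\<tau> \<xi>. indicator {a..b} \<tau> *\<^sub>R E \<tau> \<xi>"
  have M': "(\<lambda>(\<tau>, \<xi>). ?E \<tau> \<xi>) \<in> borel_measurable (lborel \<Otimes>\<^sub>M lborel)"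
    using M by (simp add: case_prod_beta')
  have i: "integrable (lborel \<Otimes>\<^sub>M lborel) (\<lambda>(\<tau>, \<xi>). ?E \<tau> \<xi>)"
  proof (rule lborel_pair.Fubini_integrable[OF M'])
    show "AE \<tau> in lborel. integrable lborel (\<lambda>\<xi>. case (\<tau>, \<xi>) of (\<tau>, \<xi>) \<Rightarrow> ?E \<tau> \<xi>)"
      using int by (intro AE_I2) (auto simp: indicator_def)
    note [measurable] = M'
    have m: "(\<lambda>\<tau>. \<integral>\<xi>. norm (?E \<tau> \<xi>) \<partial>lborel) \<in> borel_measurable lborel"
      by (rule lborel.borel_measurable_lebesgue_integral) (use measurable_compose[OF M borel_measurable_norm] in \<open>simp only: case_prod_beta'\<close>)
    show "integrable lborel (\<lambda>\<tau>. \<integral>\<xi>. norm (case (\<tau>, \<xi>) of (\<tau>, \<xi>) \<Rightarrow> ?E \<tau> \<xi>) \<partial>lborel)"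
    proof (rule Bochner_Integration.integrable_bound)
      show "integrable lborel (\<lambda>\<tau>. indicator {a..b} \<tau> * \<bar>C\<bar>)"
        by (intro integrable_mult_left integrable_real_indicator) (auto simp: emeasure_lborel_Icc_eq)
      show "(\<lambda>\<tau>. \<integral>\<xi>. norm (case (\<tau>, \<xi>) of (\<tau>, \<xi>) \<Rightarrow> ?E \<tau> \<xi>) \<partial>lborel) \<in> borel_measurable lborel"
        using m by simp
      show "AE \<tau> in lborel. norm (\<integral>\<xi>. norm (case (\<tau>, \<xi>) of (\<tau>, \<xi>) \<Rightarrow> ?E \<tau> \<xi>) \<partial>lborel) \<le> norm (indicator {a..b} \<tau> * \<bar>C\<bar>)"
        using bound by (intro AE_I2) (auto simp: indicator_def intro: order_trans[OF _ abs_ge_self])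
    qed
  qed
  from lborel_pair.Fubini_integral[OF i]
  show "(LINT \<tau>:{a..b}|lborel. (\<integral>\<xi>. E \<tau> \<xi> \<partial>lborel)) = (\<integral>\<xi>. (LINT \<tau>:{a..b}|lborel. E \<tau> \<xi>) \<partial>lborel)"
    unfolding set_lebesgue_integral_def
    by (subst (asm) eq_commute) (simp only: integral_scaleR_right)
  show "integrable lborel (\<lambda>\<xi>. LINT \<tau>:{a..b}|lborel. E \<tau> \<xi>)"
    unfolding set_lebesgue_integral_def using lborel_pair.integrable_snd[OF i] .
qed

text \<open>The exponents enter only through s > 1 and r \<ge> 1. The additional decay at the two
  distinguished times is assumed separately in the lemmas that depend on it.\<close>

locale z_solution =
  fixes \<alpha> s r T :: real and u :: "real \<Rightarrow> real \<Rightarrow> real"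
  assumes alpha: "0 < \<alpha>" "\<alpha> < 1" and s: "s > 1" and r: "r \<ge> 1"
    and sol: "Z_solution \<alpha> s r {0..T} u"
begin

abbreviation "m \<equiv> symbolA \<alpha>"
abbreviation "U t \<equiv> fourier (u t)"
abbreviation "N t \<equiv> fourier (\<lambda>x. (u t x)\<^sup>2)"

lemma Zspace: "t \<in> {0..T} \<Longrightarrow> u t \<in> Zspace s r"
  using sol by (simp add: Z_solution_def continuous_into_Z_def)

lemma Znorm_tendsto:
  "t0 \<in> {0..T} \<Longrightarrow> ((\<lambda>t. Znorm s r (\<lambda>x. u t x - u t0 x)) \<longlongrightarrow> 0) (at t0 within {0..T})"
  using sol by (simp add: Z_solution_def continuous_into_Z_def)

lemma Znorm_bounded: "\<exists>B\<ge>0. \<forall>t\<in>{0..T}. Znorm s r (u t) \<le> B"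
proof -
  have "continuous_on {0..T} (\<lambda>t. Znorm s r (u t))"
    unfolding continuous_on_def
  proof
    fix t0 assume t0: "t0 \<in> {0..T}"
    have "((\<lambda>t. Znorm s r (u t) - Znorm s r (u t0)) \<longlongrightarrow> 0) (at t0 within {0..T})"
    proof (rule Lim_null_comparison[OF _ Znorm_tendsto[OF t0]])
      have "norm (Znorm s r (u t) - Znorm s r (u t0)) \<le> Znorm s r (\<lambda>x. u t x - u t0 x)" if t: "t \<in> {0..T}" for t
        using Zspace_diff(2)[OF Zspace[OF t] Zspace[OF t0]] Zspace_diff(2)[OF Zspace[OF t0] Zspace[OF t]]
          Znorm_minus_commute[OF Zspace[OF t] Zspace[OF t0]] by simp
      then show "\<forall>\<^sub>F t in at t0 within {0..T}. norm (Znorm s r (u t) - Znorm s r (u t0)) \<le> Znorm s r (\<lambda>x. u t x - u t0 x)"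
        by (auto simp: eventually_at_filter)
    qed
    then show "((\<lambda>t. Znorm s r (u t)) \<longlongrightarrow> Znorm s r (u t0)) (at t0 within {0..T})"
      by (rule LIM_zero_cancel)
  qed
  then have "bounded ((\<lambda>t. Znorm s r (u t)) ` {0..T})"
    by (intro compact_imp_bounded compact_continuous_image compact_Icc)
  then obtain B where "\<forall>y\<in>(\<lambda>t. Znorm s r (u t)) ` {0..T}. norm y \<le> B"
    unfolding bounded_iff by blast
  then show ?thesis by (intro exI[of _ "max 0 B"]) (auto intro: order_trans[OF abs_ge_self] max.coboundedI2)
qed

text \<open>A bound for the norms along the compact time interval, fixed once so that later
  estimates can share it.\<close>

definition "B = (SOME B. B \<ge> 0 \<and> (\<forall>t\<in>{0..T}. Znorm s r (u t) \<le> B))"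

lemma B_nonneg: "0 \<le> B" and Znorm_le_B: "t \<in> {0..T} \<Longrightarrow> Znorm s r (u t) \<le> B"
proof -
  have "B \<ge> 0 \<and> (\<forall>t\<in>{0..T}. Znorm s r (u t) \<le> B)"
    unfolding B_def by (rule someI_ex) (use Znorm_bounded in blast)
  then show "0 \<le> B" "t \<in> {0..T} \<Longrightarrow> Znorm s r (u t) \<le> B" by auto
qed

lemma norm_U_diff_le:
  assumes "t \<in> {0..T}" "t0 \<in> {0..T}"
  shows "norm (U t \<xi> - U t0 \<xi>) \<le> sqrt pi * Znorm s r (\<lambda>x. u t x - u t0 x)"
proof -
  note d = Zspace_diff(1)[OF Zspace[OF assms(1)] Zspace[OF assms(2)]]
  have "U t \<xi> - U t0 \<xi> = fourier (\<lambda>x. u t x - u t0 x) \<xi>"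
    by (simp add: fourier_diff[OF integrable_Zspace[OF s r Zspace[OF assms(1)]] integrable_Zspace[OF s r Zspace[OF assms(2)]]])
  then show ?thesis
    using norm_fourier_le[of "\<lambda>x. u t x - u t0 x" \<xi>] L1norm_le_Znorm[OF s r d] by simp
qed

lemma integral_square_diff_le:
  assumes "t \<in> {0..T}" "t0 \<in> {0..T}"
  shows "(\<integral>x. \<bar>(u t x)\<^sup>2 - (u t0 x)\<^sup>2\<bar> \<partial>lborel) \<le> Znorm s r (\<lambda>x. u t x - u t0 x) * (2 * B)"
proof -
  note Z = Zspace[OF assms(1)] Zspace[OF assms(2)]
  note d = Zspace_diff(1)[OF Z]
  note sq = ZspaceD(1)[OF Z(1)] ZspaceD(1)[OF Z(2)] ZspaceD(1)[OF d]
  note add = square_integrable_add[OF sq(1,2)]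
  have "(\<integral>x. \<bar>(u t x)\<^sup>2 - (u t0 x)\<^sup>2\<bar> \<partial>lborel) = (\<integral>x. norm (u t x - u t0 x) * norm (u t x + u t0 x) \<partial>lborel)"
    by (intro Bochner_Integration.integral_cong) (auto simp: abs_mult[symmetric] power2_eq_square algebra_simps)
  also have "\<dots> \<le> L2norm (\<lambda>x. u t x - u t0 x) * L2norm (\<lambda>x. u t x + u t0 x)"
    by (rule L2_Cauchy_Schwarz_norm[OF sq(3) add])
  also have "\<dots> \<le> Znorm s r (\<lambda>x. u t x - u t0 x) * (2 * B)"
  proof (rule mult_mono)
    show "L2norm (\<lambda>x. u t x - u t0 x) \<le> Znorm s r (\<lambda>x. u t x - u t0 x)" by (rule L2norm_le_Znorm[OF s r d])
    show "L2norm (\<lambda>x. u t x + u t0 x) \<le> 2 * B"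
      using L2norm_triangle[OF sq(1,2)] L2norm_le_Znorm[OF s r Z(1)] L2norm_le_Znorm[OF s r Z(2)]
        Znorm_le_B[OF assms(1)] Znorm_le_B[OF assms(2)] by linarith
  qed auto
  finally show ?thesis .
qed

lemma norm_N_diff_le:
  assumes "t \<in> {0..T}" "t0 \<in> {0..T}"
  shows "norm (N t \<xi> - N t0 \<xi>) \<le> Znorm s r (\<lambda>x. u t x - u t0 x) * (2 * B)"
proof -
  note i = integrable_square[OF s r Zspace[OF assms(1)]] integrable_square[OF s r Zspace[OF assms(2)]]
  have "N t \<xi> - N t0 \<xi> = fourier (\<lambda>x. (u t x)\<^sup>2 - (u t0 x)\<^sup>2) \<xi>"
    by (simp add: fourier_diff[OF i])
  then show ?thesis
    using norm_fourier_le[of "\<lambda>x. (u t x)\<^sup>2 - (u t0 x)\<^sup>2" \<xi>] integral_square_diff_le[OF assms] by simp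
qed

text \<open>The weight r \<ge> 1 bounds the first moment of u^2. Together with the factor m, which
  is O(|\<xi>|), this makes replacing N(\<xi>) by N(0) an error of order \<xi>^2.\<close>

lemma norm_N_lipschitz:
  assumes t: "t \<in> {0..T}"
  shows "norm (N t \<xi> - N t \<eta>) \<le> \<bar>\<xi> - \<eta>\<bar> * B\<^sup>2"
proof -
  note Z = Zspace[OF t]
  have "norm (N t \<xi> - N t \<eta>) \<le> \<bar>\<xi> - \<eta>\<bar> * (\<integral>x. \<bar>x\<bar> * \<bar>(u t x)\<^sup>2\<bar> \<partial>lborel)"
    by (rule fourier_lipschitz[OF integrable_square[OF s r Z] integrable_abs_square[OF s r Z]])
  also have "\<dots> \<le> \<bar>\<xi> - \<eta>\<bar> * B\<^sup>2"
    using integral_abs_square_le[OF s r Z] power_mono[OF Znorm_le_B[OF t] Znorm_nonneg, of 2]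
    by (intro mult_left_mono) auto
  finally show ?thesis .
qed

lemma norm_N_le:
  assumes t: "t \<in> {0..T}"
  shows "norm (N t \<xi>) \<le> B\<^sup>2"
proof -
  have "norm (N t \<xi>) \<le> (\<integral>x. \<bar>(u t x)\<^sup>2\<bar> \<partial>lborel)" by (rule norm_fourier_le)
  also have "\<dots> = (L2norm (u t))\<^sup>2" unfolding L2norm_square by simp
  also have "\<dots> \<le> B\<^sup>2"
    using L2norm_le_Znorm[OF s r Zspace[OF t]] Znorm_le_B[OF t] by (intro power_mono) auto
  finally show ?thesis .
qed

lemma continuous_U: "continuous_on ({0..T} \<times> UNIV) (\<lambda>p. U (fst p) (snd p))"
proof (rule continuous_on_strip)
  show "continuous_on UNIV (U t)" if "t \<in> {0..T}" for t
    by (rule continuous_fourier[OF integrable_Zspace[OF s r Zspace[OF that]]])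
  show "((\<lambda>t. sqrt pi * Znorm s r (\<lambda>x. u t x - u t0 x)) \<longlongrightarrow> 0) (at t0 within {0..T})" if "t0 \<in> {0..T}" for t0
    by (rule tendsto_mult_right_zero[OF Znorm_tendsto[OF that]])
qed (rule norm_U_diff_le)

lemma continuous_N: "continuous_on ({0..T} \<times> UNIV) (\<lambda>p. N (fst p) (snd p))"
proof (rule continuous_on_strip)
  show "continuous_on UNIV (N t)" if "t \<in> {0..T}" for t
    by (rule continuous_fourier[OF integrable_square[OF s r Zspace[OF that]]])
  show "((\<lambda>t. Znorm s r (\<lambda>x. u t x - u t0 x) * (2 * B)) \<longlongrightarrow> 0) (at t0 within {0..T})" if "t0 \<in> {0..T}" for t0
    by (rule tendsto_mult_left_zero[OF Znorm_tendsto[OF that]])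
qed (rule norm_N_diff_le)

lemma continuous_m: "continuous_on A m"
  using continuous_symbolA[OF alpha(1)] continuous_on_subset by blast

text \<open>The transform of Duhamel's integrand, given by a formula that is continuous in time and
  frequency and so can replace the almost-everywhere representatives.\<close>

definition "E t \<tau> \<xi> = exp (complex_of_real (t - \<tau>) * m \<xi>) * (m \<xi> * N \<tau> \<xi>)"

lemma continuous_E: "continuous_on ({0..T} \<times> UNIV) (\<lambda>p. E t (fst p) (snd p))"
  unfolding E_def
  by (intro continuous_intros continuous_on_compose2[OF continuous_m[of UNIV]] continuous_N) auto

lemma norm_E_le:
  assumes "\<tau> \<in> {0..T}" shows "norm (E t \<tau> \<xi>) \<le> \<bar>\<xi>\<bar> * B\<^sup>2"
  unfolding E_def norm_mult norm_exp_symbolA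
  using norm_symbolA_le norm_N_le[OF assms] by (simp add: mult_mono)

lemma continuous_E_time: "continuous_on {0..T} (\<lambda>\<tau>. E t \<tau> \<xi>)"
proof -
  have "continuous_on {0..T} (\<lambda>\<tau>. (\<tau>, \<xi>))" by (intro continuous_intros)
  from continuous_on_compose2[OF continuous_E[of t] this] show ?thesis by (simp add: image_subset_iff)
qed

lemma continuous_integral_E:
  assumes "0 \<le> a" "b \<le> T"
  shows "continuous_on UNIV (\<lambda>\<xi>. integral {a..b} (\<lambda>\<tau>. E t \<tau> \<xi>))"
proof -
  have "continuous_on (UNIV \<times> cbox a b) (\<lambda>(\<xi>, \<tau>). E t \<tau> \<xi>)"
    unfolding case_prod_beta'
    using assms by (intro continuous_on_compose2[OF continuous_E[of t], of _ "\<lambda>p. (snd p, fst p)", simplified] continuous_intros) auto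
  from integral_continuous_on_param[OF this] show ?thesis by simp
qed

lemma LINT_E:
  assumes "0 \<le> a" "b \<le> T"
  shows "set_integrable lborel {a..b} (\<lambda>\<tau>. E t \<tau> \<xi>)"
    and "(LINT \<tau>:{a..b}|lborel. E t \<tau> \<xi>) = integral {a..b} (\<lambda>\<tau>. E t \<tau> \<xi>)"
proof -
  show i: "set_integrable lborel {a..b} (\<lambda>\<tau>. E t \<tau> \<xi>)"
    using assms by (intro borel_integrable_atLeastAtMost' continuous_on_subset[OF continuous_E_time]) auto
  show "(LINT \<tau>:{a..b}|lborel. E t \<tau> \<xi>) = integral {a..b} (\<lambda>\<tau>. E t \<tau> \<xi>)"
    by (rule set_borel_integral_eq_integral(2)[OF i])
qed

text \<open>Since \<xi> N is square integrable, the choice inside \<open>opA\<close> is a meaningful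
  one and has the expected transform.\<close>

lemma nonlinear_term_spec:
  assumes t: "\<tau> \<in> {0..T}"
  shows "square_integrable (opA \<alpha> (\<lambda>x. (u \<tau> x)\<^sup>2))"
    and "AE \<xi> in lborel. fourier_L2 (opA \<alpha> (\<lambda>x. (u \<tau> x)\<^sup>2)) \<xi> = m \<xi> * N \<tau> \<xi>"
proof -
  note Z = Zspace[OF t]
  note sq = square_integrable_square[OF s r Z]
  have [measurable]: "fourier_L2 (\<lambda>x. (u \<tau> x)\<^sup>2) \<in> borel_measurable borel" by (rule fourier_L2_measurable[OF sq])
  have "square_integrable (\<lambda>\<xi>. complex_of_real \<xi> * fourier_L2 (\<lambda>x. (u \<tau> x)\<^sup>2) \<xi>)"
    by (rule square_integrable_cong_AE[OF square_integrable_xi_fourier_square[OF s r Z]])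
       (use fourier_L2_square[OF s r Z] in \<open>auto elim!: eventually_mono\<close>)
  note A = opA_spec[OF alpha(1) sq this]
  show "square_integrable (opA \<alpha> (\<lambda>x. (u \<tau> x)\<^sup>2))" by (rule A(1))
  show "AE \<xi> in lborel. fourier_L2 (opA \<alpha> (\<lambda>x. (u \<tau> x)\<^sup>2)) \<xi> = m \<xi> * N \<tau> \<xi>"
    using A(2) fourier_L2_square[OF s r Z] by eventually_elim simp
qed

lemma integrand_spec:
  assumes t: "\<tau> \<in> {0..T}"
  shows "square_integrable (groupA \<alpha> (t - \<tau>) (opA \<alpha> (\<lambda>x. (u \<tau> x)\<^sup>2)))"
    and "AE \<xi> in lborel. fourier_L2 (groupA \<alpha> (t - \<tau>) (opA \<alpha> (\<lambda>x. (u \<tau> x)\<^sup>2))) \<xi> = E t \<tau> \<xi>"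
proof -
  note G = groupA_spec[OF alpha(1) nonlinear_term_spec(1)[OF t], of "t - \<tau>"]
  show "square_integrable (groupA \<alpha> (t - \<tau>) (opA \<alpha> (\<lambda>x. (u \<tau> x)\<^sup>2)))" by (rule G(1))
  show "AE \<xi> in lborel. fourier_L2 (groupA \<alpha> (t - \<tau>) (opA \<alpha> (\<lambda>x. (u \<tau> x)\<^sup>2))) \<xi> = E t \<tau> \<xi>"
    using G(2) nonlinear_term_spec(2)[OF t] by eventually_elim (simp add: E_def)
qed

lemma strip_measurable:
  fixes f :: "real \<Rightarrow> real \<Rightarrow> complex"
  assumes "continuous_on ({a..b} \<times> UNIV) (\<lambda>p. f (fst p) (snd p))"
  shows "(\<lambda>p. indicator {a..b} (fst p) *\<^sub>R f (fst p) (snd p)) \<in> borel_measurable (lborel \<Otimes>\<^sub>M lborel)"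
proof -
  have "({a..b} \<times> UNIV :: (real \<times> real) set) \<in> sets borel"
    by (intro borel_closed closed_Times closed_atLeastAtMost closed_UNIV)
  from borel_measurable_continuous_on_indicator[OF this assms]
  have "(\<lambda>p. indicator ({a..b} \<times> UNIV) p *\<^sub>R f (fst p) (snd p)) \<in> borel_measurable (borel \<Otimes>\<^sub>M borel)"
    by (simp add: borel_prod)
  moreover have "(\<lambda>p. indicator ({a..b} \<times> UNIV) p *\<^sub>R f (fst p) (snd p)) = (\<lambda>p. indicator {a..b} (fst p) *\<^sub>R f (fst p) (snd p))"
    by (auto simp: fun_eq_iff indicator_def)
  moreover have "borel_measurable (lborel \<Otimes>\<^sub>M lborel) = (borel_measurable (borel \<Otimes>\<^sub>M borel) :: (real \<times> real \<Rightarrow> complex) set)"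
    by (intro measurable_cong_sets sets_pair_measure_cong) auto
  ultimately show ?thesis by simp
qed

text \<open>The Duhamel integral is given only through pairings with real functions, so the test
  function \<open>k\<close> on the Fourier side is Hermitian and hence the transform of a real
  \<open>h\<close>. Parseval translates the pairing at each time. Boundedness and compact support of
  \<open>k\<close> compensate the growth of \<open>E\<close> in \<xi> and allow the exchange of the
  integrals.\<close>

lemma duhamel_pairing:
  assumes t: "t \<in> {0..T}"
    and w: "has_L2_integral (\<lambda>\<tau>. groupA \<alpha> (t - \<tau>) (opA \<alpha> (\<lambda>x. (u \<tau> x)\<^sup>2))) w {0..t}"
    and k: "square_integrable k" "\<And>\<xi>. k (- \<xi>) = cnj (k \<xi>)"
    and kb: "\<And>\<xi>. norm (k \<xi>) \<le> C * indicator {-R..R} \<xi>"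
  shows "(\<integral>\<xi>. fourier_L2 w \<xi> * cnj (k \<xi>) \<partial>lborel) = (\<integral>\<xi>. integral {0..t} (\<lambda>\<tau>. E t \<tau> \<xi>) * cnj (k \<xi>) \<partial>lborel)"
proof -
  let ?F = "\<lambda>\<tau>. groupA \<alpha> (t - \<tau>) (opA \<alpha> (\<lambda>x. (u \<tau> x)\<^sup>2))"
  have wsq: "square_integrable w" using w by (simp add: has_L2_integral_def)
  obtain h where h: "square_integrable h" "AE \<xi> in lborel. fourier_L2 h \<xi> = k \<xi>"
    using fourier_L2_surj[OF k(1)] k(2) by auto
  have ck[measurable]: "(\<lambda>\<xi>. cnj (k \<xi>)) \<in> borel_measurable borel"
    by (rule borel_measurable_cnj[OF borel_measurable_square_integrable[OF k(1)]])
  have ch[measurable]: "(\<lambda>\<xi>. cnj (fourier_L2 h \<xi>)) \<in> borel_measurable borel"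
    by (rule borel_measurable_cnj[OF fourier_L2_measurable[OF h(1)]])
  have C: "0 \<le> C * indicator {-R..R} \<xi>" for \<xi> :: real using order_trans[OF norm_ge_zero kb] .
  have Em: "continuous_on UNIV (E t \<tau>)" if "\<tau> \<in> {0..T}" for \<tau>
    unfolding E_def
    by (intro continuous_intros continuous_on_compose2[OF continuous_m[of UNIV]]
        continuous_fourier[OF integrable_square[OF s r Zspace[OF that]]]) auto
  have meas: "E t \<tau> \<in> borel_measurable borel" if "\<tau> \<in> {0..T}" for \<tau>
    using Em[OF that] by (rule borel_measurable_continuous_onI)
  have bnd: "norm (E t \<tau> \<xi> * cnj (k \<xi>)) \<le> (\<bar>R\<bar> * B\<^sup>2 * C) * indicator {-R..R} \<xi>" if "\<tau> \<in> {0..T}" for \<tau> \<xi>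
  proof (cases "\<xi> \<in> {-R..R}")
    case True
    have "\<bar>\<xi>\<bar> * B\<^sup>2 \<le> \<bar>R\<bar> * B\<^sup>2" using True by (intro mult_right_mono) auto
    then have "norm (E t \<tau> \<xi>) \<le> \<bar>R\<bar> * B\<^sup>2" using norm_E_le[OF that, of t \<xi>] by linarith
    then have "norm (E t \<tau> \<xi>) * norm (k \<xi>) \<le> (\<bar>R\<bar> * B\<^sup>2) * C"
      using True kb[of \<xi>] by (intro mult_mono) auto
    then show ?thesis using True by (simp add: norm_mult)
  next
    case False then show ?thesis using kb[of \<xi>] by (simp add: norm_mult)
  qed
  have iR: "integrable lborel (\<lambda>\<xi>::real. (\<bar>R\<bar> * B\<^sup>2 * C) * indicator {-R..R} \<xi>)"
    by (intro integrable_mult_right integrable_real_indicator) (auto simp: emeasure_lborel_Icc_eq)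
  have iE: "integrable lborel (\<lambda>\<xi>. E t \<tau> \<xi> * cnj (k \<xi>))" if "\<tau> \<in> {0..T}" for \<tau>
  proof (rule Bochner_Integration.integrable_bound[OF iR])
    note [measurable] = meas[OF that]
    show "(\<lambda>\<xi>. E t \<tau> \<xi> * cnj (k \<xi>)) \<in> borel_measurable lborel" by measurable
    show "AE \<xi> in lborel. norm (E t \<tau> \<xi> * cnj (k \<xi>)) \<le> norm ((\<bar>R\<bar> * B\<^sup>2 * C) * indicator {-R..R} \<xi> :: real)"
      using bnd[OF that] by (intro AE_I2) (metis abs_ge_self order_trans real_norm_def)
  qed
  have "(\<integral>\<xi>. fourier_L2 w \<xi> * cnj (k \<xi>) \<partial>lborel) = (\<integral>\<xi>. fourier_L2 w \<xi> * cnj (fourier_L2 h \<xi>) \<partial>lborel)"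
    using h(2) fourier_L2_measurable[OF wsq] by (intro integral_cong_AE) (auto elim!: eventually_mono)
  also have "\<dots> = complex_of_real (2 * pi * (\<integral>x. w x * h x \<partial>lborel))"
    by (rule fourier_L2_Parseval[OF wsq h(1)])
  also have "(\<integral>x. w x * h x \<partial>lborel) = (LINT \<tau>:{0..t}|lborel. (\<integral>x. ?F \<tau> x * h x \<partial>lborel))"
    using w h(1) by (simp add: has_L2_integral_def)
  also have "complex_of_real (2 * pi * (LINT \<tau>:{0..t}|lborel. (\<integral>x. ?F \<tau> x * h x \<partial>lborel)))
      = (LINT \<tau>:{0..t}|lborel. complex_of_real (2 * pi * (\<integral>x. ?F \<tau> x * h x \<partial>lborel)))"
    unfolding set_lebesgue_integral_def
    by (subst integral_mult_right_zero[symmetric], subst integral_complex_of_real[symmetric])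
       (intro Bochner_Integration.integral_cong, auto simp: scaleR_conv_of_real)
  also have "\<dots> = (LINT \<tau>:{0..t}|lborel. (\<integral>\<xi>. E t \<tau> \<xi> * cnj (k \<xi>) \<partial>lborel))"
  proof (rule set_lebesgue_integral_cong, simp, intro allI impI)
    fix \<tau> assume "\<tau> \<in> {0..t}"
    then have \<tau>: "\<tau> \<in> {0..T}" using t by auto
    note I = integrand_spec[OF \<tau>, of t]
    show "complex_of_real (2 * pi * (\<integral>x. ?F \<tau> x * h x \<partial>lborel)) = (\<integral>\<xi>. E t \<tau> \<xi> * cnj (k \<xi>) \<partial>lborel)"
      unfolding fourier_L2_Parseval[OF I(1) h(1), symmetric]
      using I(2) h(2) fourier_L2_measurable[OF I(1)] meas[OF \<tau>]
      by (intro integral_cong_AE) (auto elim!: eventually_elim2)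
  qed
  also have "\<dots> = (\<integral>\<xi>. (LINT \<tau>:{0..t}|lborel. E t \<tau> \<xi> * cnj (k \<xi>)) \<partial>lborel)"
  proof (rule strip_Fubini(1))
    have "continuous_on ({0..t} \<times> UNIV) (\<lambda>p. E t (fst p) (snd p))"
      by (rule continuous_on_subset[OF continuous_E]) (use t in auto)
    note [measurable] = strip_measurable[OF this]
    have "(\<lambda>p. (indicator {0..t} (fst p) *\<^sub>R E t (fst p) (snd p)) * cnj (k (snd p))) \<in> borel_measurable (lborel \<Otimes>\<^sub>M lborel)"
      by measurable
    then show "(\<lambda>p. indicator {0..t} (fst p) *\<^sub>R (E t (fst p) (snd p) * cnj (k (snd p)))) \<in> borel_measurable (lborel \<Otimes>\<^sub>M lborel)"
      by simp
    fix \<tau> assume "\<tau> \<in> {0..t}"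
    then have \<tau>: "\<tau> \<in> {0..T}" using t by auto
    show "integrable lborel (\<lambda>\<xi>. E t \<tau> \<xi> * cnj (k \<xi>))" by (rule iE[OF \<tau>])
    show "(\<integral>\<xi>. norm (E t \<tau> \<xi> * cnj (k \<xi>)) \<partial>lborel) \<le> (\<integral>\<xi>. (\<bar>R\<bar> * B\<^sup>2 * C) * indicator {-R..R} \<xi> \<partial>lborel)"
      by (rule integral_mono[OF integrable_norm[OF iE[OF \<tau>]] iR bnd[OF \<tau>]])
  qed
  also have "\<dots> = (\<integral>\<xi>. integral {0..t} (\<lambda>\<tau>. E t \<tau> \<xi>) * cnj (k \<xi>) \<partial>lborel)"
    using LINT_E(2)[of 0 t t] t by simp
  finally show ?thesis .
qed

lemma duhamel_AE:
  assumes t: "t \<in> {0..T}"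
    and w: "has_L2_integral (\<lambda>\<tau>. groupA \<alpha> (t - \<tau>) (opA \<alpha> (\<lambda>x. (u \<tau> x)\<^sup>2))) w {0..t}"
  shows "AE \<xi> in lborel. fourier_L2 w \<xi> = integral {0..t} (\<lambda>\<tau>. E t \<tau> \<xi>)"
proof -
  let ?W = "\<lambda>\<xi>. integral {0..t} (\<lambda>\<tau>. E t \<tau> \<xi>)"
  have wsq: "square_integrable w" using w by (simp add: has_L2_integral_def)
  have cW: "continuous_on UNIV ?W" using t by (intro continuous_integral_E) auto
  have iw: "integrable lborel (\<lambda>\<xi>. cindicator a b \<xi> * fourier_L2 w \<xi>)" for a b
    by (rule square_integrable_mult[OF square_integrable_indicator square_integrable_fourier_L2[OF wsq]])
  have iW: "integrable lborel (\<lambda>\<xi>. cindicator a b \<xi> * ?W \<xi>)" for a b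
    using borel_integrable_atLeastAtMost'[OF continuous_on_subset[OF cW subset_UNIV], of a b]
    by (simp add: set_integrable_def scaleR_conv_of_real)
  have "AE \<xi> in lborel. fourier_L2 w \<xi> - ?W \<xi> = 0"
  proof (rule AE_eq_0_of_interval_integrals)
    fix a b :: real
    show "integrable lborel (\<lambda>\<xi>. cindicator a b \<xi> * (fourier_L2 w \<xi> - ?W \<xi>))"
      using Bochner_Integration.integrable_diff[OF iw[of a b] iW[of a b]] by (simp add: right_diff_distrib)
    \<comment> \<open>The indicator of one interval is not Hermitian, so it is paired with its
      mirror image. The choices c = 1 and c = \<i> yield the sum and the difference of the integrals
      over the two intervals, which together isolate the integral over [a, b].\<close>
    define k where "k c \<xi> = c * cindicator a b \<xi> + cnj c * cindicator (- b) (- a) \<xi>" for c \<xi>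
    have k: "(\<integral>\<xi>. fourier_L2 w \<xi> * cnj (k c \<xi>) \<partial>lborel) = (\<integral>\<xi>. ?W \<xi> * cnj (k c \<xi>) \<partial>lborel)" for c
    proof (rule duhamel_pairing[OF t w])
      show "square_integrable (k c)"
        unfolding k_def[abs_def] by (intro square_integrable_add square_integrable_cmult square_integrable_indicator)
      show "k c (- \<xi>) = cnj (k c \<xi>)" for \<xi> by (auto simp: k_def indicator_def)
      show "norm (k c \<xi>) \<le> (2 * norm c) * indicator {- (\<bar>a\<bar> + \<bar>b\<bar>)..\<bar>a\<bar> + \<bar>b\<bar>} \<xi>" for \<xi>
        unfolding k_def using norm_triangle_ineq[of c "cnj c"] by (auto simp: indicator_def)
    qed
    have split: "(\<integral>\<xi>. f \<xi> * cnj (k c \<xi>) \<partial>lborel) =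
        cnj c * (\<integral>\<xi>. cindicator a b \<xi> * f \<xi> \<partial>lborel) + c * (\<integral>\<xi>. cindicator (- b) (- a) \<xi> * f \<xi> \<partial>lborel)"
      if f: "\<And>a b. integrable lborel (\<lambda>\<xi>. cindicator a b \<xi> * f \<xi>)" for f c
    proof -
      have "(\<integral>\<xi>. f \<xi> * cnj (k c \<xi>) \<partial>lborel) =
        (\<integral>\<xi>. cnj c * (cindicator a b \<xi> * f \<xi>) + c * (cindicator (- b) (- a) \<xi> * f \<xi>) \<partial>lborel)"
        by (intro Bochner_Integration.integral_cong) (auto simp: k_def algebra_simps)
      also have "\<dots> = (\<integral>\<xi>. cnj c * (cindicator a b \<xi> * f \<xi>) \<partial>lborel) + (\<integral>\<xi>. c * (cindicator (- b) (- a) \<xi> * f \<xi>) \<partial>lborel)"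
        by (intro Bochner_Integration.integral_add integrable_mult_right f)
      finally show ?thesis by (simp only: integral_mult_right_zero)
    qed
    let ?x = "\<integral>\<xi>. cindicator a b \<xi> * fourier_L2 w \<xi> \<partial>lborel" and ?y = "\<integral>\<xi>. cindicator a b \<xi> * ?W \<xi> \<partial>lborel"
    let ?x' = "\<integral>\<xi>. cindicator (- b) (- a) \<xi> * fourier_L2 w \<xi> \<partial>lborel" and ?y' = "\<integral>\<xi>. cindicator (- b) (- a) \<xi> * ?W \<xi> \<partial>lborel"
    have e: "cnj c * ?x + c * ?x' = cnj c * ?y + c * ?y'" for c
      using k[of c] unfolding split[OF iw] split[OF iW] .
    have "?x + ?x' = ?y + ?y'" using e[of 1] by simp
    moreover have "- ?x + ?x' = - ?y + ?y'"
    proof -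
      have "\<i> * (- ?x + ?x') = \<i> * (- ?y + ?y')" using e[of \<i>] by (simp add: algebra_simps)
      then show ?thesis by (simp only: mult_cancel_left complex_i_not_zero simp_thms)
    qed
    ultimately have "(?x + ?x') - (- ?x + ?x') = (?y + ?y') - (- ?y + ?y')" by (simp only:)
    then have "?x = ?y" by simp
    then show "(\<integral>\<xi>. cindicator a b \<xi> * (fourier_L2 w \<xi> - ?W \<xi>) \<partial>lborel) = 0"
      using Bochner_Integration.integral_diff[OF iw[of a b] iW[of a b]] by (simp add: right_diff_distrib)
  qed
  then show ?thesis by eventually_elim simp
qed

text \<open>Transforming the solution formula gives the identity for almost every \<xi>. Both sides
  are continuous in \<xi>, so no exceptional set remains.\<close>

lemma duhamel:
  assumes t: "t \<in> {0..T}"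
  shows "U t \<xi> = exp (complex_of_real t * m \<xi>) * U 0 \<xi> + integral {0..t} (\<lambda>\<tau>. E t \<tau> \<xi>)"
proof -
  have 0: "0 \<in> {0..T}" using t by auto
  note Zt = Zspace[OF t] and Z0 = Zspace[OF 0]
  obtain w where w: "has_L2_integral (\<lambda>\<tau>. groupA \<alpha> (t - \<tau>) (opA \<alpha> (\<lambda>x. (u \<tau> x)\<^sup>2))) w {0..t}"
    and ae: "AE x in lborel. u t x = groupA \<alpha> t (u 0) x + w x"
    using sol[unfolded Z_solution_def, THEN conjunct2, rule_format, OF t] by blast
  have wsq: "square_integrable w" using w by (simp add: has_L2_integral_def)
  note G = groupA_spec[OF alpha(1) ZspaceD(1)[OF Z0], of t]
  note [measurable] = borel_measurable_square_integrable[OF wsq] borel_measurable_square_integrable[OF G(1)] ZspaceD(2)[OF Zt]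
  have "fourier_L2 (\<lambda>x. u t x - groupA \<alpha> t (u 0) x) = fourier_L2 w"
    by (rule fourier_L2_cong_AE) (measurable, use ae in \<open>auto elim!: eventually_mono\<close>)
  with fourier_L2_diff[OF ZspaceD(1)[OF Zt] G(1)]
  have "AE \<xi> in lborel. fourier_L2 w \<xi> = fourier_L2 (u t) \<xi> - fourier_L2 (groupA \<alpha> t (u 0)) \<xi>" by simp
  with duhamel_AE[OF t w] G(2) fourier_L2_Zspace[OF s r Zt] fourier_L2_Zspace[OF s r Z0]
  have "AE \<xi> in lborel. U t \<xi> = exp (complex_of_real t * m \<xi>) * U 0 \<xi> + integral {0..t} (\<lambda>\<tau>. E t \<tau> \<xi>)"
    by eventually_elim (simp add: algebra_simps)
  moreover have "continuous_on UNIV (\<lambda>\<xi>. exp (complex_of_real t * m \<xi>) * U 0 \<xi>)"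
    by (intro continuous_intros continuous_m continuous_fourier[OF integrable_Zspace[OF s r Z0]])
  then have "continuous_on UNIV (\<lambda>\<xi>. exp (complex_of_real t * m \<xi>) * U 0 \<xi> + integral {0..t} (\<lambda>\<tau>. E t \<tau> \<xi>))"
    by (rule continuous_on_add) (rule continuous_integral_E, use t in auto)
  ultimately show ?thesis
    using continuous_AE_eq[OF continuous_fourier[OF integrable_Zspace[OF s r Zt]]] by blast
qed

text \<open>Split the time integral at t1. By the group law the propagator from t1 to t2 factors out
  of the earlier part, which recombines with the free term to give U at time t1.\<close>

lemma duhamel_between:
  assumes t: "0 \<le> t1" "t1 \<le> t2" "t2 \<le> T"
  shows "U t2 \<xi> = exp (complex_of_real (t2 - t1) * m \<xi>) * U t1 \<xi> + integral {t1..t2} (\<lambda>\<tau>. E t2 \<tau> \<xi>)"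
proof -
  let ?e = "exp (complex_of_real (t2 - t1) * m \<xi>)"
  have E: "E t2 \<tau> \<xi> = ?e * E t1 \<tau> \<xi>" for \<tau>
  proof -
    have "complex_of_real (t2 - \<tau>) * m \<xi> = complex_of_real (t2 - t1) * m \<xi> + complex_of_real (t1 - \<tau>) * m \<xi>"
      by (simp add: algebra_simps)
    then show ?thesis by (simp only: E_def exp_add mult.assoc)
  qed
  have e: "exp (complex_of_real t2 * m \<xi>) = ?e * exp (complex_of_real t1 * m \<xi>)"
    by (simp add: exp_add[symmetric] algebra_simps)
  have int: "(\<lambda>\<tau>. E t2 \<tau> \<xi>) integrable_on {0..t2}"
    using t by (intro integrable_continuous_interval continuous_on_subset[OF continuous_E_time]) auto
  have "integral {0..t2} (\<lambda>\<tau>. E t2 \<tau> \<xi>) = integral {0..t1} (\<lambda>\<tau>. E t2 \<tau> \<xi>) + integral {t1..t2} (\<lambda>\<tau>. E t2 \<tau> \<xi>)"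
    using t by (intro Henstock_Kurzweil_Integration.integral_combine[symmetric] int) auto
  also have "integral {0..t1} (\<lambda>\<tau>. E t2 \<tau> \<xi>) = ?e * integral {0..t1} (\<lambda>\<tau>. E t1 \<tau> \<xi>)"
    by (simp only: E integral_mult_right)
  finally show ?thesis
    using duhamel[of t2 \<xi>] duhamel[of t1 \<xi>] t by (simp add: e algebra_simps)
qed

end

section \<open>The singular term at the origin\<close>

lemma set_integrable_of_integrable_on:
  fixes f :: "real \<Rightarrow> real"
  assumes "f integrable_on S" "\<And>x. x \<in> S \<Longrightarrow> 0 \<le> f x" "S \<in> sets borel" "f \<in> borel_measurable borel"
  shows "set_integrable lborel S f"
proof -
  have "f absolutely_integrable_on S" using assms(1,2) by (intro nonnegative_absolutely_integrable_1)
  moreover have "(\<lambda>x. indicator S x *\<^sub>R f x) \<in> borel_measurable lborel" using assms(3,4) by measurable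
  ultimately show ?thesis
    unfolding set_integrable_def by (simp add: integrable_completion)
qed

lemma square_integrable_powers:
  assumes b: "b > - (1/2)" and a: "a > 1/2"
  shows "square_integrable (\<lambda>x::real. if \<bar>x\<bar> \<le> 1 then \<bar>x\<bar> powr b else \<bar>x\<bar> powr (- a))" (is "square_integrable ?f")
proof -
  let ?g = "\<lambda>x::real. indicator {0..1} x * x powr (2 * b) + indicator {1..} x * x powr (- 2 * a)"
  have g1: "integrable lborel (\<lambda>x::real. indicator {0..1} x * x powr (2 * b))"
    using set_integrable_of_integrable_on[OF integrable_on_powr_from_0[of "2 * b" 1]] b
    by (simp add: set_integrable_def)
  have g2: "integrable lborel (\<lambda>x::real. indicator {1..} x * x powr (- 2 * a))"
  proof -
    have "(\<lambda>x::real. x powr (- 2 * a)) integrable_on {1..}"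
      using has_integral_powr_to_inf[of "- 2 * a" 1] a by (auto simp: integrable_on_def)
    from set_integrable_of_integrable_on[OF this] show ?thesis by (simp add: set_integrable_def)
  qed
  have g: "integrable lborel ?g" using g1 g2 by simp
  have gr: "integrable lborel (\<lambda>x. ?g x + ?g (- x))"
    using g lborel_integrable_real_affine[OF g, of "-1" 0] by simp
  have [measurable]: "?f \<in> borel_measurable borel" by measurable
  have pos: "(x powr c)\<^sup>2 = x powr (2 * c)" if "x \<ge> 0" for x c :: real
    using that by (simp add: power2_eq_square powr_add[symmetric])
  have nonneg: "0 \<le> ?g x" for x by simp
  have le: "(?f x)\<^sup>2 \<le> ?g \<bar>x\<bar>" for x
    by (auto simp: pos indicator_def)
  have "?g \<bar>x\<bar> \<le> ?g x + ?g (- x)" for x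
    using nonneg[of x] nonneg[of "- x"] by (cases "x \<ge> 0") (auto simp: abs_if)
  with le show ?thesis
    by (intro square_integrable_dominated[OF _ gr]) (simp, unfold real_norm_def power2_abs, rule order_trans)
qed

lemma norm_second_difference_char:
  "norm ((exp (- (\<i> * complex_of_real y)) - 1)\<^sup>2) \<le> 4 * min 1 (y\<^sup>2)"
proof -
  have "norm (exp (\<i> * complex_of_real (- y)) - exp (\<i> * complex_of_real 0)) \<le> \<bar>- y - 0\<bar>"
    by (rule norm_iexp_diff_le)
  then have 1: "norm (exp (- (\<i> * complex_of_real y)) - 1) \<le> \<bar>y\<bar>" by simp
  have 2: "norm (exp (- (\<i> * complex_of_real y)) - 1) \<le> 2"
    using norm_triangle_ineq4[of "exp (- (\<i> * complex_of_real y))" 1] by simp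
  have "(norm (exp (- (\<i> * complex_of_real y)) - 1))\<^sup>2 \<le> \<bar>y\<bar>\<^sup>2"
    "(norm (exp (- (\<i> * complex_of_real y)) - 1))\<^sup>2 \<le> 2\<^sup>2"
    using 1 2 by (intro power_mono; simp)+
  moreover have "\<bar>y\<bar>\<^sup>2 \<le> 4 * y\<^sup>2" by simp
  ultimately have "(norm (exp (- (\<i> * complex_of_real y)) - 1))\<^sup>2 \<le> 4 * y\<^sup>2"
    "(norm (exp (- (\<i> * complex_of_real y)) - 1))\<^sup>2 \<le> 4"
    by (blast intro: order_trans, simp)
  then show ?thesis unfolding norm_power min_def by auto
qed

text \<open>The nodes 0, h, 2h correspond to the perfect square (exp(-i h x) - 1)^2, which vanishes
  to second order at x = 0.\<close>

lemma fourier_second_difference: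
  assumes f: "integrable lborel f"
  shows "fourier f (2 * h) - 2 * fourier f h + fourier f 0 =
    (\<integral>x. (exp (- (\<i> * complex_of_real (h * x))) - 1)\<^sup>2 * complex_of_real (f x) \<partial>lborel)"
proof -
  let ?e = "\<lambda>\<xi> x. exp (- (\<i> * complex_of_real (x * \<xi>))) * complex_of_real (f x)"
  have i: "integrable lborel (?e \<xi>)" for \<xi>
    by (rule integrable_exp_mult) (use f in simp)
  have "(exp (- (\<i> * complex_of_real (h * x))) - 1)\<^sup>2 * complex_of_real (f x) = ?e (2 * h) x - 2 * ?e h x + ?e 0 x" for x
  proof -
    have "exp (- (\<i> * complex_of_real (x * (2 * h)))) = (exp (- (\<i> * complex_of_real (h * x))))\<^sup>2"
      by (simp add: exp_double[symmetric] mult_ac)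
    then show ?thesis by (simp add: power2_eq_square algebra_simps)
  qed
  then have "(\<integral>x. (exp (- (\<i> * complex_of_real (h * x))) - 1)\<^sup>2 * complex_of_real (f x) \<partial>lborel)
      = (\<integral>x. ?e (2 * h) x - 2 * ?e h x + ?e 0 x \<partial>lborel)" by (simp only:)
  also have "\<dots> = (\<integral>x. ?e (2 * h) x - 2 * ?e h x \<partial>lborel) + (\<integral>x. ?e 0 x \<partial>lborel)"
    by (intro Bochner_Integration.integral_add Bochner_Integration.integrable_diff integrable_mult_right i)
  also have "(\<integral>x. ?e (2 * h) x - 2 * ?e h x \<partial>lborel) = (\<integral>x. ?e (2 * h) x \<partial>lborel) - (\<integral>x. 2 * ?e h x \<partial>lborel)"
    by (intro Bochner_Integration.integral_diff integrable_mult_right i)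
  finally show ?thesis unfolding fourier_def by (simp only: integral_mult_right_zero)
qed

text \<open>The exponent \<open>1 + \<alpha>\<close> is the borderline one for \<open>|x|\<^bsup>3/2+\<alpha>\<^esup> f \<in> L\<^sup>2\<close>: Cauchy--Schwarz and scaling alone
  give \<open>O(h\<^bsup>1+\<alpha>\<^esup>)\<close>, and the gain to little-o comes from the smallness of the tail of the weighted norm.\<close>

lemma second_difference_small:
  assumes \<alpha>: "0 < \<alpha>" "\<alpha> < 1" and f: "integrable lborel f"
    and w: "square_integrable (\<lambda>x. \<bar>x\<bar> powr (3/2 + \<alpha>) * f x)" and e: "e > 0"
  shows "\<exists>\<delta>>0. \<forall>h. 0 < h \<and> h < \<delta> \<longrightarrow>
    norm (fourier f (2 * h) - 2 * fourier f h + fourier f 0) \<le> e * h powr (1 + \<alpha>)"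
proof -
  define \<sigma> where "\<sigma> = 3/2 + \<alpha>"
  \<comment> \<open>\<psi>(y) is min(1, y^2) |y|^(-\<sigma>) away from 0: the bound for the squared
    exponential difference divided by the weight. Near 0 the exponent 2 - \<sigma> = 1/2 - \<alpha>
    exceeds -1/2 exactly because \<alpha> < 1, and \<sigma> > 1/2 handles infinity.\<close>
  define \<psi> where "\<psi> x = (if \<bar>x\<bar> \<le> 1 then \<bar>x\<bar> powr (2 - \<sigma>) else \<bar>x\<bar> powr (- \<sigma>))" for x :: real
  have \<psi>: "square_integrable \<psi>"
    unfolding \<psi>_def[abs_def] by (rule square_integrable_powers) (use \<alpha> in \<open>auto simp: \<sigma>_def\<close>)
  have \<psi>_eq: "min 1 (y\<^sup>2) * \<bar>y\<bar> powr (- \<sigma>) = \<psi> y" if "y \<noteq> 0" for y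
  proof (cases "\<bar>y\<bar> \<le> 1")
    case True
    then have "y\<^sup>2 \<le> 1" using power_mono[of "\<bar>y\<bar>" 1 2] by simp
    then have "min 1 (y\<^sup>2) = \<bar>y\<bar> powr 2" using that by simp
    then have "min 1 (y\<^sup>2) * \<bar>y\<bar> powr (- \<sigma>) = \<bar>y\<bar> powr (2 + - \<sigma>)" by (simp only: powr_add)
    then show ?thesis using True by (simp add: \<psi>_def)
  next
    case False
    then have "1 \<le> y\<^sup>2" using power_mono[of 1 "\<bar>y\<bar>" 2] by simp
    then show ?thesis using False by (simp add: \<psi>_def min_def)
  qed
  define G where "G x = complex_of_real (\<bar>x\<bar> powr \<sigma> * f x)" for x
  have G: "square_integrable G" using w unfolding G_def[abs_def] \<sigma>_def by (simp only: square_integrable_of_real)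
  define L where "L = 4 * (L2norm \<psi> + 1)"
  have L: "L > 0" unfolding L_def by (simp add: add_nonneg_pos)
  have "\<forall>\<^sub>F R in at_top. L2norm (\<lambda>x. truncate R G x - G x) < e / 2 / L"
    using order_tendstoD(2)[OF truncate_L2_tendsto[OF G]] e L by simp
  then obtain R0 where R0: "\<And>R. R \<ge> R0 \<Longrightarrow> L2norm (\<lambda>x. truncate R G x - G x) < e / 2 / L"
    unfolding eventually_at_top_linorder by blast
  define R where "R = max R0 1"
  have R: "L2norm (\<lambda>x. truncate R G x - G x) < e / 2 / L" "R \<ge> 1" using R0[of R] by (auto simp: R_def)
  \<comment> \<open>The negative of the tail of the weighted function: it vanishes on [-R, R], and
    its norm is small by the choice of R.\<close>
  define g where "g x = truncate R G x - G x" for x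
  have g: "square_integrable g"
    unfolding g_def[abs_def] by (rule square_integrable_diff[OF square_integrable_truncate[OF G] G])
  define F1 where "F1 = (\<integral>x. \<bar>f x\<bar> \<partial>lborel)"
  have F1: "F1 \<ge> 0" unfolding F1_def by simp
  \<comment> \<open>Solves 4 R^2 (F1 + 1) \<delta>^(1 - \<alpha>) = e/2. The part |x| \<le> R
    contributes at most 4 h^2 R^2 F1, which is then at most (e/2) h^(1 + \<alpha>); the summand 1
    keeps the divisor positive.\<close>
  define \<delta> where "\<delta> = (e / 2 / (4 * R\<^sup>2 * (F1 + 1))) powr (1 / (1 - \<alpha>))"
  have R2: "4 * R\<^sup>2 * (F1 + 1) > 0" using R F1 by (intro mult_pos_pos) auto
  have "e / 2 / (4 * R\<^sup>2 * (F1 + 1)) > 0" using e R2 by (intro divide_pos_pos) auto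
  then have "\<delta> > 0" unfolding \<delta>_def by (metis less_irrefl powr_gt_zero)
  moreover have "norm (fourier f (2 * h) - 2 * fourier f h + fourier f 0) \<le> e * h powr (1 + \<alpha>)"
    if h: "0 < h" "h < \<delta>" for h
  proof -
    \<comment> \<open>Dilation costs h^(-1/2) in L2. Against the factor h^\<sigma> this leaves
      precisely h^(1 + \<alpha>).\<close>
    have \<psi>h: "square_integrable (\<lambda>x. \<psi> (h * x))" and L\<psi>h: "L2norm (\<lambda>x. \<psi> (h * x)) = h powr (- 1/2) * L2norm \<psi>"
    proof -
      show "square_integrable (\<lambda>x. \<psi> (h * x))"
        using lborel_integrable_real_affine[OF integrable_square_integrable[OF \<psi>], of h 0] h
          measurable_compose[OF _ borel_measurable_square_integrable[OF \<psi>], of "\<lambda>x. h * x" borel]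
        by (simp add: square_integrable_def)
      have "(\<integral>x. (norm (\<psi> x))\<^sup>2 \<partial>lborel) = h * (\<integral>x. (norm (\<psi> (h * x)))\<^sup>2 \<partial>lborel)"
        using lborel_integral_real_affine[of h "\<lambda>x. (norm (\<psi> x))\<^sup>2" 0] h by simp
      then have "L2norm \<psi> = sqrt h * L2norm (\<lambda>x. \<psi> (h * x))"
        unfolding L2norm_def by (simp add: real_sqrt_mult)
      moreover have "h powr (- 1/2) * sqrt h = 1"
        using h by (simp add: powr_half_sqrt[symmetric] powr_add[symmetric])
      ultimately show "L2norm (\<lambda>x. \<psi> (h * x)) = h powr (- 1/2) * L2norm \<psi>"
        by (simp add: mult.assoc[symmetric])
    qed
    \<comment> \<open>For |x| \<le> R the quadratic bound (h x)^2 is used and yields the first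
      summand. For |x| > R the weight is inserted, so that the bound becomes \<psi>(h x) times the
      tail \<open>g\<close>, and yields the second.\<close>
    have pt: "norm ((exp (- (\<i> * complex_of_real (h * x))) - 1)\<^sup>2 * complex_of_real (f x))
        \<le> 4 * (h\<^sup>2 * R\<^sup>2) * \<bar>f x\<bar> + 4 * h powr \<sigma> * (norm (\<psi> (h * x)) * norm (g x))" (is "?l \<le> ?r") for x
    proof -
      have a: "?l \<le> 4 * min 1 ((h * x)\<^sup>2) * \<bar>f x\<bar>"
        unfolding norm_mult using norm_second_difference_char[of "h * x"]
        by (simp add: mult_right_mono)
      show ?thesis
      proof (cases "\<bar>x\<bar> \<le> R")
        case True
        then have "x\<^sup>2 \<le> R\<^sup>2" using power_mono[of "\<bar>x\<bar>" R 2] by simp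
        then have "(h * x)\<^sup>2 \<le> h\<^sup>2 * R\<^sup>2" by (simp add: power_mult_distrib mult_left_mono)
        then have "4 * min 1 ((h * x)\<^sup>2) * \<bar>f x\<bar> \<le> 4 * (h\<^sup>2 * R\<^sup>2) * \<bar>f x\<bar>"
          by (intro mult_right_mono mult_left_mono) auto
        moreover have "0 \<le> 4 * h powr \<sigma> * (norm (\<psi> (h * x)) * norm (g x))" by simp
        ultimately show ?thesis using a by linarith
      next
        case False
        then have x: "x \<noteq> 0" "x \<notin> {-R..R}" using R by auto
        have "norm (g x) = \<bar>x\<bar> powr \<sigma> * \<bar>f x\<bar>"
          using x(2) by (simp add: g_def truncate_def G_def norm_mult abs_mult)
        moreover have "norm (\<psi> (h * x)) = min 1 ((h * x)\<^sup>2) * (h powr (- \<sigma>) * \<bar>x\<bar> powr (- \<sigma>))"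
          using \<psi>_eq[of "h * x"] x h by (simp add: abs_mult powr_mult \<psi>_def)
        ultimately have "4 * h powr \<sigma> * (norm (\<psi> (h * x)) * norm (g x)) =
            4 * min 1 ((h * x)\<^sup>2) * \<bar>f x\<bar> * ((h powr \<sigma> * h powr (- \<sigma>)) * (\<bar>x\<bar> powr \<sigma> * \<bar>x\<bar> powr (- \<sigma>)))"
          by (simp only: mult_ac)
        also have "\<dots> = 4 * min 1 ((h * x)\<^sup>2) * \<bar>f x\<bar>"
          using x h by (simp add: powr_add[symmetric])
        finally have "4 * h powr \<sigma> * (norm (\<psi> (h * x)) * norm (g x)) = 4 * min 1 ((h * x)\<^sup>2) * \<bar>f x\<bar>" .
        moreover have "0 \<le> 4 * (h\<^sup>2 * R\<^sup>2) * \<bar>f x\<bar>" by simp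
        ultimately show ?thesis using a by linarith
      qed
    qed
    have cpsi: "square_integrable (\<lambda>x. complex_of_real (\<psi> (h * x)))" using \<psi>h by (simp only: square_integrable_of_real)
    have i1: "integrable lborel (\<lambda>x. norm (\<psi> (h * x)) * norm (g x))"
      using square_integrable_mult_norm[OF cpsi g] by simp
    have "norm (fourier f (2 * h) - 2 * fourier f h + fourier f 0)
        \<le> (\<integral>x. norm ((exp (- (\<i> * complex_of_real (h * x))) - 1)\<^sup>2 * complex_of_real (f x)) \<partial>lborel)"
      unfolding fourier_second_difference[OF f] by (rule integral_norm_bound)
    also have "\<dots> \<le> (\<integral>x. 4 * (h\<^sup>2 * R\<^sup>2) * \<bar>f x\<bar> + 4 * h powr \<sigma> * (norm (\<psi> (h * x)) * norm (g x)) \<partial>lborel)"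
    proof (rule integral_mono[OF _ _ pt])
      have [measurable]: "f \<in> borel_measurable borel" using f by simp
      show r: "integrable lborel (\<lambda>x. 4 * (h\<^sup>2 * R\<^sup>2) * \<bar>f x\<bar> + 4 * h powr \<sigma> * (norm (\<psi> (h * x)) * norm (g x)))"
        by (intro Bochner_Integration.integrable_add integrable_mult_right integrable_abs f i1)
      show "integrable lborel (\<lambda>x. norm ((exp (- (\<i> * complex_of_real (h * x))) - 1)\<^sup>2 * complex_of_real (f x)))"
        by (rule Bochner_Integration.integrable_bound[OF r], measurable)
           (intro AE_I2, use pt in \<open>auto intro: order_trans[OF _ abs_ge_self]\<close>)
    qed
    also have "\<dots> = 4 * (h\<^sup>2 * R\<^sup>2) * F1 + 4 * h powr \<sigma> * (\<integral>x. norm (\<psi> (h * x)) * norm (g x) \<partial>lborel)"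
      unfolding F1_def using f i1
      by (subst Bochner_Integration.integral_add) (auto intro!: integrable_mult_right)
    finally have total: "norm (fourier f (2 * h) - 2 * fourier f h + fourier f 0) \<le>
        4 * (h\<^sup>2 * R\<^sup>2) * F1 + 4 * h powr \<sigma> * (\<integral>x. norm (\<psi> (h * x)) * norm (g x) \<partial>lborel)" .
    have "(\<integral>x. norm (\<psi> (h * x)) * norm (g x) \<partial>lborel) \<le> L2norm (\<lambda>x. \<psi> (h * x)) * L2norm g"
      using L2_Cauchy_Schwarz_norm[OF cpsi g] by (simp add: L2norm_of_real)
    then have cs: "4 * h powr \<sigma> * (\<integral>x. norm (\<psi> (h * x)) * norm (g x) \<partial>lborel)
        \<le> 4 * h powr \<sigma> * (L2norm (\<lambda>x. \<psi> (h * x)) * L2norm g)"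
      by (intro mult_left_mono) auto
    have scale: "4 * h powr \<sigma> * (L2norm (\<lambda>x. \<psi> (h * x)) * L2norm g) = h powr (1 + \<alpha>) * (4 * L2norm \<psi> * L2norm g)"
    proof -
      have "h powr \<sigma> * h powr (- 1/2) = h powr (1 + \<alpha>)" by (simp add: powr_add[symmetric] \<sigma>_def)
      moreover have "4 * h powr \<sigma> * (L2norm (\<lambda>x. \<psi> (h * x)) * L2norm g)
          = (h powr \<sigma> * h powr (- 1/2)) * (4 * L2norm \<psi> * L2norm g)"
        unfolding L\<psi>h by (simp only: mult_ac)
      ultimately show ?thesis by (simp only:)
    qed
    have "4 * L2norm \<psi> * L2norm g \<le> e / 2"
    proof -
      have "4 * L2norm \<psi> * L2norm g \<le> L * L2norm g" unfolding L_def by (intro mult_right_mono) auto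
      also have "\<dots> \<le> L * (e / 2 / L)" using R(1) L unfolding g_def[abs_def] by (intro mult_left_mono) auto
      finally show ?thesis using L by simp
    qed
    then have tail: "h powr (1 + \<alpha>) * (4 * L2norm \<psi> * L2norm g) \<le> h powr (1 + \<alpha>) * (e / 2)"
      by (intro mult_left_mono) auto
    have "4 * (h\<^sup>2 * R\<^sup>2) * F1 \<le> (e / 2) * h powr (1 + \<alpha>)"
    proof -
      have "h powr (1 - \<alpha>) \<le> \<delta> powr (1 - \<alpha>)" using h \<alpha> by (intro powr_mono2) auto
      also have "\<dots> = e / 2 / (4 * R\<^sup>2 * (F1 + 1))" using e R2 \<alpha> by (simp add: \<delta>_def powr_powr)
      finally have hp: "4 * R\<^sup>2 * (F1 + 1) * h powr (1 - \<alpha>) \<le> e / 2"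
        using R2 by (simp add: pos_le_divide_eq mult.commute)
      have "h\<^sup>2 = h powr (1 - \<alpha>) * h powr (1 + \<alpha>)" using h by (simp add: powr_add[symmetric])
      then have "4 * (h\<^sup>2 * R\<^sup>2) * F1 = (4 * R\<^sup>2 * F1 * h powr (1 - \<alpha>)) * h powr (1 + \<alpha>)" by simp
      also have "\<dots> \<le> (4 * R\<^sup>2 * (F1 + 1) * h powr (1 - \<alpha>)) * h powr (1 + \<alpha>)"
        by (intro mult_right_mono mult_left_mono) auto
      also have "\<dots> \<le> (e / 2) * h powr (1 + \<alpha>)" using hp by (intro mult_right_mono) auto
      finally show ?thesis .
    qed
    then have "norm (fourier f (2 * h) - 2 * fourier f h + fourier f 0) \<le> (e / 2) * h powr (1 + \<alpha>) + h powr (1 + \<alpha>) * (e / 2)"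
      using total cs tail unfolding scale by linarith
    then show ?thesis by simp
  qed
  ultimately show ?thesis by blast
qed

text \<open>For |x| > 1 write |x| = |x|^(-1/2 - \<alpha>) |x|^(3/2 + \<alpha>); the first factor is
  square integrable at infinity because \<alpha> > 0. The finite first moment makes the transform at
  time t1 Lipschitz.\<close>

lemma integrable_abs_mult_of_weight:
  assumes \<alpha>: "0 < \<alpha>" and f: "integrable lborel f"
    and w: "square_integrable (\<lambda>x. \<bar>x\<bar> powr (3/2 + \<alpha>) * f x)"
  shows "integrable lborel (\<lambda>x. \<bar>x\<bar> * \<bar>f x\<bar>)"
proof -
  let ?\<chi> = "\<lambda>x::real. if \<bar>x\<bar> \<le> 1 then \<bar>x\<bar> powr 0 else \<bar>x\<bar> powr (- (1/2 + \<alpha>))"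
  let ?G = "\<lambda>x. \<bar>x\<bar> powr (3/2 + \<alpha>) * f x"
  have \<chi>: "square_integrable ?\<chi>" by (rule square_integrable_powers) (use \<alpha> in auto)
  have [measurable]: "f \<in> borel_measurable borel" using f by simp
  have i: "integrable lborel (\<lambda>x. \<bar>f x\<bar> + norm (?\<chi> x) * norm (?G x))"
    using f square_integrable_mult_norm[OF \<chi> w] by (intro Bochner_Integration.integrable_add integrable_abs)
  have le: "\<bar>x\<bar> * \<bar>f x\<bar> \<le> \<bar>f x\<bar> + norm (?\<chi> x) * norm (?G x)" for x
  proof (cases "\<bar>x\<bar> \<le> 1")
    case True
    then have "\<bar>x\<bar> * \<bar>f x\<bar> \<le> 1 * \<bar>f x\<bar>" by (intro mult_right_mono) auto
    moreover have "0 \<le> norm (?\<chi> x) * norm (?G x)" by simp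
    ultimately show ?thesis by linarith
  next
    case False
    then have "norm (?\<chi> x) * norm (?G x) = (\<bar>x\<bar> powr (- (1/2 + \<alpha>)) * \<bar>x\<bar> powr (3/2 + \<alpha>)) * \<bar>f x\<bar>"
      by (simp add: abs_mult)
    also have "\<bar>x\<bar> powr (- (1/2 + \<alpha>)) * \<bar>x\<bar> powr (3/2 + \<alpha>) = \<bar>x\<bar>"
      using False by (simp add: powr_add[symmetric])
    finally show ?thesis by simp
  qed
  show ?thesis
    by (rule Bochner_Integration.integrable_bound[OF i], measurable)
       (intro AE_I2, use le in \<open>auto simp: abs_mult intro: order_trans[OF _ abs_ge_self]\<close>)
qed

lemma norm_exp_imag_approx:
  assumes "Re z = 0"
  shows "norm (exp z - 1) \<le> norm z" "norm (exp z - 1 - z) \<le> (norm z)\<^sup>2"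
proof -
  have z: "z = \<i> * complex_of_real (Im z)" using assms by (simp add: complex_eq_iff)
  then have nz: "norm z = \<bar>Im z\<bar>" by (metis norm_ii norm_mult mult_1 norm_of_real)
  have "norm (exp (\<i> * complex_of_real (Im z)) - exp (\<i> * complex_of_real 0)) \<le> \<bar>Im z - 0\<bar>"
    by (rule norm_iexp_diff_le)
  then show "norm (exp z - 1) \<le> norm z" unfolding nz by (subst z) simp
  have "norm (exp (\<i> * complex_of_real (Im z)) - (\<Sum>k\<le>1. (\<i> * complex_of_real (Im z)) ^ k / fact k)) \<le> \<bar>Im z\<bar> ^ Suc 1 / fact (Suc 1)"
    by (rule iexp_approx1)
  then have "norm (exp z - 1 - z) \<le> \<bar>Im z\<bar>\<^sup>2 / 2"
    unfolding z[symmetric] by (simp add: diff_diff_eq power2_eq_square)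
  also have "\<dots> \<le> (norm z)\<^sup>2" unfolding nz by simp
  finally show "norm (exp z - 1 - z) \<le> (norm z)\<^sup>2" .
qed

text \<open>The linear parts cancel, and the common denominator leaves 2 h ((2h)^\<alpha> -
  h^\<alpha>) in the numerator. For h \<le> 1/2 both denominators are at most 2, which accounts for
  the constant; it is positive because \<alpha> > 0.\<close>

lemma symbolA_second_difference:
  assumes \<alpha>: "0 < \<alpha>" and h: "0 < h" "h \<le> 1/2"
  shows "(2 powr \<alpha> - 1) / 2 * h powr (1 + \<alpha>) \<le> norm (symbolA \<alpha> (2 * h) - 2 * symbolA \<alpha> h)"
proof -
  let ?a = "1 + h powr \<alpha>" and ?b = "1 + (2 * h) powr \<alpha>"
  have p: "0 < ?a" "0 < ?b" by (auto intro: add_pos_nonneg)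
  have "symbolA \<alpha> (2 * h) - 2 * symbolA \<alpha> h = - (\<i> * complex_of_real (2 * h / ?b - 2 * (h / ?a)))"
    using h by (simp add: symbolA_eq right_diff_distrib del: of_real_add)
  then have "norm (symbolA \<alpha> (2 * h) - 2 * symbolA \<alpha> h) = \<bar>2 * h / ?b - 2 * (h / ?a)\<bar>"
    by (simp only: norm_minus_cancel norm_mult norm_ii norm_of_real mult_1)
  also have "2 * h / ?b - 2 * (h / ?a) = - (2 * h * ((2 * h) powr \<alpha> - h powr \<alpha>) / (?a * ?b))"
  proof -
    have "2 * h / b - 2 * (h / a) = - (2 * h * ((b - 1) - (a - 1)) / (a * b))" if "a > 0" "b > 0" for a b :: real
      using that by (simp add: field_simps)
    from this[OF p] show ?thesis by simp
  qed
  also have "(2 * h) powr \<alpha> - h powr \<alpha> = (2 powr \<alpha> - 1) * h powr \<alpha>"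
    using h by (simp add: powr_mult algebra_simps)
  finally have eq: "norm (symbolA \<alpha> (2 * h) - 2 * symbolA \<alpha> h) = \<bar>2 * h * ((2 powr \<alpha> - 1) * h powr \<alpha>) / (?a * ?b)\<bar>"
    by simp
  have two: "2 powr \<alpha> - 1 \<ge> 0" using ge_one_powr_ge_zero[of 2 \<alpha>] \<alpha> by simp
  have hh: "h * h powr \<alpha> = h powr (1 + \<alpha>)" using h by (simp add: powr_add)
  have "(2 powr \<alpha> - 1) / 2 * h powr (1 + \<alpha>) = 2 * h * ((2 powr \<alpha> - 1) * h powr \<alpha>) / 4"
    by (simp add: hh[symmetric])
  also have "\<dots> \<le> 2 * h * ((2 powr \<alpha> - 1) * h powr \<alpha>) / (?a * ?b)"
  proof (rule divide_left_mono)
    have "h powr \<alpha> \<le> 1 powr \<alpha>" "(2 * h) powr \<alpha> \<le> 1 powr \<alpha>" using h \<alpha> by (intro powr_mono2; simp)+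
    then have "?a * ?b \<le> 2 * 2" by (intro mult_mono) auto
    then show "?a * ?b \<le> 4" by simp
    show "0 \<le> 2 * h * ((2 powr \<alpha> - 1) * h powr \<alpha>)" using h two by simp
  qed (use p in simp)
  also have "\<dots> \<le> \<bar>2 * h * ((2 powr \<alpha> - 1) * h powr \<alpha>) / (?a * ?b)\<bar>" by (rule abs_ge_self)
  finally show ?thesis unfolding eq .
qed

context z_solution
begin

text \<open>Exponentials are linearised and U at t1 and N are frozen at frequency 0; every error
  then carries two factors |\<xi>|, one from m and one from either the next order of the exponential
  or a Lipschitz bound. The symbol itself is not expanded, so all of its singular behaviour stays in
  the term m K.\<close>

lemma expansion_at_0:
  assumes t: "0 \<le> t1" "t1 \<le> t2" "t2 \<le> T" and w: "u t1 \<in> Zspace s (3/2 + \<alpha>)"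
  defines "K \<equiv> complex_of_real (t2 - t1) * U t1 0 + integral {t1..t2} (\<lambda>\<tau>. N \<tau> 0)"
  shows "\<exists>C\<ge>0. \<forall>\<xi>. norm (U t2 \<xi> - U t1 \<xi> - m \<xi> * K) \<le> C * \<xi>\<^sup>2"
proof -
  define \<Delta> where "\<Delta> = t2 - t1"
  have \<Delta>: "\<Delta> \<ge> 0" using t by (simp add: \<Delta>_def)
  have t1: "t1 \<in> {0..T}" using t by auto
  define P where "P = (\<integral>x. \<bar>u t1 x\<bar> \<partial>lborel)"
  define Q where "Q = (\<integral>x. \<bar>x\<bar> * \<bar>u t1 x\<bar> \<partial>lborel)"
  note i1 = integrable_Zspace[OF s r Zspace[OF t1]]
  have PQ: "P \<ge> 0" "Q \<ge> 0" by (auto simp: P_def Q_def)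
  have UP: "norm (U t1 \<xi>) \<le> P" for \<xi> unfolding P_def by (rule norm_fourier_le)
  have UQ: "norm (U t1 \<xi> - U t1 0) \<le> \<bar>\<xi>\<bar> * Q" for \<xi>
    using fourier_lipschitz[OF i1 integrable_abs_mult_of_weight[OF alpha(1) i1 ZspaceD(4)[OF w]], of \<xi> 0]
    by (simp add: Q_def)
  have m: "norm (m \<xi>) \<le> \<bar>\<xi>\<bar>" for \<xi> by (rule norm_symbolA_le)
  have term1: "norm ((exp (complex_of_real \<Delta> * m \<xi>) - 1) * U t1 \<xi> - m \<xi> * (complex_of_real \<Delta> * U t1 0)) \<le> (\<Delta>\<^sup>2 * P + \<Delta> * Q) * \<xi>\<^sup>2" for \<xi>
  proof -
    let ?z = "complex_of_real \<Delta> * m \<xi>"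
    have z: "norm ?z \<le> \<Delta> * \<bar>\<xi>\<bar>" using m[of \<xi>] \<Delta> by (simp add: norm_mult mult_left_mono)
    have "(exp ?z - 1) * U t1 \<xi> - m \<xi> * (complex_of_real \<Delta> * U t1 0) = (exp ?z - 1 - ?z) * U t1 \<xi> + ?z * (U t1 \<xi> - U t1 0)"
      by (simp add: algebra_simps)
    also have "norm \<dots> \<le> norm (exp ?z - 1 - ?z) * norm (U t1 \<xi>) + norm ?z * norm (U t1 \<xi> - U t1 0)"
      by (rule order_trans[OF norm_triangle_ineq]) (simp only: norm_mult)
    also have "\<dots> \<le> (\<Delta> * \<bar>\<xi>\<bar>)\<^sup>2 * P + (\<Delta> * \<bar>\<xi>\<bar>) * (\<bar>\<xi>\<bar> * Q)"
    proof (intro add_mono mult_mono UP UQ z)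
      show "norm (exp ?z - 1 - ?z) \<le> (\<Delta> * \<bar>\<xi>\<bar>)\<^sup>2"
        using norm_exp_imag_approx(2)[of ?z] power_mono[OF z, of 2] by simp
    qed (use \<Delta> PQ in auto)
    also have "\<dots> = (\<Delta>\<^sup>2 * P + \<Delta> * Q) * \<xi>\<^sup>2"
      by (simp add: power_mult_distrib algebra_simps power2_eq_square[of "\<bar>\<xi>\<bar>", symmetric])
        (simp add: power2_eq_square)
    finally show ?thesis .
  qed
  have term2: "norm (integral {t1..t2} (\<lambda>\<tau>. E t2 \<tau> \<xi>) - m \<xi> * integral {t1..t2} (\<lambda>\<tau>. N \<tau> 0)) \<le> ((T + 1) * B\<^sup>2 * \<Delta>) * \<xi>\<^sup>2" for \<xi>
  proof -
    have cE: "continuous_on {t1..t2} (\<lambda>\<tau>. E t2 \<tau> \<xi>)"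
      by (rule continuous_on_subset[OF continuous_E_time]) (use t in auto)
    have c: "continuous_on {0..T} (\<lambda>\<tau>. (\<tau>, 0::real))" by (intro continuous_intros)
    have "continuous_on {0..T} (\<lambda>\<tau>. N \<tau> 0)"
      using continuous_on_compose2[OF continuous_N c] by (simp add: image_subset_iff)
    then have cN: "continuous_on {t1..t2} (\<lambda>\<tau>. N \<tau> 0)"
      by (rule continuous_on_subset) (use t in auto)
    have "integral {t1..t2} (\<lambda>\<tau>. E t2 \<tau> \<xi>) - m \<xi> * integral {t1..t2} (\<lambda>\<tau>. N \<tau> 0)
        = integral {t1..t2} (\<lambda>\<tau>. E t2 \<tau> \<xi> - m \<xi> * N \<tau> 0)"
      using cE cN by (subst integral_mult_right[symmetric], subst Henstock_Kurzweil_Integration.integral_diff)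
        (auto intro!: integrable_continuous_interval continuous_intros)
    also have "norm \<dots> \<le> ((T + 1) * B\<^sup>2 * \<xi>\<^sup>2) * (t2 - t1)"
    proof (rule integral_bound[OF t(2)])
      show "continuous_on {t1..t2} (\<lambda>\<tau>. E t2 \<tau> \<xi> - m \<xi> * N \<tau> 0)" using cE cN by (intro continuous_intros)
      fix \<tau> assume \<tau>: "\<tau> \<in> {t1..t2}"
      then have \<tau>': "\<tau> \<in> {0..T}" using t by auto
      let ?z = "complex_of_real (t2 - \<tau>) * m \<xi>"
      have z: "norm ?z \<le> T * \<bar>\<xi>\<bar>"
        using m[of \<xi>] \<tau> t unfolding norm_mult norm_of_real by (intro mult_mono) auto
      have "E t2 \<tau> \<xi> - m \<xi> * N \<tau> 0 = m \<xi> * ((exp ?z - 1) * N \<tau> \<xi> + (N \<tau> \<xi> - N \<tau> 0))"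
        by (simp add: E_def algebra_simps)
      also have "norm \<dots> \<le> norm (m \<xi>) * (norm (exp ?z - 1) * norm (N \<tau> \<xi>) + norm (N \<tau> \<xi> - N \<tau> 0))"
        unfolding norm_mult[of "m \<xi>"]
        by (intro mult_left_mono order_trans[OF norm_triangle_ineq]) (simp_all add: norm_mult)
      also have "\<dots> \<le> \<bar>\<xi>\<bar> * ((T * \<bar>\<xi>\<bar>) * B\<^sup>2 + \<bar>\<xi>\<bar> * B\<^sup>2)"
      proof (intro mult_mono add_mono m norm_N_le[OF \<tau>'])
        show "norm (exp ?z - 1) \<le> T * \<bar>\<xi>\<bar>" using norm_exp_imag_approx(1)[of ?z] z by simp
        show "norm (N \<tau> \<xi> - N \<tau> 0) \<le> \<bar>\<xi>\<bar> * B\<^sup>2" using norm_N_lipschitz[OF \<tau>', of \<xi> 0] by simp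
      qed (use t in auto)
      also have "\<dots> = (T + 1) * B\<^sup>2 * (\<bar>\<xi>\<bar> * \<bar>\<xi>\<bar>)" by (simp add: algebra_simps)
      also have "\<bar>\<xi>\<bar> * \<bar>\<xi>\<bar> = \<xi>\<^sup>2" by (simp add: power2_eq_square)
      finally show "norm (E t2 \<tau> \<xi> - m \<xi> * N \<tau> 0) \<le> (T + 1) * B\<^sup>2 * \<xi>\<^sup>2" .
    qed
    finally show ?thesis by (simp add: \<Delta>_def mult_ac)
  qed
  have "norm (U t2 \<xi> - U t1 \<xi> - m \<xi> * K) \<le> ((\<Delta>\<^sup>2 * P + \<Delta> * Q) + (T + 1) * B\<^sup>2 * \<Delta>) * \<xi>\<^sup>2" for \<xi>
  proof -
    have "U t2 \<xi> - U t1 \<xi> - m \<xi> * K =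
      ((exp (complex_of_real \<Delta> * m \<xi>) - 1) * U t1 \<xi> - m \<xi> * (complex_of_real \<Delta> * U t1 0)) +
      (integral {t1..t2} (\<lambda>\<tau>. E t2 \<tau> \<xi>) - m \<xi> * integral {t1..t2} (\<lambda>\<tau>. N \<tau> 0))"
      unfolding duhamel_between[OF t, of \<xi>] K_def \<Delta>_def by (simp add: algebra_simps)
    then show ?thesis
      using norm_triangle_ineq[of "(exp (complex_of_real \<Delta> * m \<xi>) - 1) * U t1 \<xi> - m \<xi> * (complex_of_real \<Delta> * U t1 0)"
          "integral {t1..t2} (\<lambda>\<tau>. E t2 \<tau> \<xi>) - m \<xi> * integral {t1..t2} (\<lambda>\<tau>. N \<tau> 0)"] term1[of \<xi>] term2[of \<xi>]
      by (simp add: distrib_right)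
  qed
  moreover have "0 \<le> (\<Delta>\<^sup>2 * P + \<Delta> * Q) + (T + 1) * B\<^sup>2 * \<Delta>" using \<Delta> PQ t by simp
  ultimately show ?thesis by blast
qed

lemma singular_coefficient_zero:
  assumes t: "0 \<le> t1" "t1 \<le> t2" "t2 \<le> T"
    and w1: "u t1 \<in> Zspace s (3/2 + \<alpha>)" and w2: "u t2 \<in> Zspace s (3/2 + \<alpha>)"
  shows "complex_of_real (t2 - t1) * U t1 0 + integral {t1..t2} (\<lambda>\<tau>. N \<tau> 0) = 0" (is "?K = 0")
proof -
  obtain C where C: "C \<ge> 0" "\<And>\<xi>. norm (U t2 \<xi> - U t1 \<xi> - m \<xi> * ?K) \<le> C * \<xi>\<^sup>2"
    using expansion_at_0[OF t w1] by blast
  define f where "f x = u t2 x - u t1 x" for x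
  have Zf: "f \<in> Zspace s (3/2 + \<alpha>)" unfolding f_def[abs_def] by (rule Zspace_diff(1)[OF w2 w1])
  have i: "integrable lborel (u t1)" "integrable lborel (u t2)"
    using t by (auto intro!: integrable_Zspace[OF s r Zspace])
  have fi: "integrable lborel f" unfolding f_def[abs_def] using i by simp
  have F: "fourier f \<xi> = U t2 \<xi> - U t1 \<xi>" for \<xi> unfolding f_def[abs_def] by (rule fourier_diff[OF i(2,1)])
  \<comment> \<open>Conservation of the mean: m(0) = 0, so the expansion at \<xi> = 0 is
    exact.\<close>
  have F0: "fourier f 0 = 0" using C(2)[of 0] by (simp add: F symbolA_eq)
  define c where "c = (2 powr \<alpha> - 1) / 2"
  have c: "c > 0" using alpha by (simp add: c_def)
  have "norm ?K * c \<le> 0"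
  proof (rule field_le_epsilon)
    fix e :: real assume e: "e > 0"
    obtain \<delta> where \<delta>: "\<delta> > 0" "\<And>h. 0 < h \<Longrightarrow> h < \<delta> \<Longrightarrow>
        norm (fourier f (2 * h) - 2 * fourier f h + fourier f 0) \<le> (e / 2) * h powr (1 + \<alpha>)"
      using second_difference_small[OF alpha fi ZspaceD(4)[OF Zf], of "e / 2"] e by auto
    \<comment> \<open>Small enough for the second-difference estimate, for the bound on the symbol,
      and for 6 C h^(1 - \<alpha>) \<le> e/2. The 6 collects the remainders at the two nodes: C
      (2h)^2 + 2 C h^2.\<close>
    define h where "h = min (min (\<delta> / 2) (1 / 2)) ((e / 2 / (6 * C + 1)) powr (1 / (1 - \<alpha>)))"
    have q: "e / 2 / (6 * C + 1) > 0" using e C(1) by (intro divide_pos_pos) auto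
    have h: "0 < h" "h < \<delta>" "h \<le> 1/2" using \<delta>(1) q unfolding h_def by (auto simp: powr_gt_zero min_less_iff_disj)
    have "h powr (1 - \<alpha>) \<le> ((e / 2 / (6 * C + 1)) powr (1 / (1 - \<alpha>))) powr (1 - \<alpha>)"
      using alpha h by (intro powr_mono2) (auto simp: h_def)
    also have "\<dots> = e / 2 / (6 * C + 1)"
    proof -
      have "(x powr (1 / (1 - \<alpha>))) powr (1 - \<alpha>) = x" if "x > 0" for x :: real
        using that alpha by (simp add: powr_powr)
      from this[OF q] show ?thesis .
    qed
    finally have hC: "h powr (1 - \<alpha>) \<le> e / 2 / (6 * C + 1)" .
    have "0 < 6 * C + 1" using C(1) by simp
    from hC[unfolded pos_le_divide_eq[OF this]] have "(6 * C + 1) * h powr (1 - \<alpha>) \<le> e / 2" by (simp only: mult.commute)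
    moreover have "6 * C * h powr (1 - \<alpha>) \<le> (6 * C + 1) * h powr (1 - \<alpha>)" by (intro mult_right_mono) auto
    ultimately have small: "6 * C * h powr (1 - \<alpha>) \<le> e / 2" by linarith
    have "(norm ?K * c) * h powr (1 + \<alpha>) = norm ?K * (c * h powr (1 + \<alpha>))" by simp
    also have "\<dots> \<le> norm ?K * norm (m (2 * h) - 2 * m h)"
      unfolding c_def by (intro mult_left_mono symbolA_second_difference[OF alpha(1) h(1,3)]) simp
    also have "\<dots> = norm ((m (2 * h) - 2 * m h) * ?K)" by (simp only: norm_mult mult.commute)
    \<comment> \<open>The second difference of m K is that of \<open>f\<close> minus that of the
      remainder in the expansion. The values at 0 vanish, so only the nodes h and 2h contribute
      remainders.\<close>
    also have "(m (2 * h) - 2 * m h) * ?K = (fourier f (2 * h) - 2 * fourier f h + fourier f 0)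
        - (fourier f (2 * h) - m (2 * h) * ?K) + 2 * (fourier f h - m h * ?K)"
      by (simp add: F0 algebra_simps)
    also have "norm \<dots> \<le> norm (fourier f (2 * h) - 2 * fourier f h + fourier f 0)
        + norm (fourier f (2 * h) - m (2 * h) * ?K) + 2 * norm (fourier f h - m h * ?K)"
    proof -
      have "norm (a - b + 2 * d) \<le> norm a + norm b + 2 * norm d" for a b d :: complex
        using norm_triangle_ineq[of "a - b" "2 * d"] norm_triangle_ineq4[of a b] by (simp add: norm_mult)
      then show ?thesis .
    qed
    also have "\<dots> \<le> (e / 2) * h powr (1 + \<alpha>) + C * (2 * h)\<^sup>2 + 2 * (C * h\<^sup>2)"
      using \<delta>(2)[OF h(1,2)] C(2)[of "2 * h"] C(2)[of h] unfolding F by linarith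
    also have "\<dots> = (e / 2) * h powr (1 + \<alpha>) + 6 * C * h\<^sup>2" by (simp add: power_mult_distrib)
    also have "h\<^sup>2 = h powr (1 - \<alpha>) * h powr (1 + \<alpha>)" using h by (simp add: powr_add[symmetric])
    also have "(e / 2) * h powr (1 + \<alpha>) + 6 * C * (h powr (1 - \<alpha>) * h powr (1 + \<alpha>))
        = (e / 2 + 6 * C * h powr (1 - \<alpha>)) * h powr (1 + \<alpha>)" by (simp add: algebra_simps)
    also have "\<dots> \<le> e * h powr (1 + \<alpha>)" using small by (intro mult_right_mono) auto
    finally show "norm ?K * c \<le> 0 + e" using h(1) by (simp add: powr_gt_zero)
  qed
  then have "norm ?K \<le> 0" using c by (simp only: mult_le_0_iff) auto
  then show ?thesis by simp
qed

end

section \<open>Conservation of energy\<close>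

text \<open>On the Fourier side \<open>\<integral> v (v\<^sup>2)' = 0\<close> is the vanishing of \<open>\<integral>\<integral> a V(a) V(b) V(c)\<close> over \<open>a + b + c = 0\<close>:
  by symmetry it equals the integrals with \<open>a\<close> replaced by \<open>b\<close> and by \<open>c\<close>, and the three add up to zero.\<close>

lemma trilinear_cancellation:
  fixes V :: "real \<Rightarrow> complex"
  assumes V1: "integrable lborel V" and V2: "square_integrable V"
    and xV: "square_integrable (\<lambda>x. complex_of_real x * V x)"
  shows "(\<integral>x. complex_of_real x * V x * (\<integral>y. V y * V (- x - y) \<partial>lborel) \<partial>lborel) = 0"
proof -
  note [measurable] = borel_measurable_integrable[OF V1]
  \<comment> \<open>The third frequency is eliminated by c = -x - y.\<close>
  define \<Phi> where "\<Phi> x y = V x * (V y * V (- x - y))" for x y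
  have sym: "\<Phi> x y = \<Phi> y x" for x y
  proof -
    have "- x - y = - y - x" by simp
    then show ?thesis unfolding \<Phi>_def by (simp only: mult_ac)
  qed
  have shift: "square_integrable (\<lambda>y. V (- x - y))" for x
  proof -
    have "integrable lborel (\<lambda>y. (norm (V (- x + - 1 * y)))\<^sup>2)"
      using lborel_integrable_real_affine[OF integrable_square_integrable[OF V2], of "-1" "- x"] by simp
    then show ?thesis by (simp add: square_integrable_def)
  qed
  have Lshift: "L2norm (\<lambda>y. V (- x - y)) = L2norm V" for x
    unfolding L2norm_def using lborel_integral_real_affine[of "-1" "\<lambda>y. (norm (V y))\<^sup>2" "- x"] by simp
  \<comment> \<open>For fixed x the inner integral is bounded by Cauchy-Schwarz, using that y V and
    V are in L2; integrability of V then handles the outer variable.\<close>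
  have i1: "integrable (lborel \<Otimes>\<^sub>M lborel) (\<lambda>(x, y). complex_of_real y * \<Phi> x y)"
  proof (rule lborel_pair.Fubini_integrable)
    show m: "(\<lambda>(x, y). complex_of_real y * \<Phi> x y) \<in> borel_measurable (lborel \<Otimes>\<^sub>M lborel)"
      unfolding \<Phi>_def by measurable
    have eq: "complex_of_real y * \<Phi> x y = V x * ((complex_of_real y * V y) * V (- x - y))" for x y
      by (simp add: \<Phi>_def mult_ac)
    show "AE x in lborel. integrable lborel (\<lambda>y. case (x, y) of (x, y) \<Rightarrow> complex_of_real y * \<Phi> x y)"
      unfolding split_conv eq by (intro AE_I2 integrable_mult_right square_integrable_mult xV shift)
    show "integrable lborel (\<lambda>x. \<integral>y. norm (case (x, y) of (x, y) \<Rightarrow> complex_of_real y * \<Phi> x y) \<partial>lborel)"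
    proof (rule Bochner_Integration.integrable_bound)
      let ?C = "L2norm (\<lambda>x. complex_of_real x * V x) * L2norm V"
      show "integrable lborel (\<lambda>x. ?C * norm (V x))" using V1 by simp
      show "(\<lambda>x. \<integral>y. norm (case (x, y) of (x, y) \<Rightarrow> complex_of_real y * \<Phi> x y) \<partial>lborel) \<in> borel_measurable lborel"
        by (rule lborel.borel_measurable_lebesgue_integral)
           (use measurable_compose[OF m borel_measurable_norm] in \<open>simp add: case_prod_beta'\<close>)
      have "(\<integral>y. norm (complex_of_real y * \<Phi> x y) \<partial>lborel) \<le> ?C * norm (V x)" for x
      proof -
        have "(\<integral>y. norm (complex_of_real y * \<Phi> x y) \<partial>lborel) = norm (V x) * (\<integral>y. norm (complex_of_real y * V y) * norm (V (- x - y)) \<partial>lborel)"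
          unfolding eq by (simp add: norm_mult)
        also have "\<dots> \<le> norm (V x) * ?C"
          using L2_Cauchy_Schwarz_norm[OF xV shift[of x]] unfolding Lshift by (intro mult_left_mono) auto
        finally show ?thesis by (simp only: mult.commute)
      qed
      then show "AE x in lborel. norm (\<integral>y. norm (case (x, y) of (x, y) \<Rightarrow> complex_of_real y * \<Phi> x y) \<partial>lborel) \<le> norm (?C * norm (V x))"
        by (intro AE_I2) (auto intro: order_trans[OF _ abs_ge_self])
    qed
  qed
  have i2: "integrable (lborel \<Otimes>\<^sub>M lborel) (\<lambda>(x, y). complex_of_real x * \<Phi> x y)"
    using lborel_pair.integrable_product_swap[OF i1] by (simp add: sym)
  let ?A = "\<integral>x. (\<integral>y. complex_of_real y * \<Phi> x y \<partial>lborel) \<partial>lborel"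
  let ?B = "\<integral>x. (\<integral>y. complex_of_real x * \<Phi> x y \<partial>lborel) \<partial>lborel"
  have AB: "?A = ?B"
    using lborel_pair.Fubini_integral[OF i1] by (simp add: sym)
  \<comment> \<open>The substitution of -x - y for y exchanges the second and third frequency and
    turns A into -B - A. Thus B = -2 A, while swapping the variables gives A = B, so both are
    0.\<close>
  have "AE x in lborel. (\<integral>y. complex_of_real x * \<Phi> x y \<partial>lborel) = - 2 * (\<integral>y. complex_of_real y * \<Phi> x y \<partial>lborel)"
    using lborel_pair.AE_integrable_fst[OF i1] lborel_pair.AE_integrable_fst[OF i2]
  proof eventually_elim
    case (elim x)
    have "(\<integral>y. complex_of_real y * \<Phi> x y \<partial>lborel) = (\<integral>y. complex_of_real (- x - y) * \<Phi> x (- x - y) \<partial>lborel)"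
      using lborel_integral_real_affine[of "-1" "\<lambda>y. complex_of_real y * \<Phi> x y" "- x"] by simp
    also have "\<dots> = (\<integral>y. - (complex_of_real x * \<Phi> x y) - complex_of_real y * \<Phi> x y \<partial>lborel)"
      by (intro Bochner_Integration.integral_cong) (auto simp: \<Phi>_def algebra_simps)
    also have "\<dots> = - (\<integral>y. complex_of_real x * \<Phi> x y \<partial>lborel) - (\<integral>y. complex_of_real y * \<Phi> x y \<partial>lborel)"
      using elim by (subst Bochner_Integration.integral_diff) auto
    finally show ?case by (simp add: algebra_simps)
  qed
  then have "?B = (\<integral>x. - 2 * (\<integral>y. complex_of_real y * \<Phi> x y \<partial>lborel) \<partial>lborel)"
    using borel_measurable_integrable[OF lborel_pair.integrable_fst[OF i1]]
      borel_measurable_integrable[OF lborel_pair.integrable_fst[OF i2]]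
    by (intro integral_cong_AE) (auto intro!: borel_measurable_times borel_measurable_const)
  then have "?B = - 2 * ?A" by (simp only: integral_mult_right_zero)
  then have "?B = 0" using AB by (simp add: eq_neg_iff_add_eq_0)
  moreover have "?B = (\<integral>x. complex_of_real x * V x * (\<integral>y. V y * V (- x - y) \<partial>lborel) \<partial>lborel)"
    unfolding \<Phi>_def mult.assoc[symmetric] by (simp add: mult.assoc)
  ultimately show ?thesis by simp
qed

context z_solution
begin

text \<open>Replacing \<xi> by -\<xi> turns the conjugate of U into U, because u is real, and N into
  a convolution whose three frequencies sum to 0.\<close>

lemma nonlinear_energy_zero:
  assumes t: "t \<in> {0..T}"
  shows "(\<integral>\<xi>. complex_of_real \<xi> * (cnj (U t \<xi>) * N t \<xi>) \<partial>lborel) = 0"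
proof -
  note Z = Zspace[OF t]
  have "(\<integral>\<xi>. complex_of_real \<xi> * (cnj (U t \<xi>) * N t \<xi>) \<partial>lborel)
      = (\<integral>\<xi>. complex_of_real (- \<xi>) * (cnj (U t (- \<xi>)) * N t (- \<xi>)) \<partial>lborel)"
    using lborel_integral_real_affine[of "-1" "\<lambda>\<xi>. complex_of_real \<xi> * (cnj (U t \<xi>) * N t \<xi>)" 0] by simp
  also have "\<dots> = (\<integral>\<xi>. complex_of_real (- 1 / (2 * pi)) * (complex_of_real \<xi> * U t \<xi> * (\<integral>\<eta>. U t \<eta> * U t (- \<xi> - \<eta>) \<partial>lborel)) \<partial>lborel)"
    by (intro Bochner_Integration.integral_cong) (auto simp: fourier_uminus[of "u t"] fourier_square_convolution[OF s r Z])
  also have "\<dots> = complex_of_real (- 1 / (2 * pi)) * (\<integral>\<xi>. complex_of_real \<xi> * U t \<xi> * (\<integral>\<eta>. U t \<eta> * U t (- \<xi> - \<eta>) \<partial>lborel) \<partial>lborel)"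
    by (rule integral_mult_right_zero)
  also have "\<dots> = 0"
    using trilinear_cancellation[OF integrable_fourier[OF s r Z] square_integrable_fourier[OF s r Z] square_integrable_xi_fourier[OF s r Z]]
    by simp
  finally show ?thesis .
qed

text \<open>At fixed \<xi> Duhamel's formula is an ordinary differential equation. Removing the
  unimodular propagator leaves Y with derivative g and |Y| = |U|, so |U|^2 is recovered by the
  fundamental theorem of calculus. The weight 1 + |\<xi>|^\<alpha> cancels the denominator of m and
  leaves -\<i> \<xi>, the derivative in the trilinear identity.\<close>

lemma energy_density:
  assumes t: "0 \<le> t1" "t1 \<le> t" "t \<le> T" and zero: "U t1 \<xi> = 0"
  shows "complex_of_real ((1 + \<bar>\<xi>\<bar> powr \<alpha>) * (norm (U t \<xi>))\<^sup>2) =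
    of_real (Re (LINT \<tau>:{t1..t}|lborel. - 2 * \<i> * (complex_of_real \<xi> * (cnj (U \<tau> \<xi>) * N \<tau> \<xi>))))"
proof -
  let ?G = "\<lambda>\<tau>. - 2 * \<i> * (complex_of_real \<xi> * (cnj (U \<tau> \<xi>) * N \<tau> \<xi>))"
  have c: "continuous_on {t1..t} (\<lambda>\<tau>. (\<tau>, \<xi>))" by (intro continuous_intros)
  have "continuous_on {t1..t} (\<lambda>\<tau>. U \<tau> \<xi>)" "continuous_on {t1..t} (\<lambda>\<tau>. N \<tau> \<xi>)"
    using continuous_on_compose2[OF continuous_U c] continuous_on_compose2[OF continuous_N c] t
    by (simp_all add: image_subset_iff)
  then have cG: "continuous_on {t1..t} ?G" by (intro continuous_intros)
  \<comment> \<open>Taking 0 as the final time in \<open>E\<close> undoes the propagation, giving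
    exp(-\<tau> m) m N.\<close>
  define g where "g \<tau> = E 0 \<tau> \<xi>" for \<tau>
  define Y where "Y \<tau> = integral {t1..\<tau>} g" for \<tau>
  have cg: "continuous_on {t1..t} g"
    unfolding g_def by (rule continuous_on_subset[OF continuous_E_time]) (use t in auto)
  have UY: "U \<tau> \<xi> = exp (complex_of_real \<tau> * m \<xi>) * Y \<tau>" if \<tau>: "\<tau> \<in> {t1..t}" for \<tau>
  proof -
    have E: "E \<tau> \<sigma> \<xi> = exp (complex_of_real \<tau> * m \<xi>) * g \<sigma>" for \<sigma>
    proof -
      have "complex_of_real (\<tau> - \<sigma>) * m \<xi> = complex_of_real \<tau> * m \<xi> + complex_of_real (0 - \<sigma>) * m \<xi>"
        by (simp add: algebra_simps)
      then show ?thesis by (simp only: E_def g_def exp_add mult.assoc)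
    qed
    have "U \<tau> \<xi> = integral {t1..\<tau>} (\<lambda>\<sigma>. E \<tau> \<sigma> \<xi>)"
      using duhamel_between[of t1 \<tau> \<xi>] \<tau> t zero by simp
    then show ?thesis by (simp only: E Y_def integral_mult_right)
  qed
  have dY: "(Y has_vector_derivative g \<tau>) (at \<tau> within {t1..t})" if "\<tau> \<in> {t1..t}" for \<tau>
    unfolding Y_def[abs_def] by (rule integral_has_vector_derivative[OF cg that])
  have "((\<lambda>\<tau>. Y \<tau> \<bullet> g \<tau> + g \<tau> \<bullet> Y \<tau>) has_integral (Y t \<bullet> Y t - Y t1 \<bullet> Y t1)) {t1..t}"
  proof (rule fundamental_theorem_of_calculus[OF t(2)])
    fix \<tau> assume "\<tau> \<in> {t1..t}"
    from bounded_bilinear.has_vector_derivative[OF bounded_bilinear_inner dY[OF this] dY[OF this]]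
    show "((\<lambda>\<tau>. Y \<tau> \<bullet> Y \<tau>) has_vector_derivative Y \<tau> \<bullet> g \<tau> + g \<tau> \<bullet> Y \<tau>) (at \<tau> within {t1..t})" .
  qed
  moreover have "Y t1 = 0" by (simp add: Y_def)
  moreover have "Y t \<bullet> Y t = (norm (U t \<xi>))\<^sup>2"
    using UY[of t] t by (simp add: norm_mult power2_norm_eq_inner)
  ultimately have "((\<lambda>\<tau>. 2 * (Y \<tau> \<bullet> g \<tau>)) has_integral (norm (U t \<xi>))\<^sup>2) {t1..t}"
    by (simp add: inner_commute[of "g _"])
  then have "integral {t1..t} (\<lambda>\<tau>. 2 * (Y \<tau> \<bullet> g \<tau>)) = (norm (U t \<xi>))\<^sup>2"
    by (rule integral_unique)
  then have "(1 + \<bar>\<xi>\<bar> powr \<alpha>) * (norm (U t \<xi>))\<^sup>2 = integral {t1..t} (\<lambda>\<tau>. (1 + \<bar>\<xi>\<bar> powr \<alpha>) * (2 * (Y \<tau> \<bullet> g \<tau>)))"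
    by simp
  also have "\<dots> = integral {t1..t} (\<lambda>\<tau>. Re (- 2 * \<i> * (complex_of_real \<xi> * (cnj (U \<tau> \<xi>) * N \<tau> \<xi>))))"
  proof (rule Henstock_Kurzweil_Integration.integral_cong)
    fix \<tau> assume \<tau>: "\<tau> \<in> {t1..t}"
    have "cnj (U \<tau> \<xi>) = exp (complex_of_real (0 - \<tau>) * m \<xi>) * cnj (Y \<tau>)"
      by (simp add: UY[OF \<tau>] exp_cnj cnj_symbolA)
    then have "cnj (U \<tau> \<xi>) * (m \<xi> * N \<tau> \<xi>) = cnj (Y \<tau>) * g \<tau>"
      by (simp add: g_def E_def)
    moreover have "complex_of_real (1 + \<bar>\<xi>\<bar> powr \<alpha>) * m \<xi> = - (\<i> * complex_of_real \<xi>)"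
      using one_plus_powr_pos[of \<xi> \<alpha>] unfolding symbolA_def
      by (metis less_irrefl nonzero_mult_div_cancel_left of_real_eq_0_iff times_divide_eq_right)
    moreover have "complex_of_real (1 + \<bar>\<xi>\<bar> powr \<alpha>) * (cnj (U \<tau> \<xi>) * (m \<xi> * N \<tau> \<xi>)) = (complex_of_real (1 + \<bar>\<xi>\<bar> powr \<alpha>) * m \<xi>) * (cnj (U \<tau> \<xi>) * N \<tau> \<xi>)"
      by (simp only: mult_ac)
    ultimately have "complex_of_real (1 + \<bar>\<xi>\<bar> powr \<alpha>) * (cnj (Y \<tau>) * g \<tau>) = - (\<i> * complex_of_real \<xi>) * (cnj (U \<tau> \<xi>) * N \<tau> \<xi>)"
      by (simp only:)
    then have "complex_of_real (2 * (1 + \<bar>\<xi>\<bar> powr \<alpha>)) * (cnj (Y \<tau>) * g \<tau>) = - 2 * \<i> * (complex_of_real \<xi> * (cnj (U \<tau> \<xi>) * N \<tau> \<xi>))"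
      by (simp only: of_real_mult mult.assoc) simp
    moreover have "Re (complex_of_real a * z) = a * Re z" for a z by simp
    ultimately have "Re (- 2 * \<i> * (complex_of_real \<xi> * (cnj (U \<tau> \<xi>) * N \<tau> \<xi>))) = 2 * (1 + \<bar>\<xi>\<bar> powr \<alpha>) * Re (cnj (Y \<tau>) * g \<tau>)"
      by metis
    moreover have "Y \<tau> \<bullet> g \<tau> = Re (cnj (Y \<tau>) * g \<tau>)" by (simp add: inner_complex_def)
    ultimately show "(1 + \<bar>\<xi>\<bar> powr \<alpha>) * (2 * (Y \<tau> \<bullet> g \<tau>)) = Re (- 2 * \<i> * (complex_of_real \<xi> * (cnj (U \<tau> \<xi>) * N \<tau> \<xi>)))"
      by (simp only: mult_ac)
  qed
  also have "\<dots> = Re (integral {t1..t} ?G)"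
    using integral_linear[OF integrable_continuous_interval[OF cG] bounded_linear_Re] by (simp add: o_def)
  also have "integral {t1..t} ?G = (LINT \<tau>:{t1..t}|lborel. ?G \<tau>)"
    by (rule set_borel_integral_eq_integral(2)[OF borel_integrable_atLeastAtMost'[OF cG], symmetric])
  finally show ?thesis by (simp only:)
qed

text \<open>Integrate \<open>energy_density\<close> over \<xi> and exchange the integrals: at each
  time the integral over \<xi> vanishes by \<open>nonlinear_energy_zero\<close>. Fubini also
  supplies the integrability of the energy density at time t. A nonnegative density with zero
  integral forces U = 0 almost everywhere.\<close>

lemma zero_preserved:
  assumes t: "0 \<le> t1" "t1 \<le> t" "t \<le> T" and zero: "AE x in lborel. u t1 x = 0"
  shows "AE x in lborel. u t x = 0"
proof -
  have tT: "t \<in> {0..T}" and t1T: "t1 \<in> {0..T}" using t by auto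
  note Z = Zspace[OF tT] and Z1 = Zspace[OF t1T]
  have U1: "U t1 \<xi> = 0" for \<xi>
  proof -
    note [measurable] = ZspaceD(2)[OF Z1]
    have "U t1 \<xi> = integral\<^sup>L lborel (\<lambda>x::real. 0)"
      unfolding fourier_def using zero by (intro integral_cong_AE) auto
    then show ?thesis by simp
  qed
  let ?G = "\<lambda>\<tau> \<xi>. - 2 * \<i> * (complex_of_real \<xi> * (cnj (U \<tau> \<xi>) * N \<tau> \<xi>))"
  let ?e = "\<lambda>\<xi>. (1 + \<bar>\<xi>\<bar> powr \<alpha>) * (norm (U t \<xi>))\<^sup>2"
  have Nsq: "square_integrable (N \<tau>)" and NL: "L2norm (N \<tau>) \<le> sqrt (2 * pi) * B\<^sup>2" if \<tau>: "\<tau> \<in> {0..T}" for \<tau>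
  proof -
    note Z' = Zspace[OF \<tau>]
    note sq = square_integrable_square[OF s r Z']
    note m = fourier_L2_measurable[OF sq] fourier_measurable[OF integrable_square[OF s r Z']]
    show "square_integrable (N \<tau>)"
      by (rule square_integrable_cong_AE[OF square_integrable_fourier_L2[OF sq] fourier_L2_square[OF s r Z'] m(2)])
    have "L2norm (N \<tau>) = sqrt (2 * pi) * L2norm (\<lambda>x. (u \<tau> x)\<^sup>2)"
      unfolding L2norm_fourier_L2[OF sq, symmetric] by (rule L2norm_cong_AE[OF m fourier_L2_square[OF s r Z'], symmetric])
    also have "\<dots> \<le> sqrt (2 * pi) * B\<^sup>2"
      using L2norm_square_le[OF s r Z'] power_mono[OF Znorm_le_B[OF \<tau>] Znorm_nonneg, of 2]
      by (intro mult_left_mono) auto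
    finally show "L2norm (N \<tau>) \<le> sqrt (2 * pi) * B\<^sup>2" .
  qed
  have G_eq: "?G \<tau> \<xi> = (- 2 * \<i>) * (cnj (complex_of_real \<xi> * U \<tau> \<xi>) * N \<tau> \<xi>)" for \<tau> \<xi> by simp
  have Gint: "integrable lborel (?G \<tau>)" and Gbd: "(\<integral>\<xi>. norm (?G \<tau> \<xi>) \<partial>lborel) \<le> 2 * (B * (sqrt (2 * pi) * B\<^sup>2))"
    if \<tau>: "\<tau> \<in> {0..T}" for \<tau>
  proof -
    note Z' = Zspace[OF \<tau>]
    note xU = square_integrable_xi_fourier[OF s r Z'] and cxU = square_integrable_cnj[OF square_integrable_xi_fourier[OF s r Z']]
    show "integrable lborel (?G \<tau>)"
      unfolding G_eq by (intro integrable_mult_right square_integrable_mult[OF cxU Nsq[OF \<tau>]])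
    have "(\<integral>\<xi>. norm (?G \<tau> \<xi>) \<partial>lborel) = 2 * (\<integral>\<xi>. norm (cnj (complex_of_real \<xi> * U \<tau> \<xi>)) * norm (N \<tau> \<xi>) \<partial>lborel)"
      unfolding G_eq by (simp add: norm_mult)
    also have "\<dots> \<le> 2 * (L2norm (\<lambda>\<xi>. cnj (complex_of_real \<xi> * U \<tau> \<xi>)) * L2norm (N \<tau>))"
      by (intro mult_left_mono L2_Cauchy_Schwarz_norm cxU Nsq[OF \<tau>]) simp
    also have "L2norm (\<lambda>\<xi>. cnj (complex_of_real \<xi> * U \<tau> \<xi>)) = L2norm (\<lambda>\<xi>. complex_of_real \<xi> * U \<tau> \<xi>)"
      by (rule L2norm_cong_norm) (rule complex_mod_cnj)
    also have "2 * (L2norm (\<lambda>\<xi>. complex_of_real \<xi> * U \<tau> \<xi>) * L2norm (N \<tau>)) \<le> 2 * (B * (sqrt (2 * pi) * B\<^sup>2))"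
      using L2norm_xi_fourier_le[OF s r Z'] Znorm_le_B[OF \<tau>] NL[OF \<tau>] B_nonneg
      by (intro mult_left_mono mult_mono) auto
    finally show "(\<integral>\<xi>. norm (?G \<tau> \<xi>) \<partial>lborel) \<le> 2 * (B * (sqrt (2 * pi) * B\<^sup>2))" .
  qed
  have "continuous_on ({t1..t} \<times> UNIV) (\<lambda>p. ?G (fst p) (snd p))"
    using t by (intro continuous_intros continuous_on_subset[OF continuous_U] continuous_on_subset[OF continuous_N]) auto
  from strip_Fubini[OF strip_measurable[OF this], of "2 * (B * (sqrt (2 * pi) * B\<^sup>2))"]
  have F: "(LINT \<tau>:{t1..t}|lborel. (\<integral>\<xi>. ?G \<tau> \<xi> \<partial>lborel)) = (\<integral>\<xi>. (LINT \<tau>:{t1..t}|lborel. ?G \<tau> \<xi>) \<partial>lborel)"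
    and Fi: "integrable lborel (\<lambda>\<xi>. LINT \<tau>:{t1..t}|lborel. ?G \<tau> \<xi>)"
    using Gint Gbd t by auto
  have "(\<integral>\<xi>. ?G \<tau> \<xi> \<partial>lborel) = 0" if "\<tau> \<in> {t1..t}" for \<tau>
    using nonlinear_energy_zero[of \<tau>] that t by (simp only: integral_mult_right_zero) simp
  then have "(LINT \<tau>:{t1..t}|lborel. (\<integral>\<xi>. ?G \<tau> \<xi> \<partial>lborel)) = (LINT \<tau>:{t1..t}|lborel. 0)"
    by (intro set_lebesgue_integral_cong) auto
  then have 0: "(\<integral>\<xi>. (LINT \<tau>:{t1..t}|lborel. ?G \<tau> \<xi>) \<partial>lborel) = 0"
    unfolding F by (simp add: set_lebesgue_integral_def)
  have e: "?e \<xi> = Re (LINT \<tau>:{t1..t}|lborel. ?G \<tau> \<xi>)" for \<xi>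
    using energy_density[OF t U1, of \<xi>] unfolding of_real_eq_iff .
  have "(\<integral>\<xi>. ?e \<xi> \<partial>lborel) = 0" and "integrable lborel ?e"
    unfolding e using integral_Re[OF Fi] 0 integrable_Re[OF Fi] by simp_all
  then have "AE \<xi> in lborel. ?e \<xi> = 0"
    using integral_nonneg_eq_0_iff_AE[of lborel ?e] one_plus_powr_pos[of _ \<alpha>] by (simp add: less_imp_le)
  then have U0: "AE \<xi> in lborel. U t \<xi> = 0"
    by eventually_elim (use one_plus_powr_pos[of _ \<alpha>] in \<open>simp add: less_imp_neq[symmetric]\<close>)
  note sq = ZspaceD(1)[OF Z]
  have "L2norm (fourier_L2 (u t)) = L2norm (\<lambda>x::real. 0::complex)"
    by (rule L2norm_cong_AE[OF fourier_L2_measurable[OF sq]])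
       (use U0 fourier_L2_Zspace[OF s r Z] in \<open>auto elim: eventually_elim2\<close>)
  then have "L2norm (u t) = 0" using L2norm_fourier_L2[OF sq] by simp
  then show ?thesis by (rule L2norm_eq_0[OF sq])
qed

text \<open>At frequency 0 the transforms are the integrals of u and u^2, so the vanishing complex
  coefficient is an identity between real numbers.\<close>

lemma mean_identity:
  assumes t: "0 \<le> t1" "t1 \<le> t2" "t2 \<le> T"
    and w: "u t1 \<in> Zspace s (3/2 + \<alpha>)" "u t2 \<in> Zspace s (3/2 + \<alpha>)"
  shows "continuous_on {t1..t2} (\<lambda>\<tau>. \<integral>x. (u \<tau> x)\<^sup>2 \<partial>lborel)"
    and "(t2 - t1) * (\<integral>x. u t1 x \<partial>lborel) + integral {t1..t2} (\<lambda>\<tau>. \<integral>x. (u \<tau> x)\<^sup>2 \<partial>lborel) = 0"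
proof -
  let ?P = "\<lambda>\<tau>. \<integral>x. (u \<tau> x)\<^sup>2 \<partial>lborel"
  have f0: "fourier f 0 = complex_of_real (\<integral>x. f x \<partial>lborel)" for f by (simp add: fourier_def)
  have c: "continuous_on {t1..t2} (\<lambda>\<tau>. (\<tau>, 0::real))" by (intro continuous_intros)
  have "continuous_on {t1..t2} (\<lambda>\<tau>. N \<tau> 0)"
    using continuous_on_compose2[OF continuous_N c] t by (simp add: image_subset_iff)
  then have cN: "continuous_on {t1..t2} (\<lambda>\<tau>. complex_of_real (?P \<tau>))" by (simp only: f0)
  from continuous_on_Re[OF this] show cP: "continuous_on {t1..t2} ?P" by simp
  have "integral {t1..t2} (\<lambda>\<tau>. N \<tau> 0) = complex_of_real (integral {t1..t2} ?P)"
    using integral_linear[OF integrable_continuous_interval[OF cP] bounded_linear_of_real[where 'a = complex]]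
    by (simp add: f0 o_def)
  then have "complex_of_real ((t2 - t1) * (\<integral>x. u t1 x \<partial>lborel) + integral {t1..t2} ?P) = 0"
    using singular_coefficient_zero[OF t w] by (simp add: f0)
  then show "(t2 - t1) * (\<integral>x. u t1 x \<partial>lborel) + integral {t1..t2} ?P = 0"
    by (simp only: of_real_eq_0_iff)
qed

end

section \<open>Extension by zero\<close>

lemma Zspace_AE_zero:
  assumes f: "f \<in> borel_measurable borel" and ae: "AE x in lborel. f x = 0"
  shows "f \<in> Zspace s r" "Znorm s r f = 0"
proof -
  note [measurable] = f
  have sq: "square_integrable f"
    by (rule square_integrable_cong_AE[OF square_integrable_zero _ f]) (use ae in \<open>auto elim!: eventually_mono\<close>)
  have L: "L2norm h = 0" if "h \<in> borel_measurable borel" "AE x in lborel. h x = 0"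
    for h :: "real \<Rightarrow> 'b::{real_normed_field,banach,second_countable_topology}"
    using L2norm_cong_AE[OF that(1) _ that(2)] by simp
  have "L2norm (fourier_L2 f) = 0" using L[OF f ae] by (simp add: L2norm_fourier_L2[OF sq])
  then have F: "AE \<xi> in lborel. fourier_L2 f \<xi> = 0" by (rule L2norm_eq_0[OF square_integrable_fourier_L2[OF sq]])
  note [measurable] = fourier_L2_measurable[OF sq]
  have w: "(\<lambda>\<xi>. complex_of_real ((1 + \<xi>\<^sup>2) powr (s/2)) * fourier_L2 f \<xi>) \<in> borel_measurable borel" by measurable
  have wF: "AE \<xi> in lborel. complex_of_real ((1 + \<xi>\<^sup>2) powr (s/2)) * fourier_L2 f \<xi> = 0" using F by eventually_elim simp
  have v: "(\<lambda>x. \<bar>x\<bar> powr r * f x) \<in> borel_measurable borel" by measurable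
  have vf: "AE x in lborel. \<bar>x\<bar> powr r * f x = 0" using ae by eventually_elim simp
  have "square_integrable (\<lambda>\<xi>. complex_of_real ((1 + \<xi>\<^sup>2) powr (s/2)) * fourier_L2 f \<xi>)"
    by (rule square_integrable_cong_AE[OF square_integrable_zero _ w]) (use wF in \<open>auto elim!: eventually_mono\<close>)
  moreover have "square_integrable (\<lambda>x. \<bar>x\<bar> powr r * f x)"
    by (rule square_integrable_cong_AE[OF square_integrable_zero _ v]) (use vf in \<open>auto elim!: eventually_mono\<close>)
  ultimately show "f \<in> Zspace s r" using sq by (simp add: Zspace_def Sobolev_def)
  show "Znorm s r f = 0" using L[OF w wF] L[OF v vf] by (simp add: Znorm_def Sobolev_norm_def)
qed

lemma L2norm_zero_AE:
  fixes f :: "real \<Rightarrow> real"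
  assumes "square_integrable f" "AE x in lborel. f x = 0" shows "L2norm f = 0"
  using L2norm_cong_AE[OF borel_measurable_square_integrable[OF assms(1)] _ assms(2)] by simp

text \<open>\<open>opA\<close> is defined by a choice of representative, so even on the zero
  function its value is known only almost everywhere.\<close>

lemma opA_zero:
  assumes \<alpha>: "\<alpha> > 0"
  shows "square_integrable (opA \<alpha> (\<lambda>x. 0))" "AE x in lborel. opA \<alpha> (\<lambda>x. 0) x = 0"
proof -
  have z: "square_integrable (\<lambda>x::real. 0::real)" by simp
  have "L2norm (fourier_L2 (\<lambda>x. 0)) = 0" by (simp add: L2norm_fourier_L2[OF z])
  from L2norm_eq_0[OF square_integrable_fourier_L2[OF z] this]
  have F: "AE \<xi> in lborel. fourier_L2 (\<lambda>x. 0) \<xi> = 0" .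
  note [measurable] = fourier_L2_measurable[OF z]
  have "square_integrable (\<lambda>\<xi>. complex_of_real \<xi> * fourier_L2 (\<lambda>x. 0) \<xi>)"
    by (rule square_integrable_cong_AE[OF square_integrable_zero]) (use F in \<open>auto elim!: eventually_mono\<close>)
  note A = opA_spec[OF \<alpha> z this]
  show sq: "square_integrable (opA \<alpha> (\<lambda>x. 0))" by (rule A(1))
  have "L2norm (fourier_L2 (opA \<alpha> (\<lambda>x. 0))) = L2norm (\<lambda>x::real. 0::complex)"
    by (rule L2norm_cong_AE[OF fourier_L2_measurable[OF sq]]) (use F A(2) in \<open>auto elim: eventually_elim2\<close>)
  then have "L2norm (opA \<alpha> (\<lambda>x. 0)) = 0" by (simp add: L2norm_fourier_L2[OF sq])
  then show "AE x in lborel. opA \<alpha> (\<lambda>x. 0) x = 0" by (rule L2norm_eq_0[OF sq])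
qed

lemma groupA_AE_zero:
  assumes \<alpha>: "\<alpha> > 0" and f: "square_integrable f" "AE x in lborel. f x = 0"
  shows "AE x in lborel. groupA \<alpha> t f x = 0"
proof -
  have "L2norm (groupA \<alpha> t f) = 0" unfolding L2norm_groupA[OF \<alpha> f(1)] by (rule L2norm_zero_AE[OF f])
  then show ?thesis by (rule L2norm_eq_0[OF groupA_spec(1)[OF \<alpha> f(1)]])
qed

lemma has_L2_integral_cong:
  assumes "has_L2_integral F w S" "\<And>\<tau>. \<tau> \<in> S \<Longrightarrow> F \<tau> = G \<tau>"
  shows "has_L2_integral G w S"
proof -
  have c: "set_integrable lborel S f = set_integrable lborel S g \<and> set_lebesgue_integral lborel S f = set_lebesgue_integral lborel S g"
    if "\<And>\<tau>. \<tau> \<in> S \<Longrightarrow> f \<tau> = g \<tau>" for f g :: "real \<Rightarrow> real"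
  proof -
    have "(\<lambda>\<tau>. indicator S \<tau> *\<^sub>R f \<tau>) = (\<lambda>\<tau>. indicator S \<tau> *\<^sub>R g \<tau>)" using that by (auto simp: indicator_def fun_eq_iff)
    then show ?thesis by (simp add: set_integrable_def set_lebesgue_integral_def)
  qed
  have "set_integrable lborel S (\<lambda>\<tau>. L2norm (F \<tau>)) = set_integrable lborel S (\<lambda>\<tau>. L2norm (G \<tau>))"
    using c[of "\<lambda>\<tau>. L2norm (F \<tau>)" "\<lambda>\<tau>. L2norm (G \<tau>)"] assms(2) by simp
  moreover have "set_integrable lborel S (\<lambda>\<tau>. \<integral>x. F \<tau> x * g x \<partial>lborel) = set_integrable lborel S (\<lambda>\<tau>. \<integral>x. G \<tau> x * g x \<partial>lborel)"
    "(LINT \<tau>:S|lborel. (\<integral>x. F \<tau> x * g x \<partial>lborel)) = (LINT \<tau>:S|lborel. (\<integral>x. G \<tau> x * g x \<partial>lborel))" for g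
    using c[of "\<lambda>\<tau>. \<integral>x. F \<tau> x * g x \<partial>lborel" "\<lambda>\<tau>. \<integral>x. G \<tau> x * g x \<partial>lborel"] assms(2) by simp_all
  ultimately show ?thesis using assms unfolding has_L2_integral_def by simp
qed

context z_solution
begin

text \<open>Before T nothing changes. After T the integrand vanishes almost everywhere in x, so the
  integral up to t must be the integral up to T propagated by t - T; since u(T) = 0, this is -exp(t
  A) u(0).\<close>

lemma extension_by_zero:
  assumes t: "0 \<le> t1" "t1 < T" and zero: "AE x in lborel. u t1 x = 0"
  defines "v \<equiv> \<lambda>t. if t \<le> T then u t else (\<lambda>x. 0)"
  shows "Z_solution \<alpha> s r {0..} v" "\<forall>t\<ge>t1. AE x in lborel. v t x = 0"
proof -
  show v0: "\<forall>t\<ge>t1. AE x in lborel. v t x = 0"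
    using zero_preserved[OF t(1) _ _ zero] by (auto simp: v_def)
  have vT: "v t = u t" if "t \<le> T" for t using that by (simp add: v_def)
  have vZ: "v t \<in> Zspace s r" if "t \<ge> 0" for t
    using that Zspace[of t] Zspace_AE_zero(1)[of "\<lambda>x. 0" s r] by (auto simp: v_def)
  have cont: "continuous_into_Z s r {0..} v"
    unfolding continuous_into_Z_def
  proof (intro conjI ballI)
    show "v t \<in> Zspace s r" if "t \<in> {0..}" for t using vZ that by simp
    fix t0 :: real assume t0: "t0 \<in> {0..}"
    show "((\<lambda>t. Znorm s r (\<lambda>x. v t x - v t0 x)) \<longlongrightarrow> 0) (at t0 within {0..})"
    proof (cases "t0 < T")
      case True
      have "at t0 within {0..} = at t0 within {0..T}"
        by (rule at_within_nhd[of t0 "{..<T}"]) (use True in auto)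
      moreover have "((\<lambda>t. Znorm s r (\<lambda>x. v t x - v t0 x)) \<longlongrightarrow> 0) (at t0 within {0..T})"
      proof (rule Lim_transform_eventually[OF Znorm_tendsto])
        show "t0 \<in> {0..T}" using True t0 by auto
        show "\<forall>\<^sub>F t in at t0 within {0..T}. Znorm s r (\<lambda>x. u t x - u t0 x) = Znorm s r (\<lambda>x. v t x - v t0 x)"
          using True by (auto simp: eventually_at_filter vT)
      qed
      ultimately show ?thesis by simp
    next
      \<comment> \<open>Here t1 < T \<le> t0, so near t0 the function \<open>v\<close> vanishes
        almost everywhere and its distance to \<open>v t0\<close> is eventually 0.\<close>
      case False
      have "\<forall>\<^sub>F t in at t0 within {0..}. t1 < t"
        using False t by (intro order_tendstoD(1)[OF tendsto_ident_at]) auto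
      moreover have "\<forall>\<^sub>F t in at t0 within {0..}. t \<in> {0..}" by (simp add: eventually_at_filter)
      ultimately have "\<forall>\<^sub>F t in at t0 within {0..}. Znorm s r (\<lambda>x. v t x - v t0 x) = 0"
      proof eventually_elim
        case (elim t)
        have [measurable]: "v t \<in> borel_measurable borel" "v t0 \<in> borel_measurable borel"
          using ZspaceD(2)[OF vZ] elim t0 by auto
        have "AE x in lborel. v t x = 0" "AE x in lborel. v t0 x = 0" using v0 elim False t by auto
        then have "AE x in lborel. v t x - v t0 x = 0" by eventually_elim simp
        then show ?case by (intro Zspace_AE_zero(2)) measurable
      qed
      then show ?thesis by (rule tendsto_eventually)
    qed
  qed
  have "\<exists>w. has_L2_integral (\<lambda>\<tau>. groupA \<alpha> (t - \<tau>) (opA \<alpha> (\<lambda>x. (v \<tau> x)\<^sup>2))) w {0..t} \<and>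
        (AE x in lborel. v t x = groupA \<alpha> t (v 0) x + w x)" if t0: "t \<ge> 0" for t
  proof (cases "t \<le> T")
    case True
    then have "t \<in> {0..T}" using t0 by simp
    from sol[unfolded Z_solution_def, THEN conjunct2, rule_format, OF this]
    obtain w where w: "has_L2_integral (\<lambda>\<tau>. groupA \<alpha> (t - \<tau>) (opA \<alpha> (\<lambda>x. (u \<tau> x)\<^sup>2))) w {0..t}"
      "AE x in lborel. u t x = groupA \<alpha> t (u 0) x + w x" by blast
    have "has_L2_integral (\<lambda>\<tau>. groupA \<alpha> (t - \<tau>) (opA \<alpha> (\<lambda>x. (v \<tau> x)\<^sup>2))) w {0..t}"
      by (rule has_L2_integral_cong[OF w(1)]) (use True in \<open>simp add: vT\<close>)
    then show ?thesis using w(2) True t by (auto simp: vT)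
  next
    case False
    define d where "d = t - T"
    have T: "T \<in> {0..T}" "0 \<in> {0..T}" using t by auto
    have v0': "v 0 = u 0" using t by (simp add: vT)
    note Z0 = ZspaceD(1)[OF Zspace[OF T(2)]]
    from sol[unfolded Z_solution_def, THEN conjunct2, rule_format, OF T(1)]
    obtain wT where wT: "has_L2_integral (\<lambda>\<tau>. groupA \<alpha> (T - \<tau>) (opA \<alpha> (\<lambda>x. (u \<tau> x)\<^sup>2))) wT {0..T}"
      "AE x in lborel. u T x = groupA \<alpha> T (u 0) x + wT x" by blast
    have wTsq: "square_integrable wT" using wT(1) by (simp add: has_L2_integral_def)
    have "AE x in lborel. u T x = 0" using zero_preserved[OF t(1) _ _ zero, of T] t by simp
    with wT(2) have wT0: "AE x in lborel. wT x = - groupA \<alpha> T (u 0) x" by eventually_elim simp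
    let ?F = "\<lambda>\<tau>. groupA \<alpha> (t - \<tau>) (opA \<alpha> (\<lambda>x. (v \<tau> x)\<^sup>2))"
    let ?FT = "\<lambda>\<tau>. groupA \<alpha> (T - \<tau>) (opA \<alpha> (\<lambda>x. (u \<tau> x)\<^sup>2))"
    \<comment> \<open>The free evolution has to be cancelled exactly, as the extended solution is 0
      at time t.\<close>
    let ?w = "\<lambda>x. - groupA \<alpha> t (u 0) x"
    have late: "square_integrable (?F \<tau>)" "AE x in lborel. ?F \<tau> x = 0" if "\<tau> > T" for \<tau>
    proof -
      have "(\<lambda>x. (v \<tau> x)\<^sup>2) = (\<lambda>x. 0)" using that by (simp add: v_def)
      then show "square_integrable (?F \<tau>)" "AE x in lborel. ?F \<tau> x = 0"
        using groupA_spec(1)[OF alpha(1) opA_zero(1)[OF alpha(1)]] groupA_AE_zero[OF alpha(1) opA_zero[OF alpha(1)]]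
        by simp_all
    qed
    have F_sq: "square_integrable (?F \<tau>)" if "\<tau> \<in> {0..t}" for \<tau>
      using integrand_spec(1)[of \<tau> t] late(1)[of \<tau>] that by (cases "\<tau> \<le> T") (auto simp: vT)
    have F_L2: "indicator {0..t} \<tau> *\<^sub>R L2norm (?F \<tau>) = indicator {0..T} \<tau> *\<^sub>R L2norm (?FT \<tau>)" for \<tau>
    proof (cases "\<tau> \<in> {0..T}")
      case True
      then show ?thesis
        using False nonlinear_term_spec(1)[OF True] by (simp add: vT L2norm_groupA[OF alpha(1)])
    next
      case F: False
      then show ?thesis using L2norm_zero_AE[OF late] False by (cases "\<tau> > T") auto
    qed
    \<comment> \<open>With t - \<tau> = (T - \<tau>) + d, the extra propagation by d is moved onto
      the test function. The integral to be verified at t thereby becomes the one known at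
      T.\<close>
    have pair: "indicator {0..t} \<tau> *\<^sub>R (\<integral>x. ?F \<tau> x * g x \<partial>lborel)
        = indicator {0..T} \<tau> *\<^sub>R (\<integral>x. ?FT \<tau> x * groupA \<alpha> (- d) g x \<partial>lborel)" if g: "square_integrable g" for g \<tau>
    proof (cases "\<tau> \<in> {0..T}")
      case True
      have e: "t - \<tau> = (T - \<tau>) + d" by (simp add: d_def)
      have "(\<integral>x. ?F \<tau> x * g x \<partial>lborel) = (\<integral>x. ?FT \<tau> x * groupA \<alpha> (- d) g x \<partial>lborel)"
        using True groupA_adjoint[OF alpha(1) nonlinear_term_spec(1)[OF True] g, of "T - \<tau>" d]
        unfolding e by (simp add: vT)
      then show ?thesis using True False by simp
    next
      case F: False
      show ?thesis
      proof (cases "\<tau> > T")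
        case True
        have "(\<integral>x. ?F \<tau> x * g x \<partial>lborel) = integral\<^sup>L lborel (\<lambda>x::real. 0::real)"
          using late[OF True] borel_measurable_square_integrable[OF g] borel_measurable_square_integrable[OF late(1)[OF True]]
          by (intro integral_cong_AE) (auto elim!: eventually_mono)
        then show ?thesis using F by simp
      qed (use F False in auto)
    qed
    have "has_L2_integral ?F ?w {0..t}"
      unfolding has_L2_integral_def
    proof (intro conjI ballI allI impI)
      show "square_integrable ?w" by (intro square_integrable_uminus groupA_spec(1)[OF alpha(1) Z0])
      show "square_integrable (?F \<tau>)" if "\<tau> \<in> {0..t}" for \<tau> by (rule F_sq[OF that])
      show "set_integrable lborel {0..t} (\<lambda>\<tau>. L2norm (?F \<tau>))"
        using wT(1) unfolding has_L2_integral_def set_integrable_def F_L2 by simp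
      fix g :: "real \<Rightarrow> real" assume g: "square_integrable g"
      have g': "square_integrable (groupA \<alpha> (- d) g)" by (rule groupA_spec(1)[OF alpha(1) g])
      show "set_integrable lborel {0..t} (\<lambda>\<tau>. \<integral>x. ?F \<tau> x * g x \<partial>lborel)"
        using wT(1) g' unfolding has_L2_integral_def set_integrable_def pair[OF g] by simp
      have "(\<integral>x. ?w x * g x \<partial>lborel) = - (\<integral>x. groupA \<alpha> (T + d) (u 0) x * g x \<partial>lborel)" by (simp add: d_def)
      also have "\<dots> = - (\<integral>x. groupA \<alpha> T (u 0) x * groupA \<alpha> (- d) g x \<partial>lborel)"
        by (simp only: groupA_adjoint[OF alpha(1) Z0 g])
      also have "\<dots> = (\<integral>x. - (groupA \<alpha> T (u 0) x * groupA \<alpha> (- d) g x) \<partial>lborel)" by simp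
      also have "\<dots> = (\<integral>x. wT x * groupA \<alpha> (- d) g x \<partial>lborel)"
        using wT0 borel_measurable_square_integrable[OF wTsq] borel_measurable_square_integrable[OF g']
          borel_measurable_square_integrable[OF groupA_spec(1)[OF alpha(1) Z0, of T]]
        by (intro integral_cong_AE) (auto elim!: eventually_mono)
      also have "\<dots> = (LINT \<tau>:{0..T}|lborel. (\<integral>x. ?FT \<tau> x * groupA \<alpha> (- d) g x \<partial>lborel))"
        using wT(1) g' unfolding has_L2_integral_def by blast
      finally show "(\<integral>x. ?w x * g x \<partial>lborel) = (LINT \<tau>:{0..t}|lborel. (\<integral>x. ?F \<tau> x * g x \<partial>lborel))"
        unfolding set_lebesgue_integral_def pair[OF g] .
    qed
    moreover have "AE x in lborel. v t x = groupA \<alpha> t (v 0) x + ?w x"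
      unfolding v0' using False by (simp add: v_def)
    ultimately show ?thesis by blast
  qed
  with cont show "Z_solution \<alpha> s r {0..} v" by (simp add: Z_solution_def)
qed

end

text \<open>As u is given only on [0, T], vanishing on the unbounded interval is expressed by a
  global solution that agrees with u up to T and vanishes from t1 on.\<close>

theorem theorem1p2:
  fixes \<alpha> s :: real
  assumes "0 < \<alpha>" "\<alpha> < 1" "s > s_crit \<alpha>"
  shows "\<exists>\<epsilon>0>0. \<forall>\<epsilon>. 0 < \<epsilon> \<and> \<epsilon> < \<epsilon>0 \<longrightarrow>
    (\<forall>(T::real) (t1::real) (t2::real) (u :: real \<Rightarrow> real \<Rightarrow> real).
       Z_solution \<alpha> s (3/2 + \<alpha> - \<epsilon>) {0..T} u \<and> 0 \<le> t1 \<and> t1 < t2 \<and> t2 < T \<and>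
       u t1 \<in> Zspace s (3/2 + \<alpha>) \<and> u t2 \<in> Zspace s (3/2 + \<alpha>) \<longrightarrow>
         integrable lborel (u t1) \<and>
         set_integrable lborel {t1..t2} (\<lambda>\<tau>. \<integral>x. (u \<tau> x)\<^sup>2 \<partial>lborel) \<and>
         fourier (u t1) 0 = complex_of_real (\<integral>x. u t1 x \<partial>lborel) \<and>
         (\<integral>x. u t1 x \<partial>lborel) =
           - (1 / (t2 - t1)) * (LINT \<tau>:{t1..t2}|lborel. (\<integral>x. (u \<tau> x)\<^sup>2 \<partial>lborel)) \<and>
         ((\<integral>x. u t1 x \<partial>lborel) \<ge> 0 \<longleftrightarrow>
           (\<exists>v. Z_solution \<alpha> s (3/2 + \<alpha> - \<epsilon>) {0..} v \<and>
              (\<forall>t\<in>{0..T}. AE x in lborel. v t x = u t x) \<and>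
              (\<forall>t\<ge>t1. AE x in lborel. v t x = 0))))"
proof (intro exI[of _ "1/2"] conjI allI impI; (elim conjE)?)
  fix \<epsilon> T t1 t2 :: real and u :: "real \<Rightarrow> real \<Rightarrow> real"
  assume \<epsilon>: "0 < \<epsilon>" "\<epsilon> < 1/2" and sol: "Z_solution \<alpha> s (3/2 + \<alpha> - \<epsilon>) {0..T} u"
    and t: "0 \<le> t1" "t1 < t2" "t2 < T"
    and w: "u t1 \<in> Zspace s (3/2 + \<alpha>)" "u t2 \<in> Zspace s (3/2 + \<alpha>)"
  \<comment> \<open>Both branches of \<open>s_crit\<close> are at least 1: for \<alpha> < 1/2 the
    value 2 - 2 \<alpha> exceeds 1.\<close>
  have s: "s > 1" using assms by (auto simp: s_crit_def split: if_splits)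
  \<comment> \<open>From \<epsilon> < 1/2 it follows that 3/2 + \<alpha> - \<epsilon> > 1 +
    \<alpha>, which covers the requirement r \<ge> 1.\<close>
  interpret z_solution \<alpha> s "3/2 + \<alpha> - \<epsilon>" T u
    by unfold_locales (use assms s \<epsilon> sol in auto)
  let ?r = "3/2 + \<alpha> - \<epsilon>" and ?P = "\<lambda>\<tau>. \<integral>x. (u \<tau> x)\<^sup>2 \<partial>lborel" and ?I = "\<integral>x. u t1 x \<partial>lborel"
  have t1: "t1 \<in> {0..T}" using t by auto
  note Z1 = Zspace[OF t1]
  have "continuous_on {t1..t2} ?P" and id: "(t2 - t1) * ?I + integral {t1..t2} ?P = 0"
    using mean_identity[of t1 t2] t w by auto
  note cP = this(1)
  show i1: "integrable lborel (u t1)" by (rule integrable_Zspace[OF s r Z1])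
  show iP: "set_integrable lborel {t1..t2} ?P" by (rule borel_integrable_atLeastAtMost'[OF cP])
  show "fourier (u t1) 0 = complex_of_real ?I" by (simp add: fourier_def)
  have L: "(LINT \<tau>:{t1..t2}|lborel. ?P \<tau>) = integral {t1..t2} ?P"
    by (rule set_borel_integral_eq_integral(2)[OF iP])
  show "?I = - (1 / (t2 - t1)) * (LINT \<tau>:{t1..t2}|lborel. ?P \<tau>)"
    using id t unfolding L by (simp add: field_simps)
  show "?I \<ge> 0 \<longleftrightarrow> (\<exists>v. Z_solution \<alpha> s ?r {0..} v \<and>
      (\<forall>t\<in>{0..T}. AE x in lborel. v t x = u t x) \<and> (\<forall>t\<ge>t1. AE x in lborel. v t x = 0))"
  proof
    assume I: "?I \<ge> 0"
    have "integral {t1..t2} ?P = - ((t2 - t1) * ?I)" using id by simp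
    also have "\<dots> \<le> 0" using I t by simp
    finally have "integral {t1..t2} ?P = 0"
      using Henstock_Kurzweil_Integration.integral_nonneg[OF integrable_continuous_interval[OF cP]] by fastforce
    then have "(?P has_integral 0) (cbox t1 t2)"
      using integrable_integral[OF integrable_continuous_interval[OF cP]] by simp
    \<comment> \<open>A continuous nonnegative integrand with zero integral vanishes everywhere on
      the closed interval, in particular at the end point t1; t1 < t2 makes the interval
      nondegenerate.\<close>
    from has_integral_0_cbox_imp_0[OF _ _ this, of t1] cP t have "?P t1 = 0" by auto
    then have "L2norm (u t1) = 0" by (simp add: L2norm_def)
    then have z: "AE x in lborel. u t1 x = 0" by (rule L2norm_eq_0[OF ZspaceD(1)[OF Z1]])
    show "\<exists>v. Z_solution \<alpha> s ?r {0..} v \<and>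
      (\<forall>t\<in>{0..T}. AE x in lborel. v t x = u t x) \<and> (\<forall>t\<ge>t1. AE x in lborel. v t x = 0)"
      using extension_by_zero[OF t(1) _ z] t
      by (intro exI[of _ "\<lambda>t. if t \<le> T then u t else (\<lambda>x. 0)"]) auto
  next
    assume "\<exists>v. Z_solution \<alpha> s ?r {0..} v \<and>
      (\<forall>t\<in>{0..T}. AE x in lborel. v t x = u t x) \<and> (\<forall>t\<ge>t1. AE x in lborel. v t x = 0)"
    then obtain v where "AE x in lborel. v t1 x = u t1 x" "AE x in lborel. v t1 x = 0" using t1 by blast
    then have "AE x in lborel. u t1 x = 0" by eventually_elim simp
    then have "?I = integral\<^sup>L lborel (\<lambda>x::real. 0)"
      using ZspaceD(2)[OF Z1] by (intro integral_cong_AE) auto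
    then show "?I \<ge> 0" by simp
  qed
qed simp

end
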